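(* There exists a finite group $G$ with exactly three real-valued complex irreducible characters such that, for a Sylow $2$-subgroup $P$ of $G$, the quotient $P/Z_2(P)$ is a Suzuki $2$-group, where $Z_2(P)$ denotes the second term of the upper central series of $P$.
   Context: A group $S$ is a Suzuki $2$-group if $S$ is a nonabelian (finite) $2$-group, $S$ has more than one involution, and $S$ has a solvable group of automorphisms that transitively permutes the involutions of $S$. The upper central series of $P$ is indexed by $Z_1(P) = Z(P)$ and $Z_{n+1}(P)/Z_n(P) = Z(P/Z_n(P))$. *)

theory Defs
  imports
    "HOL-Algebra.Algebra"
    "HOL-Computational_Algebra.Primes"
    "Jordan_Normal_Form.VS_Connect"
begin

section \<open>Complex characters of a group\<close>

definition GL :: "nat \<Rightarrow> complex mat monoid" where
  "GL n = units_of (ring_mat TYPE(complex) n ())"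

definition trace :: "complex mat \<Rightarrow> complex" where
  "trace A = (\<Sum>i<dim_row A. A $$ (i, i))"

definition irreducible_rep ::
    "('a, 'b) monoid_scheme \<Rightarrow> nat \<Rightarrow> ('a \<Rightarrow> complex mat) \<Rightarrow> bool" where
  "irreducible_rep G n \<rho> \<longleftrightarrow>
     \<rho> \<in> hom G (GL n) \<and> n > 0 \<and>
     (\<forall>W. subspace class_ring W (module_vec TYPE(complex) n) \<and>
          (\<forall>g\<in>carrier G. \<forall>w\<in>W. \<rho> g *\<^sub>v w \<in> W) \<longrightarrow>
          W = {0\<^sub>v n} \<or> W = carrier_vec n)"

text \<open>Characters are restricted to the carrier (they are \<^const>\<open>undefined\<close> elsewhere), so that equality
  of characters as HOL functions is equality on the group.\<close>

definition character ::
    "('a, 'b) monoid_scheme \<Rightarrow> ('a \<Rightarrow> complex mat) \<Rightarrow> 'a \<Rightarrow> complex" where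
  "character G \<rho> = (\<lambda>g\<in>carrier G. trace (\<rho> g))"

definition Irr :: "('a, 'b) monoid_scheme \<Rightarrow> ('a \<Rightarrow> complex) set" where
  "Irr G = {character G \<rho> | n \<rho>. irreducible_rep G n \<rho>}"

definition real_valued_Irr :: "('a, 'b) monoid_scheme \<Rightarrow> ('a \<Rightarrow> complex) set" where
  "real_valued_Irr G = {\<chi> \<in> Irr G. \<forall>g\<in>carrier G. \<chi> g \<in> \<real>}"


section \<open>Sylow subgroups and the upper central series\<close>

definition sylow_subgroup :: "nat \<Rightarrow> 'a set \<Rightarrow> ('a, 'b) monoid_scheme \<Rightarrow> bool" where
  "sylow_subgroup p P G \<longleftrightarrow>
     subgroup P G \<and> card P = p ^ multiplicity p (card (carrier G))"

definition center :: "('a, 'b) monoid_scheme \<Rightarrow> 'a set" where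
  "center G = {z \<in> carrier G. \<forall>x\<in>carrier G. z \<otimes>\<^bsub>G\<^esub> x = x \<otimes>\<^bsub>G\<^esub> z}"

text \<open>The series is started at the trivial subgroup; the term with index 1 is then the center.\<close>

primrec upper_central :: "('a, 'b) monoid_scheme \<Rightarrow> nat \<Rightarrow> 'a set" where
  "upper_central G 0 = {\<one>\<^bsub>G\<^esub>}"
| "upper_central G (Suc n) =
     {x \<in> carrier G. upper_central G n #>\<^bsub>G\<^esub> x \<in> center (G Mod upper_central G n)}"

lemma (in group) upper_central_1: "upper_central G 1 = center G"
  by (auto simp: center_def FactGroup_def RCOSETS_def r_coset_def set_mult_def)

lemma (in group) upper_central_normal: "upper_central G n \<lhd> G"
proof (induction n)
  case 0
  show ?case by (simp add: one_is_normal)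
next
  case (Suc n)
  let ?N = "upper_central G n"
  let ?Z = "upper_central G (Suc n)"
  interpret N: normal ?N G by (rule Suc)
  have mem: "x \<in> ?Z \<longleftrightarrow> x \<in> carrier G \<and>
      (\<forall>y\<in>carrier G. ?N #> (x \<otimes> y) = ?N #> (y \<otimes> x))" for x
    by (auto simp: center_def FactGroup_def RCOSETS_def N.rcos_sum)
  have shift: "?N #> (a \<otimes> x \<otimes> b) = ?N #> (a \<otimes> y \<otimes> b)"
    if "?N #> x = ?N #> y" "a \<in> carrier G" "b \<in> carrier G" "x \<in> carrier G" "y \<in> carrier G"
    for a b x y
    using that by (metis N.rcos_sum m_closed)
  show ?case
  proof (rule normal_invI)
    show "subgroup ?Z G"
    proof (rule subgroupI)
      show "?Z \<subseteq> carrier G" by auto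
      have "\<one> \<in> ?Z" unfolding mem by simp
      then show "?Z \<noteq> {}" by blast
    next
      fix a assume "a \<in> ?Z"
      then have a: "a \<in> carrier G"
        and ac: "\<And>y. y \<in> carrier G \<Longrightarrow> ?N #> (a \<otimes> y) = ?N #> (y \<otimes> a)"
        unfolding mem by auto
      have "?N #> (inv a \<otimes> y) = ?N #> (y \<otimes> inv a)" if y: "y \<in> carrier G" for y
        using shift[OF ac[OF y, symmetric], of "inv a" "inv a"] a y
        by (simp add: m_assoc) (simp add: m_assoc[symmetric])
      then show "inv a \<in> ?Z" unfolding mem using a by simp
    next
      fix a b assume "a \<in> ?Z" "b \<in> ?Z"
      then have a: "a \<in> carrier G" "b \<in> carrier G"
        and ac: "\<And>y. y \<in> carrier G \<Longrightarrow> ?N #> (a \<otimes> y) = ?N #> (y \<otimes> a)"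
        and bc: "\<And>y. y \<in> carrier G \<Longrightarrow> ?N #> (b \<otimes> y) = ?N #> (y \<otimes> b)"
        unfolding mem by auto
      have "?N #> (a \<otimes> b \<otimes> y) = ?N #> (y \<otimes> (a \<otimes> b))" if y: "y \<in> carrier G" for y
        using shift[OF bc[OF y], of a \<one>] shift[OF ac[OF y], of \<one> b] a y
        by (simp add: m_assoc)
      then show "a \<otimes> b \<in> ?Z" unfolding mem using a by simp
    qed
  next
    fix x h assume x: "x \<in> carrier G" and "h \<in> ?Z"
    then have h: "h \<in> carrier G"
      and hc: "\<And>y. y \<in> carrier G \<Longrightarrow> ?N #> (h \<otimes> y) = ?N #> (y \<otimes> h)"
      unfolding mem by auto
    have e: "?N #> (x \<otimes> h \<otimes> inv x) = ?N #> h"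
      using shift[OF hc[OF x, symmetric], of \<one> "inv x"] x h by (simp add: m_assoc)
    have "?N #> (x \<otimes> h \<otimes> inv x \<otimes> y) = ?N #> (y \<otimes> (x \<otimes> h \<otimes> inv x))"
      if y: "y \<in> carrier G" for y
      using shift[OF e, of \<one> y] shift[OF e, of y \<one>] hc[OF y] x h y by simp
    then show "x \<otimes> h \<otimes> inv x \<in> ?Z" unfolding mem using x h by simp
  qed
qed

lemma upper_central_Suc_image:
  "(\<lambda>x. upper_central G n #>\<^bsub>G\<^esub> x) ` upper_central G (Suc n) = center (G Mod upper_central G n)"
  by (auto simp: center_def FactGroup_def RCOSETS_def)


section \<open>Suzuki 2-groups\<close>

definition involutions :: "('a, 'b) monoid_scheme \<Rightarrow> 'a set" where
  "involutions S = {x \<in> carrier S. x \<noteq> \<one>\<^bsub>S\<^esub> \<and> x \<otimes>\<^bsub>S\<^esub> x = \<one>\<^bsub>S\<^esub>}"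

definition suzuki_2_group :: "('a, 'b) monoid_scheme \<Rightarrow> bool" where
  "suzuki_2_group S \<longleftrightarrow>
     group S \<and> finite (carrier S) \<and> (\<exists>k. card (carrier S) = 2 ^ k) \<and> \<not> comm_group S \<and>
     card (involutions S) > 1 \<and>
     (\<exists>A. subgroup A (AutoGroup S) \<and> solvable (AutoGroup S\<lparr>carrier := A\<rparr>) \<and>
          (\<forall>x\<in>involutions S. \<forall>y\<in>involutions S. \<exists>\<alpha>\<in>A. \<alpha> x = y))"

end

theory Submission
  imports Defs "Jordan_Normal_Form.Spectral_Radius"
begin

text \<open>
  The number of real-valued irreducible characters of a finite group is its number of real conjugacy
  classes: integrating \<open>\<chi> x * \<chi> x\<close> over the group detects whether \<open>\<chi>\<close> is real, and column orthogonality
  turns the sum of these squares over all \<open>\<chi>\<close> into a count of real classes.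

  Let \<open>\<theta>\<close> be the Frobenius automorphism of \<open>F\<close>, the field with eight elements, and \<open>R = F[X; \<theta>] / X\<^sup>5\<close>
  with \<open>X a = \<theta> a X\<close>. The group is \<open>{f \<in> R\<^sup>\<times>. nu f = 0}\<close> extended by the Galois group of \<open>F\<close>, where
  \<open>nu f\<close> is the coefficient of \<open>X\<^sup>3\<close> in the reduced norm of \<open>f\<close>; its order is \<open>2\<^sup>1\<^sup>1 * 7 * 3\<close> and its
  normal Sylow 2-subgroup \<open>P\<close> consists of the \<open>1 + a X + b X\<^sup>2 + c X\<^sup>3 + d X\<^sup>4\<close> with \<open>nu = 0\<close>.
  As the index of \<open>P\<close> is odd, an element conjugate to its inverse lies in \<open>P\<close> and is inverted by an
  element of \<open>P\<close>; comparing coefficients (and using that the trace of 1 is 1) forces \<open>a = b = 0\<close>. The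
  remaining 32 elements form three classes: the identity, the involutions with \<open>c = 0\<close>, which are
  permuted transitively by \<open>F\<^sup>\<times>\<close>, and the others, where the Galois group permutes the three possible
  values of \<open>c\<close> and conjugation by \<open>P\<close> moves \<open>d\<close>. Finally \<open>Z\<^sub>2(P)\<close> is given by \<open>a = b = 0\<close>, so that
  \<open>P / Z\<^sub>2(P)\<close> is the Suzuki 2-group of pairs \<open>(a, b)\<close>.
\<close>

section \<open>Linear algebra\<close>

text \<open>The shape of the group is dictated by two layers. Modulo X^4 every 1 + b X^2 + c X^3
  squares to 1, so only the coefficient of X^4 can keep elements with b nonzero from being real;
  hence the truncation at X^5. On the layer 1 + c X^3 + d X^4, conjugation by scalars fixes c
  because X^3 commutes with them, and conjugation by P moves d only if c differs from its image
  under \<theta>. The involution 1 + X^3 would therefore contribute extra real classes; the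
  condition \<open>nu = 0\<close> reads tr c = 0 on this layer and excludes c = 1, while the Galois
  group fuses the remaining values of c. On the side of characters, \<open>Irr\<close> collects
  functions coming from representations of every degree, so its finiteness is itself a consequence
  of orthogonality. Completeness rests on a single irreducible subrepresentation inside an image,
  not on a decomposition of the regular representation. The statement asks for a group on the
  natural numbers and for all of its Sylow 2-subgroups, so the results about the concrete group are
  carried along an isomorphism.\<close>

lemma subspace_carrier_vec_iff:
  "VectorSpace.subspace class_ring W (module_vec TYPE(complex) n) \<longleftrightarrow>
     W \<subseteq> carrier_vec n \<and> 0\<^sub>v n \<in> W \<and> (\<forall>v\<in>W. \<forall>w\<in>W. v + w \<in> W) \<and> (\<forall>c. \<forall>v\<in>W. c \<cdot>\<^sub>v v \<in> W)"
proof -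
  interpret vec_space "TYPE(complex)" n .
  show ?thesis
    unfolding VectorSpace.subspace_def submodule_def
    by (auto simp: module_vec_simps vectorspace_axioms module_axioms vec_vs vec_module)
qed

text \<open>Linear independence of the columns, phrased as a trivial kernel: bases of subspaces and
  comparisons of dimensions are handled through such matrices.\<close>

definition inj_mat :: "complex mat \<Rightarrow> bool" where
  "inj_mat B \<longleftrightarrow> (\<forall>v\<in>carrier_vec (dim_col B). B *\<^sub>v v = 0\<^sub>v (dim_row B) \<longrightarrow> v = 0\<^sub>v (dim_col B))"

lemma inj_matD:
  "inj_mat B \<Longrightarrow> B \<in> carrier_mat n k \<Longrightarrow> v \<in> carrier_vec k \<Longrightarrow> B *\<^sub>v v = 0\<^sub>v n \<Longrightarrow> v = 0\<^sub>v k"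
  by (auto simp: inj_mat_def)

lemma mult_mat_vec_zero: "A \<in> carrier_mat n m \<Longrightarrow> A *\<^sub>v 0\<^sub>v m = (0\<^sub>v n :: complex vec)"
  by (intro eq_vecI) (auto simp: scalar_prod_def)

lemma mult_mat_vec_unit: "A \<in> carrier_mat n m \<Longrightarrow> j < m \<Longrightarrow> A *\<^sub>v unit_vec m j = (col A j :: complex vec)"
  by (intro eq_vecI) auto

lemma smult_one_mult_vec:
  assumes "v \<in> carrier_vec n"
  shows "(c \<cdot>\<^sub>m 1\<^sub>m n) *\<^sub>v v = c \<cdot>\<^sub>v (v :: complex vec)"
proof (rule eq_vecI)
  fix i assume "i < dim_vec (c \<cdot>\<^sub>v v)"
  then have i: "i < n" using assms by simp
  have "((c \<cdot>\<^sub>m 1\<^sub>m n) *\<^sub>v v) $ i = (\<Sum>j<n. (c \<cdot>\<^sub>m 1\<^sub>m n) $$ (i, j) * v $ j)"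
    using i assms by (auto simp: scalar_prod_def lessThan_atLeast0 intro!: sum.cong)
  also have "\<dots> = (\<Sum>j<n. if j = i then c * v $ j else 0)"
    by (rule sum.cong) (use i in auto)
  finally show "((c \<cdot>\<^sub>m 1\<^sub>m n) *\<^sub>v v) $ i = (c \<cdot>\<^sub>v v) $ i" using i assms by simp
qed (use assms in auto)

lemma inj_mat_square:
  assumes B: "B \<in> carrier_mat k k" and inj: "inj_mat B"
  obtains C where "C \<in> carrier_mat k k" "B * C = 1\<^sub>m k" "C * B = 1\<^sub>m k"
proof -
  have "det B \<noteq> 0"
    using det_0_iff_vec_prod_zero_field[OF B] inj_matD[OF inj B] by auto
  then show thesis
    using det_non_zero_imp_unit[OF B, of "()"] that
    by (auto simp: Units_def ring_mat_simps)
qed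

text \<open>With more columns than rows, padding by zero rows gives a square matrix of determinant
  0, which has a nonzero kernel vector.\<close>

lemma inj_mat_dims:
  assumes B: "B \<in> carrier_mat n k" and inj: "inj_mat B"
  shows "k \<le> n"
proof (rule ccontr)
  assume "\<not> k \<le> n"
  then have less: "n < k" by simp
  define A where "A = mat k k (\<lambda>(i, j). if i < n then B $$ (i, j) else 0)"
  have A: "A \<in> carrier_mat k k" by (simp add: A_def)
  have eq: "A = mat\<^sub>r k k (\<lambda>i. if i = n then 0\<^sub>v k else row A i)"
    using less by (intro eq_matI) (auto simp: A_def)
  have "det A = 0"
    by (subst eq, rule det_row_0[OF less]) (use A in auto)
  then obtain v where v: "v \<in> carrier_vec k" "v \<noteq> 0\<^sub>v k" "A *\<^sub>v v = 0\<^sub>v k"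
    using det_0_iff_vec_prod_zero_field[OF A] by auto
  have "B *\<^sub>v v = 0\<^sub>v n"
  proof (rule eq_vecI)
    fix i assume i: "i < dim_vec (0\<^sub>v n :: complex vec)"
    have "(B *\<^sub>v v) $ i = (A *\<^sub>v v) $ i"
      using i less B v(1) by (auto simp: A_def scalar_prod_def intro!: sum.cong)
    then show "(B *\<^sub>v v) $ i = 0\<^sub>v n $ i" using i less v(3) by simp
  qed (use B in auto)
  then show False using inj_matD[OF inj B v(1)] v(2) by simp
qed

lemma inj_mat_mult:
  assumes B: "B \<in> carrier_mat n k" and C: "C \<in> carrier_mat k l" and "inj_mat B" "inj_mat C"
  shows "inj_mat (B * C)"
  unfolding inj_mat_def
proof (intro ballI impI)
  fix v assume v: "v \<in> carrier_vec (dim_col (B * C))" "B * C *\<^sub>v v = 0\<^sub>v (dim_row (B * C))"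
  then have v1: "v \<in> carrier_vec l" and "B *\<^sub>v (C *\<^sub>v v) = 0\<^sub>v n" using B C by auto
  then have "C *\<^sub>v v = 0\<^sub>v k"
    using inj_matD[OF assms(3) B, of "C *\<^sub>v v"] C by auto
  then show "v = 0\<^sub>v (dim_col (B * C))" using inj_matD[OF assms(4) C v1] C by simp
qed

lemma mult_mat_vec_mem:
  assumes B: "B \<in> carrier_mat n k" and v: "v \<in> carrier_vec k"
    and W: "VectorSpace.subspace class_ring W (module_vec TYPE(complex) n)"
    and c: "\<And>j. j < k \<Longrightarrow> col B j \<in> W"
  shows "B *\<^sub>v v \<in> W"
proof -
  \<comment> \<open>Partial sums over the first \<open>m\<close> columns, so that the closure
    properties of \<open>W\<close> can be applied one column at a time.\<close>
  define p where "p m = vec n (\<lambda>i. \<Sum>j<m. B $$ (i, j) * v $ j)" for m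
  have "m \<le> k \<Longrightarrow> p m \<in> W" for m
  proof (induction m)
    case 0
    have "p 0 = 0\<^sub>v n" by (auto simp: p_def)
    then show ?case using W by (simp add: subspace_carrier_vec_iff)
  next
    case (Suc m)
    have "p (Suc m) = p m + v $ m \<cdot>\<^sub>v col B m"
      using Suc.prems B by (intro eq_vecI) (auto simp: p_def)
    then show ?case using W Suc c[of m] by (simp add: subspace_carrier_vec_iff)
  qed
  moreover have "B *\<^sub>v v = p k"
    using B v by (intro eq_vecI) (auto simp: p_def scalar_prod_def lessThan_atLeast0)
  ultimately show ?thesis by simp
qed

text \<open>The number of independent columns taken from \<open>W\<close> is bounded by
  \<open>n\<close>, so a maximal one exists; maximality forces the columns to span
  \<open>W\<close>.\<close>

lemma subspace_basis_mat:
  assumes W: "VectorSpace.subspace class_ring W (module_vec TYPE(complex) n)" and nz: "W \<noteq> {0\<^sub>v n}"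
  obtains k B where "k > 0" "B \<in> carrier_mat n k" "inj_mat B"
    "\<And>v. v \<in> carrier_vec k \<Longrightarrow> B *\<^sub>v v \<in> W"
    "\<And>w. w \<in> W \<Longrightarrow> \<exists>v\<in>carrier_vec k. B *\<^sub>v v = w"
proof -
  have Wc: "W \<subseteq> carrier_vec n" using W by (simp add: subspace_carrier_vec_iff)
  define P where "P k \<longleftrightarrow> (\<exists>B\<in>carrier_mat n k. inj_mat B \<and> (\<forall>j<k. col B j \<in> W))" for k
  have "P 0" unfolding P_def
    by (rule bexI[of _ "0\<^sub>m n 0"]) (auto simp: inj_mat_def)
  moreover have "\<forall>k. P k \<longrightarrow> k \<le> n" unfolding P_def using inj_mat_dims by blast
  ultimately obtain k where k: "P k" and max: "\<And>l. P l \<Longrightarrow> l \<le> k"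
    using Nat.ex_has_greatest_nat[of P 0 n] by auto
  then obtain B where B: "B \<in> carrier_mat n k" "inj_mat B" "\<And>j. j < k \<Longrightarrow> col B j \<in> W"
    unfolding P_def by auto
  have span: "\<exists>v\<in>carrier_vec k. B *\<^sub>v v = w" if w: "w \<in> W" for w
  proof (rule ccontr)
    assume no: "\<not> ?thesis"
    have wc: "w \<in> carrier_vec n" using w Wc by auto
    \<comment> \<open>A vector \<open>w\<close> outside the span could be appended as a further
      column, against maximality.\<close>
    define C where "C = mat n (Suc k) (\<lambda>(i, j). if j < k then B $$ (i, j) else w $ i)"
    have C: "C \<in> carrier_mat n (Suc k)" by (simp add: C_def)
    have Cv: "C *\<^sub>v v = B *\<^sub>v vec k (\<lambda>j. v $ j) + v $ k \<cdot>\<^sub>v w" if "v \<in> carrier_vec (Suc k)" for v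
      using that B(1) wc
      by (intro eq_vecI) (auto simp: C_def scalar_prod_def row_def)
    have "inj_mat C" unfolding inj_mat_def
    proof (intro ballI impI)
      fix v assume "v \<in> carrier_vec (dim_col C)" "C *\<^sub>v v = 0\<^sub>v (dim_row C)"
      then have v: "v \<in> carrier_vec (Suc k)" and z: "C *\<^sub>v v = 0\<^sub>v n" using C by auto
      let ?u = "vec k (\<lambda>j. v $ j)"
      have eq: "B *\<^sub>v ?u + v $ k \<cdot>\<^sub>v w = 0\<^sub>v n" using Cv[OF v] z by simp
      have idx: "(B *\<^sub>v ?u) $ i + v $ k * w $ i = 0" if "i < n" for i
        using arg_cong[OF eq, of "\<lambda>u. u $ i"] that wc B(1) by simp
      \<comment> \<open>Otherwise the kernel relation could be solved for \<open>w\<close>, which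
        would then lie in the span.\<close>
      have vk: "v $ k = 0"
      proof (rule ccontr)
        assume nz: "v $ k \<noteq> 0"
        have "B *\<^sub>v ((- inverse (v $ k)) \<cdot>\<^sub>v ?u) = (- inverse (v $ k)) \<cdot>\<^sub>v (B *\<^sub>v ?u)"
          by (rule mult_mat_vec[OF B(1)]) simp
        also have "\<dots> = w"
        proof (rule eq_vecI)
          fix i assume "i < dim_vec w"
          then have i: "i < n" using wc by simp
          have "(B *\<^sub>v ?u) $ i = - (v $ k * w $ i)" using idx[OF i] by (simp add: eq_neg_iff_add_eq_0)
          then show "((- inverse (v $ k)) \<cdot>\<^sub>v (B *\<^sub>v ?u)) $ i = w $ i" using i B(1) nz by simp
        qed (use wc B(1) in auto)
        finally show False using no by auto
      qed
      then have "B *\<^sub>v ?u = 0\<^sub>v n" using idx B(1) by (intro eq_vecI) auto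
      then have "?u = 0\<^sub>v k" using inj_matD[OF B(2,1)] by simp
      then have "v $ j = 0" if "j < k" for j using that by (metis index_vec index_zero_vec(1))
      then show "v = 0\<^sub>v (dim_col C)" using v vk C
        by (intro eq_vecI) (auto simp: less_Suc_eq)
    qed
    moreover have "col C j \<in> W" if "j < Suc k" for j
    proof (cases "j < k")
      case True
      then have "col C j = col B j" using B(1) by (intro eq_vecI) (auto simp: C_def)
      then show ?thesis using B(3) True by simp
    next
      case False
      then have "col C j = w" using that wc by (intro eq_vecI) (auto simp: C_def)
      then show ?thesis using w by simp
    qed
    ultimately have "P (Suc k)" using C unfolding P_def by auto
    then show False using max by fastforce
  qed
  have "k > 0"
  proof (rule ccontr)
    assume "\<not> k > 0"
    then have "B *\<^sub>v v = 0\<^sub>v n" if "v \<in> carrier_vec k" for v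
      using that B(1) by (intro eq_vecI) (auto simp: scalar_prod_def)
    then have "W \<subseteq> {0\<^sub>v n}" using span by force
    then show False using nz W by (auto simp: subspace_carrier_vec_iff)
  qed
  then show thesis using that[of k B] B span mult_mat_vec_mem[OF B(1) _ W B(3)] by blast
qed

text \<open>The dimensions are parameters because the type of matrices contains all sizes, which
  have no common zero matrix from which a sum could start.\<close>

definition mat_sum :: "nat \<Rightarrow> nat \<Rightarrow> 'i set \<Rightarrow> ('i \<Rightarrow> complex mat) \<Rightarrow> complex mat" where
  "mat_sum n m A F = mat n m (\<lambda>p. \<Sum>i\<in>A. F i $$ p)"

lemma mat_sum_carrier [simp]: "mat_sum n m A F \<in> carrier_mat n m"
  by (simp add: mat_sum_def)

lemma mat_sum_index: "i < n \<Longrightarrow> j < m \<Longrightarrow> mat_sum n m A F $$ (i, j) = (\<Sum>a\<in>A. F a $$ (i, j))"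
  by (simp add: mat_sum_def)

lemma mat_sum_cong: "(\<And>i. i \<in> A \<Longrightarrow> F i = H i) \<Longrightarrow> mat_sum n m A F = mat_sum n m A H"
  by (auto simp: mat_sum_def intro!: eq_matI sum.cong)

lemma mat_sum_reindex: "bij_betw h A B \<Longrightarrow> mat_sum n m B F = mat_sum n m A (\<lambda>i. F (h i))"
  by (auto simp: mat_sum_def sum.reindex_bij_betw[symmetric] intro!: eq_matI)

lemma mat_sum_mult_left:
  assumes "B \<in> carrier_mat k n" "\<And>i. i \<in> A \<Longrightarrow> F i \<in> carrier_mat n m"
  shows "B * mat_sum n m A F = mat_sum k m A (\<lambda>i. B * F i)"
proof (rule eq_matI)
  fix i j assume "i < dim_row (mat_sum k m A (\<lambda>i. B * F i))" "j < dim_col (mat_sum k m A (\<lambda>i. B * F i))"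
  then have ij: "i < k" "j < m" by (auto simp: mat_sum_def)
  have "(B * mat_sum n m A F) $$ (i, j) = (\<Sum>l<n. \<Sum>a\<in>A. B $$ (i, l) * F a $$ (l, j))"
    using ij assms(1) by (simp add: scalar_prod_def mat_sum_def sum_distrib_left lessThan_atLeast0)
  also have "\<dots> = (\<Sum>a\<in>A. \<Sum>l<n. B $$ (i, l) * F a $$ (l, j))" by (rule sum.swap)
  also have "\<dots> = (\<Sum>a\<in>A. (B * F a) $$ (i, j))"
  proof (rule sum.cong)
    fix a assume "a \<in> A"
    then have "F a \<in> carrier_mat n m" by (rule assms(2))
    then show "(\<Sum>l<n. B $$ (i, l) * F a $$ (l, j)) = (B * F a) $$ (i, j)"
      using ij assms(1) by (simp add: scalar_prod_def lessThan_atLeast0)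
  qed simp
  finally show "(B * mat_sum n m A F) $$ (i, j) = mat_sum k m A (\<lambda>i. B * F i) $$ (i, j)"
    using ij by (simp add: mat_sum_index)
qed (use assms in \<open>auto simp: mat_sum_def\<close>)

lemma mat_sum_mult_right:
  assumes "B \<in> carrier_mat m k" "\<And>i. i \<in> A \<Longrightarrow> F i \<in> carrier_mat n m"
  shows "mat_sum n m A F * B = mat_sum n k A (\<lambda>i. F i * B)"
proof (rule eq_matI)
  fix i j assume "i < dim_row (mat_sum n k A (\<lambda>i. F i * B))" "j < dim_col (mat_sum n k A (\<lambda>i. F i * B))"
  then have ij: "i < n" "j < k" by (auto simp: mat_sum_def)
  have "(mat_sum n m A F * B) $$ (i, j) = (\<Sum>l<m. \<Sum>a\<in>A. F a $$ (i, l) * B $$ (l, j))"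
    using ij assms(1) by (simp add: scalar_prod_def mat_sum_def sum_distrib_right lessThan_atLeast0)
  also have "\<dots> = (\<Sum>a\<in>A. \<Sum>l<m. F a $$ (i, l) * B $$ (l, j))" by (rule sum.swap)
  also have "\<dots> = (\<Sum>a\<in>A. (F a * B) $$ (i, j))"
  proof (rule sum.cong)
    fix a assume "a \<in> A"
    then have "F a \<in> carrier_mat n m" by (rule assms(2))
    then show "(\<Sum>l<m. F a $$ (i, l) * B $$ (l, j)) = (F a * B) $$ (i, j)"
      using ij assms(1) by (simp add: scalar_prod_def lessThan_atLeast0)
  qed simp
  finally show "(mat_sum n m A F * B) $$ (i, j) = mat_sum n k A (\<lambda>i. F i * B) $$ (i, j)"
    using ij by (simp add: mat_sum_index)
qed (use assms in \<open>auto simp: mat_sum_def\<close>)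

lemma mult_mat_vec_nth:
  "A \<in> carrier_mat n m \<Longrightarrow> v \<in> carrier_vec m \<Longrightarrow> i < n \<Longrightarrow>
     (A *\<^sub>v v) $ i = (\<Sum>j<m. A $$ (i, j) * v $ j)"
  by (simp add: scalar_prod_def lessThan_atLeast0)

lemma mult_mat_nth:
  "A \<in> carrier_mat n m \<Longrightarrow> B \<in> carrier_mat m k \<Longrightarrow> i < n \<Longrightarrow> l < k \<Longrightarrow>
     (A * B) $$ (i, l) = (\<Sum>j<m. A $$ (i, j) * B $$ (j, l))"
  by (simp add: scalar_prod_def lessThan_atLeast0)

lemma mat_sum_mult_vec_nth:
  assumes "\<And>a. a \<in> A \<Longrightarrow> F a \<in> carrier_mat n m" "v \<in> carrier_vec m" "i < n"
  shows "(mat_sum n m A F *\<^sub>v v) $ i = (\<Sum>a\<in>A. (F a *\<^sub>v v) $ i)"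
proof -
  have "(mat_sum n m A F *\<^sub>v v) $ i = (\<Sum>j<m. \<Sum>a\<in>A. F a $$ (i, j) * v $ j)"
    by (subst mult_mat_vec_nth[OF mat_sum_carrier assms(2,3)])
      (auto simp: mat_sum_index assms(3) sum_distrib_right intro!: sum.cong)
  also have "\<dots> = (\<Sum>a\<in>A. \<Sum>j<m. F a $$ (i, j) * v $ j)" by (rule sum.swap)
  also have "\<dots> = (\<Sum>a\<in>A. (F a *\<^sub>v v) $ i)"
    by (rule sum.cong[OF refl]) (rule mult_mat_vec_nth[symmetric, OF assms(1) assms(2,3)])
  finally show ?thesis .
qed

lemma trace_mat_sum:
  assumes "\<And>i. i \<in> A \<Longrightarrow> F i \<in> carrier_mat n n"
  shows "trace (mat_sum n n A F) = (\<Sum>i\<in>A. trace (F i))"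
proof -
  have "trace (mat_sum n n A F) = (\<Sum>k<n. \<Sum>i\<in>A. F i $$ (k, k))"
    by (simp add: trace_def mat_sum_def)
  also have "\<dots> = (\<Sum>i\<in>A. \<Sum>k<n. F i $$ (k, k))" by (rule sum.swap)
  also have "\<dots> = (\<Sum>i\<in>A. trace (F i))"
    unfolding trace_def by (rule sum.cong) (use assms in \<open>auto dest: carrier_matD\<close>)
  finally show ?thesis .
qed

lemma trace_mult_comm:
  assumes "A \<in> carrier_mat n m" "B \<in> carrier_mat m n"
  shows "trace (A * B) = trace (B * A)"
proof -
  have "trace (A * B) = (\<Sum>i<n. \<Sum>j<m. A $$ (i, j) * B $$ (j, i))"
    using assms by (auto simp: trace_def scalar_prod_def lessThan_atLeast0)
  also have "\<dots> = (\<Sum>j<m. \<Sum>i<n. B $$ (j, i) * A $$ (i, j))"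
    by (subst sum.swap) (simp add: mult.commute)
  also have "\<dots> = trace (B * A)"
    using assms by (auto simp: trace_def scalar_prod_def lessThan_atLeast0)
  finally show ?thesis .
qed

lemma trace_smult: "trace (c \<cdot>\<^sub>m A) = c * trace A" if "A \<in> carrier_mat n n"
  using that by (auto simp: trace_def sum_distrib_left)

lemma trace_one [simp]: "trace (1\<^sub>m n) = of_nat n"
  by (simp add: trace_def)

text \<open>The conjugate transpose, that is, the adjoint for the standard Hermitian form.\<close>

definition ctrans :: "complex mat \<Rightarrow> complex mat" where
  "ctrans A = mat (dim_col A) (dim_row A) (\<lambda>(i, j). cnj (A $$ (j, i)))"

lemma ctrans_carrier [simp]: "A \<in> carrier_mat n m \<Longrightarrow> ctrans A \<in> carrier_mat m n"
  by (simp add: ctrans_def)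

lemma ctrans_mult:
  assumes "A \<in> carrier_mat n m" "B \<in> carrier_mat m k"
  shows "ctrans (A * B) = ctrans B * ctrans A"
  using assms by (intro eq_matI) (auto simp: ctrans_def scalar_prod_def mult.commute intro!: sum.cong)

lemma trace_ctrans: "A \<in> carrier_mat n n \<Longrightarrow> trace (ctrans A) = cnj (trace A)"
  by (simp add: ctrans_def trace_def)

text \<open>This is v* A* A v = |A v|^2. Positivity of the right side later yields A v = 0, both
  from A* A v = 0 and from the vanishing of a sum of such terms.\<close>

lemma ctrans_mult_quadratic:
  assumes A: "A \<in> carrier_mat n m" and v: "v \<in> carrier_vec m"
  shows "(\<Sum>i<m. cnj (v $ i) * ((ctrans A * A) *\<^sub>v v) $ i) = of_real (\<Sum>j<n. (cmod ((A *\<^sub>v v) $ j))\<^sup>2)"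
proof -
  have Av: "(A *\<^sub>v v) $ j = (\<Sum>i<m. A $$ (j, i) * v $ i)" if "j < n" for j
    using that A v by (auto simp: scalar_prod_def lessThan_atLeast0)
  have "((ctrans A * A) *\<^sub>v v) $ i = (\<Sum>j<n. cnj (A $$ (j, i)) * (A *\<^sub>v v) $ j)" if "i < m" for i
  proof -
    have "(ctrans A * A) *\<^sub>v v = ctrans A *\<^sub>v (A *\<^sub>v v)"
      by (rule assoc_mult_mat_vec[of _ m n _ m]) (use A v in auto)
    also have "\<dots> $ i = (\<Sum>j<n. cnj (A $$ (j, i)) * (A *\<^sub>v v) $ j)"
      using that A by (auto simp: scalar_prod_def ctrans_def lessThan_atLeast0 intro!: sum.cong)
    finally show ?thesis .
  qed
  then have "(\<Sum>i<m. cnj (v $ i) * ((ctrans A * A) *\<^sub>v v) $ i)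
      = (\<Sum>i<m. \<Sum>j<n. cnj (v $ i) * (cnj (A $$ (j, i)) * (A *\<^sub>v v) $ j))"
    by (simp add: sum_distrib_left)
  also have "\<dots> = (\<Sum>j<n. \<Sum>i<m. cnj (v $ i) * (cnj (A $$ (j, i)) * (A *\<^sub>v v) $ j))"
    by (rule sum.swap)
  also have "\<dots> = (\<Sum>j<n. cnj ((A *\<^sub>v v) $ j) * (A *\<^sub>v v) $ j)"
  proof (rule sum.cong)
    fix j assume "j \<in> {..<n}"
    then have "cnj ((A *\<^sub>v v) $ j) = (\<Sum>i<m. cnj (v $ i) * cnj (A $$ (j, i)))"
      by (simp add: Av mult.commute)
    then show "(\<Sum>i<m. cnj (v $ i) * (cnj (A $$ (j, i)) * (A *\<^sub>v v) $ j)) =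
        cnj ((A *\<^sub>v v) $ j) * (A *\<^sub>v v) $ j"
      by (simp add: sum_distrib_right mult.assoc)
  qed simp
  also have "\<dots> = of_real (\<Sum>j<n. (cmod ((A *\<^sub>v v) $ j))\<^sup>2)"
    by (simp only: of_real_sum complex_norm_square) (simp add: mult.commute)
  finally show ?thesis .
qed

section \<open>Representations\<close>

locale finite_group = group G for G (structure) +
  assumes finite_carrier [simp]: "finite (carrier G)"
begin

text \<open>An equational form of homomorphisms into \<open>GL n\<close>; the values are invertible
  because \<open>\<rho> (inv g)\<close> inverts \<open>\<rho> g\<close>.\<close>

definition is_rep :: "nat \<Rightarrow> ('a \<Rightarrow> complex mat) \<Rightarrow> bool" where
  "is_rep n \<rho> \<longleftrightarrow> (\<forall>g\<in>carrier G. \<rho> g \<in> carrier_mat n n) \<and>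
     (\<forall>g\<in>carrier G. \<forall>h\<in>carrier G. \<rho> (g \<otimes> h) = \<rho> g * \<rho> h) \<and> \<rho> \<one> = 1\<^sub>m n"

lemma is_rep_carrier: "is_rep n \<rho> \<Longrightarrow> g \<in> carrier G \<Longrightarrow> \<rho> g \<in> carrier_mat n n"
  and is_rep_mult: "is_rep n \<rho> \<Longrightarrow> g \<in> carrier G \<Longrightarrow> h \<in> carrier G \<Longrightarrow> \<rho> (g \<otimes> h) = \<rho> g * \<rho> h"
  and is_rep_one: "is_rep n \<rho> \<Longrightarrow> \<rho> \<one> = 1\<^sub>m n"
  by (auto simp: is_rep_def)

lemma is_rep_inv:
  assumes "is_rep n \<rho>" "g \<in> carrier G"
  shows "\<rho> g * \<rho> (inv g) = 1\<^sub>m n" "\<rho> (inv g) * \<rho> g = 1\<^sub>m n"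
  using is_rep_mult[OF assms(1), of g "inv g"] is_rep_mult[OF assms(1), of "inv g" g]
    is_rep_one[OF assms(1)] assms(2) by auto

lemma is_rep_iff_hom: "is_rep n \<rho> \<longleftrightarrow> \<rho> \<in> hom G (GL n)"
proof
  assume rep: "is_rep n \<rho>"
  have "\<rho> g \<in> carrier (GL n)" if g: "g \<in> carrier G" for g
    using is_rep_inv[OF rep g] is_rep_carrier[OF rep g] is_rep_carrier[OF rep inv_closed[OF g]]
    by (auto simp: GL_def units_of_def Units_def ring_mat_simps)
  then show "\<rho> \<in> hom G (GL n)"
    using rep by (auto simp: hom_def is_rep_def GL_def units_of_def ring_mat_simps)
next
  assume h: "\<rho> \<in> hom G (GL n)"
  have "monoid (ring_mat TYPE(complex) n ())" using ring.is_monoid[OF ring_mat] .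
  then have "group (GL n)" unfolding GL_def by (rule monoid.units_group)
  then have "\<rho> \<one> = \<one>\<^bsub>GL n\<^esub>" using hom_one[OF h is_group] by blast
  then have one: "\<rho> \<one> = 1\<^sub>m n" by (simp add: GL_def units_of_def ring_mat_simps)
  have carr: "M \<in> carrier_mat n n" if "M \<in> carrier (GL n)" for M
    using that unfolding GL_def units_of_def Units_def by (auto simp: ring_mat_simps)
  have mult: "A \<otimes>\<^bsub>GL n\<^esub> B = A * B" for A B by (simp add: GL_def units_of_def ring_mat_simps)
  show "is_rep n \<rho>" unfolding is_rep_def
    using one carr[OF hom_in_carrier[OF h]] hom_mult[OF h] by (simp add: mult)
qed

lemma irreducible_repD:
  assumes "irreducible_rep G n \<rho>"
  shows "is_rep n \<rho>" "n > 0"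
    "VectorSpace.subspace class_ring W (module_vec TYPE(complex) n) \<Longrightarrow>
       (\<And>g w. g \<in> carrier G \<Longrightarrow> w \<in> W \<Longrightarrow> \<rho> g *\<^sub>v w \<in> W) \<Longrightarrow> W = {0\<^sub>v n} \<or> W = carrier_vec n"
  using assms unfolding irreducible_rep_def is_rep_iff_hom by auto

text \<open>Pure associativity, isolated for \<open>intertwiner_sum\<close>, where one factor on the
  left is absorbed into \<open>R\<close> and one factor on the right is split off from
  \<open>S\<close>.\<close>

lemma mult_mat_regroup:
  assumes "R = A * B" "S = C * D" "A \<in> carrier_mat n n" "B \<in> carrier_mat n n" "E \<in> carrier_mat n m"
    "C \<in> carrier_mat m m" "D \<in> carrier_mat m m"
  shows "A * (B * E * S) = (R * E * C) * (D :: complex mat)"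
proof -
  have BE: "B * E \<in> carrier_mat n m" using assms by auto
  have "A * (B * E * S) = A * (B * E) * S" using assms BE by (intro assoc_mult_mat[symmetric]) auto
  also have "A * (B * E) = R * E" using assms(3-5) unfolding assms(1) by (intro assoc_mult_mat[symmetric]) auto
  also have "R * E * S = R * E * C * D" using assms(3-7) unfolding assms(1,2)
    by (intro assoc_mult_mat[symmetric]) auto
  finally show ?thesis .
qed

text \<open>Averaging makes any matrix equivariant: replacing \<open>g\<close> by
  \<open>h \<otimes> g\<close> absorbs \<open>\<rho> h\<close> on the left and releases
  \<open>\<sigma> h\<close> on the right.\<close>

lemma intertwiner_sum:
  assumes \<rho>: "is_rep n \<rho>" and \<sigma>: "is_rep m \<sigma>" and E: "E \<in> carrier_mat n m" and h: "h \<in> carrier G"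
  defines "T \<equiv> mat_sum n m (carrier G) (\<lambda>g. \<rho> g * E * \<sigma> (inv g))"
  shows "\<rho> h * T = T * \<sigma> h"
proof -
  note c = is_rep_carrier[OF \<rho>] is_rep_carrier[OF \<sigma>]
  have "\<rho> h * T = mat_sum n m (carrier G) (\<lambda>g. \<rho> h * (\<rho> g * E * \<sigma> (inv g)))"
    unfolding T_def by (rule mat_sum_mult_left) (use c h E in \<open>auto intro!: mult_carrier_mat\<close>)
  also have "\<dots> = mat_sum n m (carrier G) (\<lambda>g. (\<rho> (h \<otimes> g) * E * \<sigma> (inv (h \<otimes> g))) * \<sigma> h)"
  proof (rule mat_sum_cong)
    fix g assume g: "g \<in> carrier G"
    have "\<sigma> (inv g) = \<sigma> (inv (h \<otimes> g)) * \<sigma> h"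
      using is_rep_mult[OF \<sigma>, of "inv (h \<otimes> g)" h] g h by (simp add: inv_mult_group m_assoc)
    moreover have "\<rho> (h \<otimes> g) = \<rho> h * \<rho> g" by (rule is_rep_mult[OF \<rho> h g])
    ultimately show "\<rho> h * (\<rho> g * E * \<sigma> (inv g)) = (\<rho> (h \<otimes> g) * E * \<sigma> (inv (h \<otimes> g))) * \<sigma> h"
      using c(1)[OF h] c(1)[OF g] c(2)[of "inv (h \<otimes> g)"] c(2)[OF h] E g h
      by (intro mult_mat_regroup) auto
  qed
  also have "\<dots> = mat_sum n m (carrier G) (\<lambda>g. (\<rho> g * E * \<sigma> (inv g)) * \<sigma> h)"
    by (rule mat_sum_reindex[symmetric, where h = "\<lambda>g. h \<otimes> g"])
      (use h in \<open>auto intro!: bij_betwI[of _ _ _ "\<lambda>g. inv h \<otimes> g"] simp: m_assoc[symmetric]\<close>)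
  also have "\<dots> = T * \<sigma> h"
    unfolding T_def by (rule mat_sum_mult_right[symmetric]) (use c h E in \<open>auto intro!: mult_carrier_mat\<close>)
  finally show ?thesis .
qed

text \<open>Kernel and image of \<open>T\<close> are invariant. As \<open>T\<close> is nonzero, the
  kernel is not everything, hence trivial; the image is then nonzero, hence everything.\<close>

theorem schur_iso:
  assumes \<rho>: "irreducible_rep G n \<rho>" and \<sigma>: "irreducible_rep G m \<sigma>" and T: "T \<in> carrier_mat n m"
    and comm: "\<And>g. g \<in> carrier G \<Longrightarrow> \<rho> g * T = T * \<sigma> g" and nz: "T \<noteq> 0\<^sub>m n m"
  obtains C where "n = m" "C \<in> carrier_mat n n" "T * C = 1\<^sub>m n" "C * T = 1\<^sub>m n"
proof -
  note c = is_rep_carrier[OF irreducible_repD(1)[OF \<rho>]] is_rep_carrier[OF irreducible_repD(1)[OF \<sigma>]]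
  have cv: "\<rho> g *\<^sub>v (T *\<^sub>v v) = T *\<^sub>v (\<sigma> g *\<^sub>v v)" if "g \<in> carrier G" "v \<in> carrier_vec m" for g v
    using comm[OF that(1)] c[OF that(1)] T that(2) by (metis assoc_mult_mat_vec)
  let ?K = "{v \<in> carrier_vec m. T *\<^sub>v v = 0\<^sub>v n}"
  have "?K = {0\<^sub>v m} \<or> ?K = carrier_vec m"
  proof (rule irreducible_repD(3)[OF \<sigma>])
    show "VectorSpace.subspace class_ring ?K (module_vec TYPE(complex) m)"
      unfolding subspace_carrier_vec_iff
      using T by (auto simp: mult_add_distrib_mat_vec mult_mat_vec)
    fix g w assume g: "g \<in> carrier G" and w: "w \<in> ?K"
    have "T *\<^sub>v (\<sigma> g *\<^sub>v w) = \<rho> g *\<^sub>v (T *\<^sub>v w)" using cv[OF g, of w] w by simp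
    also have "\<dots> = 0\<^sub>v n" using w c(1)[OF g] by (simp add: mult_mat_vec_zero)
    finally show "\<sigma> g *\<^sub>v w \<in> ?K" using w c(2)[OF g] by simp
  qed
  moreover have "?K \<noteq> carrier_vec m"
  proof
    assume K: "?K = carrier_vec m"
    have "T *\<^sub>v unit_vec m j = 0\<^sub>v n" for j
    proof -
      have "unit_vec m j \<in> ?K" unfolding K by simp
      then show ?thesis by simp
    qed
    then have "col T j = 0\<^sub>v n" if "j < m" for j using T that by (metis mult_mat_vec_unit)
    then have "T $$ (i, j) = 0" if "i < n" "j < m" for i j
      using that T by (metis carrier_matD index_col index_zero_vec(1))
    then have "T = 0\<^sub>m n m" using T by (intro eq_matI) auto
    then show False using nz by simp
  qed
  ultimately have inj: "inj_mat T" using T by (auto simp: inj_mat_def)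
  let ?I = "(\<lambda>v. T *\<^sub>v v) ` carrier_vec m"
  have "?I = {0\<^sub>v n} \<or> ?I = carrier_vec n"
  proof (rule irreducible_repD(3)[OF \<rho>])
    show "VectorSpace.subspace class_ring ?I (module_vec TYPE(complex) n)"
      unfolding subspace_carrier_vec_iff
    proof (intro conjI allI ballI)
      show "?I \<subseteq> carrier_vec n" using T by auto
      show "0\<^sub>v n \<in> ?I" using T by (intro image_eqI[of _ _ "0\<^sub>v m"]) auto
      fix v w assume "v \<in> ?I" "w \<in> ?I"
      then obtain a b where "a \<in> carrier_vec m" "v = T *\<^sub>v a" "b \<in> carrier_vec m" "w = T *\<^sub>v b" by auto
      then show "v + w \<in> ?I" using T
        by (intro image_eqI[of _ _ "a + b"]) (auto simp: mult_add_distrib_mat_vec)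
    next
      fix c v assume "v \<in> ?I"
      then obtain a where "a \<in> carrier_vec m" "v = T *\<^sub>v a" by auto
      then show "c \<cdot>\<^sub>v v \<in> ?I" using T
        by (intro image_eqI[of _ _ "c \<cdot>\<^sub>v a"]) (auto simp: mult_mat_vec)
    qed
    fix g w assume g: "g \<in> carrier G" and "w \<in> ?I"
    then obtain a where a: "a \<in> carrier_vec m" "w = T *\<^sub>v a" by auto
    show "\<rho> g *\<^sub>v w \<in> ?I" using cv[OF g a(1)] a c(2)[OF g]
      by (intro image_eqI[of _ _ "\<sigma> g *\<^sub>v a"]) auto
  qed
  moreover have "?I \<noteq> {0\<^sub>v n}"
  proof
    assume I: "?I = {0\<^sub>v n}"
    have "unit_vec m 0 \<in> carrier_vec m" by simp
    then have "T *\<^sub>v unit_vec m 0 = 0\<^sub>v n" using I by blast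
    then have "unit_vec m 0 = (0\<^sub>v m :: complex vec)" using inj_matD[OF inj T, of "unit_vec m 0"] by simp
    then have "unit_vec m 0 $ 0 = (0 :: complex)" using irreducible_repD(2)[OF \<sigma>] by simp
    then show False using irreducible_repD(2)[OF \<sigma>] by simp
  qed
  ultimately have surj: "?I = carrier_vec n" by blast
  have "\<exists>v. v \<in> carrier_vec m \<and> T *\<^sub>v v = unit_vec n i" for i
  proof -
    have "unit_vec n i \<in> ?I" unfolding surj by simp
    then show ?thesis by auto
  qed
  \<comment> \<open>Preimages of the unit vectors become the columns of a right inverse
    \<open>B\<close>.\<close>
  then obtain f where f: "\<And>i. f i \<in> carrier_vec m" "\<And>i. T *\<^sub>v f i = unit_vec n i" by metis
  define B where "B = mat m n (\<lambda>(i, j). f j $ i)"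
  have B: "B \<in> carrier_mat m n" by (simp add: B_def)
  have colB: "col B j = f j" if "j < n" for j
    using that f(1)[of j] by (intro eq_vecI) (auto simp: B_def)
  have TB: "T * B = 1\<^sub>m n"
  proof (rule eq_matI)
    fix i j assume "i < dim_row (1\<^sub>m n :: complex mat)" "j < dim_col (1\<^sub>m n :: complex mat)"
    then have ij: "i < n" "j < n" by auto
    have "(T * B) $$ (i, j) = (T *\<^sub>v col B j) $ i" using ij T B by simp
    also have "\<dots> = unit_vec n j $ i" using colB[OF ij(2)] f(2) by simp
    finally show "(T * B) $$ (i, j) = 1\<^sub>m n $$ (i, j)" using ij by (simp add: unit_vec_def)
  qed (use T B in auto)
  \<comment> \<open>Injectivity of \<open>B\<close> and of \<open>T\<close> bounds the two degrees
    by each other, which makes \<open>T\<close> square.\<close>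
  have "inj_mat B" unfolding inj_mat_def
  proof (intro ballI impI)
    fix v assume v: "v \<in> carrier_vec (dim_col B)" "B *\<^sub>v v = 0\<^sub>v (dim_row B)"
    then have "v = (T * B) *\<^sub>v v" using TB B by simp
    also have "\<dots> = T *\<^sub>v (B *\<^sub>v v)" using T B v(1) by (intro assoc_mult_mat_vec) auto
    also have "\<dots> = 0\<^sub>v n" using v(2) T B by (simp add: mult_mat_vec_zero)
    finally show "v = 0\<^sub>v (dim_col B)" using B by simp
  qed
  then have nm: "n = m" using inj_mat_dims[OF B] inj_mat_dims[OF T inj] by simp
  with T inj obtain C where "C \<in> carrier_mat n n" "T * C = 1\<^sub>m n" "C * T = 1\<^sub>m n"
    using inj_mat_square[of T n] by blast
  then show thesis using that nm by blast
qed

text \<open>A complex matrix has an eigenvalue \<open>c\<close>. The intertwiner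
  \<open>T - c\<close> kills an eigenvector, so it is not invertible and must vanish by
  \<open>schur_iso\<close>.\<close>

theorem schur_scalar:
  assumes \<rho>: "irreducible_rep G n \<rho>" and T: "T \<in> carrier_mat n n"
    and comm: "\<And>g. g \<in> carrier G \<Longrightarrow> \<rho> g * T = T * \<rho> g"
  obtains c where "T = c \<cdot>\<^sub>m 1\<^sub>m n"
proof -
  note cr = is_rep_carrier[OF irreducible_repD(1)[OF \<rho>]]
  obtain c v where v: "v \<in> carrier_vec n" "v \<noteq> 0\<^sub>v n" "T *\<^sub>v v = c \<cdot>\<^sub>v v"
  proof -
    obtain c where "c \<in> spectrum T"
      using spectrum_non_empty[OF T irreducible_repD(2)[OF \<rho>]] by blast
    then show thesis using that T by (auto simp: spectrum_def eigenvalue_def eigenvector_def)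
  qed
  let ?S = "T - c \<cdot>\<^sub>m 1\<^sub>m n"
  have S: "?S \<in> carrier_mat n n" using T by (simp add: minus_carrier_mat)
  have "?S = 0\<^sub>m n n"
  proof (rule ccontr)
    assume nz: "?S \<noteq> 0\<^sub>m n n"
    have "\<rho> g * ?S = ?S * \<rho> g" if "g \<in> carrier G" for g
    proof -
      note R = cr[OF that]
      have I: "c \<cdot>\<^sub>m 1\<^sub>m n \<in> carrier_mat n n" by simp
      have "\<rho> g * (c \<cdot>\<^sub>m 1\<^sub>m n) = c \<cdot>\<^sub>m \<rho> g"
        using mult_smult_distrib[OF R one_carrier_mat] right_mult_one_mat[OF R] by metis
      moreover have "(c \<cdot>\<^sub>m 1\<^sub>m n) * \<rho> g = c \<cdot>\<^sub>m \<rho> g"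
        using mult_smult_assoc_mat[OF one_carrier_mat R] left_mult_one_mat[OF R] by metis
      ultimately show ?thesis
        unfolding mult_minus_distrib_mat[OF R T I] minus_mult_distrib_mat[OF T I R] comm[OF that] by metis
    qed
    from schur_iso[OF \<rho> \<rho> S this nz] obtain C where C: "C \<in> carrier_mat n n" "C * ?S = 1\<^sub>m n" by blast
    have "c \<cdot>\<^sub>m 1\<^sub>m n \<in> carrier_mat n n" by simp
    from minus_mult_distrib_mat_vec[OF T this v(1)] have "?S *\<^sub>v v = 0\<^sub>v n"
      using v smult_one_mult_vec[OF v(1), of c] by simp
    then have "C *\<^sub>v (?S *\<^sub>v v) = 0\<^sub>v n" using C(1) by (simp add: mult_mat_vec_zero)
    moreover have "C *\<^sub>v (?S *\<^sub>v v) = v"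
      using assoc_mult_mat_vec[OF C(1) S v(1)] C(2) v(1) by simp
    ultimately show False using v(2) by simp
  qed
  have "T = c \<cdot>\<^sub>m 1\<^sub>m n"
  proof (intro eq_matI)
    fix i j assume "i < dim_row (c \<cdot>\<^sub>m 1\<^sub>m n)" "j < dim_col (c \<cdot>\<^sub>m 1\<^sub>m n)"
    then have ij: "i < n" "j < n" by auto
    have "?S $$ (i, j) = 0" using \<open>?S = 0\<^sub>m n n\<close> ij by simp
    then show "T $$ (i, j) = (c \<cdot>\<^sub>m 1\<^sub>m n) $$ (i, j)" using ij T by simp
  qed (use T in auto)
  then show thesis by (rule that)
qed


section \<open>Characters: conjugation, inversion and orthogonality\<close>

lemma character_eq: "g \<in> carrier G \<Longrightarrow> character G \<rho> g = trace (\<rho> g)"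
  by (simp add: character_def)

lemma IrrE:
  assumes "\<chi> \<in> Irr G"
  obtains n \<rho> where "irreducible_rep G n \<rho>" "\<chi> = character G \<rho>"
  using assms by (auto simp: Irr_def)

lemma Irr_extensional: "\<chi> \<in> Irr G \<Longrightarrow> \<chi> \<in> extensional (carrier G)"
  by (auto simp: Irr_def character_def)

lemma bij_betw_inv: "bij_betw (\<lambda>g. inv g) (carrier G) (carrier G)"
  by (auto intro!: bij_betwI[of _ _ _ "\<lambda>g. inv g"])

lemma bij_betw_conj: "h \<in> carrier G \<Longrightarrow> bij_betw (\<lambda>g. h \<otimes> g \<otimes> inv h) (carrier G) (carrier G)"
  by (rule bij_betwI[of _ _ _ "\<lambda>g. inv h \<otimes> g \<otimes> h"])
    (auto simp: m_assoc, (simp add: m_assoc[symmetric])+)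

lemma Irr_conj:
  assumes "\<chi> \<in> Irr G" "g \<in> carrier G" "h \<in> carrier G"
  shows "\<chi> (h \<otimes> g \<otimes> inv h) = \<chi> g"
proof -
  obtain n \<rho> where \<rho>: "irreducible_rep G n \<rho>" "\<chi> = character G \<rho>" using IrrE assms(1) by blast
  note r = irreducible_repD(1)[OF \<rho>(1)]
  note c = is_rep_carrier[OF r]
  have "trace (\<rho> (h \<otimes> g \<otimes> inv h)) = trace (\<rho> (h \<otimes> g) * \<rho> (inv h))"
    using is_rep_mult[OF r] assms by simp
  also have "\<dots> = trace (\<rho> (inv h) * \<rho> (h \<otimes> g))"
    using c assms by (intro trace_mult_comm[of _ n n]) auto
  also have "\<rho> (inv h) * \<rho> (h \<otimes> g) = \<rho> g"
    using is_rep_mult[OF r, of "inv h" "h \<otimes> g"] assms by (simp add: m_assoc[symmetric])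
  finally show ?thesis using assms \<rho>(2) by (simp add: character_eq)
qed

text \<open>The unitarian trick: the averaged form H, the sum of all
  \<open>ctrans (\<rho> g) * \<rho> g\<close>, is invariant and positive definite. Hence
  \<open>ctrans (\<rho> h)\<close> is similar to \<open>\<rho> (inv h)\<close> via H, and the traces
  agree.\<close>

lemma trace_rep_inv:
  assumes rep: "is_rep n \<rho>" and h: "h \<in> carrier G"
  shows "trace (\<rho> (inv h)) = cnj (trace (\<rho> h))"
proof -
  note c = is_rep_carrier[OF rep]
  have cs: "ctrans (\<rho> g) * \<rho> g \<in> carrier_mat n n" if "g \<in> carrier G" for g
    using mult_carrier_mat[OF ctrans_carrier[OF c[OF that]] c[OF that]] .
  define H where "H = mat_sum n n (carrier G) (\<lambda>g. ctrans (\<rho> g) * \<rho> g)"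
  have H: "H \<in> carrier_mat n n" by (simp add: H_def)
  have ch: "ctrans (\<rho> h) \<in> carrier_mat n n" "\<rho> (inv h) \<in> carrier_mat n n" "\<rho> h \<in> carrier_mat n n"
    using c h by auto
  have inv_form: "H = mat_sum n n (carrier G) (\<lambda>g. ctrans (\<rho> (g \<otimes> h)) * \<rho> (g \<otimes> h))"
    unfolding H_def by (rule mat_sum_reindex)
      (use h in \<open>auto intro!: bij_betwI[of _ _ _ "\<lambda>g. g \<otimes> inv h"] simp: m_assoc\<close>)
  have "ctrans (\<rho> h) * H = mat_sum n n (carrier G) (\<lambda>g. ctrans (\<rho> h) * (ctrans (\<rho> g) * \<rho> g))"
    unfolding H_def by (rule mat_sum_mult_left) (use ch cs in auto)
  also have "\<dots> = mat_sum n n (carrier G) (\<lambda>g. (ctrans (\<rho> (g \<otimes> h)) * \<rho> (g \<otimes> h)) * \<rho> (inv h))"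
  proof (rule mat_sum_cong)
    fix g assume g: "g \<in> carrier G"
    have 1: "ctrans (\<rho> (g \<otimes> h)) = ctrans (\<rho> h) * ctrans (\<rho> g)"
      using is_rep_mult[OF rep g h] ctrans_mult[OF c[OF g] c[OF h]] by simp
    have 2: "\<rho> (g \<otimes> h) * \<rho> (inv h) = \<rho> g"
      using is_rep_mult[OF rep, of "g \<otimes> h" "inv h"] g h by (simp add: m_assoc)
    have gh: "\<rho> (g \<otimes> h) \<in> carrier_mat n n" "ctrans (\<rho> (g \<otimes> h)) \<in> carrier_mat n n"
      "ctrans (\<rho> g) \<in> carrier_mat n n" "\<rho> g \<in> carrier_mat n n"
      using g h c by auto
    show "ctrans (\<rho> h) * (ctrans (\<rho> g) * \<rho> g) = (ctrans (\<rho> (g \<otimes> h)) * \<rho> (g \<otimes> h)) * \<rho> (inv h)"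
      unfolding assoc_mult_mat[OF gh(2,1) ch(2)] 2 unfolding 1
      by (rule assoc_mult_mat[OF ch(1) gh(3,4), symmetric])
  qed
  also have "\<dots> = H * \<rho> (inv h)"
    unfolding inv_form using h
    by (intro mat_sum_mult_right[symmetric]) (auto simp: ch cs)
  finally have eq: "ctrans (\<rho> h) * H = H * \<rho> (inv h)" .
  \<comment> \<open>On a kernel vector the quadratic form of \<open>H\<close> vanishes; it is a sum
    of squared norms over the group.\<close>
  have "inj_mat H" unfolding inj_mat_def
  proof (intro ballI impI)
    fix v assume "v \<in> carrier_vec (dim_col H)" "H *\<^sub>v v = 0\<^sub>v (dim_row H)"
    then have v: "v \<in> carrier_vec n" "H *\<^sub>v v = 0\<^sub>v n" using H by auto
    have Hv: "(H *\<^sub>v v) $ i = (\<Sum>g\<in>carrier G. ((ctrans (\<rho> g) * \<rho> g) *\<^sub>v v) $ i)" if "i < n" for i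
      unfolding H_def by (rule mat_sum_mult_vec_nth[OF cs v(1) that])
    have "0 = (\<Sum>i<n. cnj (v $ i) * (H *\<^sub>v v) $ i)" using v by simp
    also have "\<dots> = (\<Sum>i<n. \<Sum>g\<in>carrier G. cnj (v $ i) * ((ctrans (\<rho> g) * \<rho> g) *\<^sub>v v) $ i)"
      by (rule sum.cong) (simp_all add: Hv sum_distrib_left)
    also have "\<dots> = (\<Sum>g\<in>carrier G. \<Sum>i<n. cnj (v $ i) * ((ctrans (\<rho> g) * \<rho> g) *\<^sub>v v) $ i)"
      by (rule sum.swap)
    also have "\<dots> = (\<Sum>g\<in>carrier G. of_real (\<Sum>j<n. (cmod ((\<rho> g *\<^sub>v v) $ j))\<^sup>2))"
      by (rule sum.cong[OF refl]) (rule ctrans_mult_quadratic[OF c v(1)])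
    also have "\<dots> = of_real (\<Sum>g\<in>carrier G. \<Sum>j<n. (cmod ((\<rho> g *\<^sub>v v) $ j))\<^sup>2)"
      by (simp only: of_real_sum)
    finally have "complex_of_real (\<Sum>g\<in>carrier G. \<Sum>j<n. (cmod ((\<rho> g *\<^sub>v v) $ j))\<^sup>2) = 0"
      by (rule sym)
    then have "(\<Sum>g\<in>carrier G. \<Sum>j<n. (cmod ((\<rho> g *\<^sub>v v) $ j))\<^sup>2) = 0"
      by (simp only: of_real_eq_0_iff)
    \<comment> \<open>The summand belonging to \<open>\<one>\<close> already forces \<open>v\<close>
      to be 0.\<close>
    then have "(\<Sum>j<n. (cmod ((\<rho> \<one> *\<^sub>v v) $ j))\<^sup>2) = 0"
      by (subst (asm) sum_nonneg_eq_0_iff) (auto intro: sum_nonneg)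
    then have "(cmod ((\<rho> \<one> *\<^sub>v v) $ j))\<^sup>2 = 0" if "j < n" for j
      using that by (subst (asm) sum_nonneg_eq_0_iff) auto
    then have "v $ j = 0" if "j < n" for j using that v(1) is_rep_one[OF rep] by simp
    then show "v = 0\<^sub>v (dim_col H)" using v(1) H by (intro eq_vecI) auto
  qed
  then obtain C where C: "C \<in> carrier_mat n n" "H * C = 1\<^sub>m n" "C * H = 1\<^sub>m n"
    using inj_mat_square[OF H] by blast
  have "ctrans (\<rho> h) = ctrans (\<rho> h) * H * C"
    using assoc_mult_mat[OF ch(1) H C(1)] C(2) ch(1) by simp
  then have "trace (ctrans (\<rho> h)) = trace (H * \<rho> (inv h) * C)" using eq by simp
  also have "\<dots> = trace (C * (H * \<rho> (inv h)))"
    using H C(1) ch(2) by (intro trace_mult_comm[of _ n n]) auto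
  also have "C * (H * \<rho> (inv h)) = \<rho> (inv h)"
    using assoc_mult_mat[OF C(1) H ch(2)] C(3) ch(2) by simp
  finally show ?thesis using trace_ctrans[OF ch(3)] by simp
qed

lemma Irr_inv: "\<chi> \<in> Irr G \<Longrightarrow> g \<in> carrier G \<Longrightarrow> \<chi> (inv g) = cnj (\<chi> g)"
  by (elim IrrE) (simp add: character_eq trace_rep_inv[OF irreducible_repD(1)])

text \<open>Entrywise conjugation matches the invariant subspaces of a representation with those of
  its conjugate, so irreducibility is preserved. This lets the reality of a character be tested by
  orthogonality to its conjugate.\<close>

lemma Irr_cnj:
  assumes "\<chi> \<in> Irr G"
  shows "(\<lambda>g\<in>carrier G. cnj (\<chi> g)) \<in> Irr G"
proof -
  obtain n \<rho> where \<rho>: "irreducible_rep G n \<rho>" "\<chi> = character G \<rho>" using IrrE assms by blast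
  note r = irreducible_repD(1)[OF \<rho>(1)]
  note c = is_rep_carrier[OF r]
  let ?\<sigma> = "\<lambda>g. map_mat cnj (\<rho> g)"
  have cnj_vec: "?\<sigma> g *\<^sub>v v = map_vec cnj (\<rho> g *\<^sub>v map_vec cnj v)"
    if "g \<in> carrier G" "v \<in> carrier_vec n" for g v
    using c[OF that(1)] that(2) by (intro eq_vecI) (auto simp: scalar_prod_def)
  have rep: "is_rep n ?\<sigma>"
    unfolding is_rep_def
  proof (intro conjI ballI)
    fix g h assume gh: "g \<in> carrier G" "h \<in> carrier G"
    show "?\<sigma> (g \<otimes> h) = ?\<sigma> g * ?\<sigma> h"
      unfolding is_rep_mult[OF r gh] using c[OF gh(1)] c[OF gh(2)]
      by (intro eq_matI) (auto simp: scalar_prod_def)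
  qed (use c is_rep_one[OF r] in auto)
  have "irreducible_rep G n ?\<sigma>"
    unfolding irreducible_rep_def
  proof (intro conjI allI impI)
    show "?\<sigma> \<in> hom G (GL n)" using rep is_rep_iff_hom by blast
    show "0 < n" by (rule irreducible_repD(2)[OF \<rho>(1)])
    fix W assume W: "VectorSpace.subspace class_ring W (module_vec TYPE(complex) n) \<and>
      (\<forall>g\<in>carrier G. \<forall>w\<in>W. ?\<sigma> g *\<^sub>v w \<in> W)"
    then have Wc: "W \<subseteq> carrier_vec n" by (simp add: subspace_carrier_vec_iff)
    let ?V = "map_vec cnj ` W"
    have cc: "map_vec cnj (map_vec cnj v) = v" for v by (intro eq_vecI) auto
    have "?V = {0\<^sub>v n} \<or> ?V = carrier_vec n"
    proof (rule irreducible_repD(3)[OF \<rho>(1)])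
      show "VectorSpace.subspace class_ring ?V (module_vec TYPE(complex) n)"
        unfolding subspace_carrier_vec_iff
      proof (intro conjI ballI allI)
        show "?V \<subseteq> carrier_vec n" using Wc by auto
        show "0\<^sub>v n \<in> ?V" using W
          by (intro image_eqI[of _ _ "0\<^sub>v n"]) (auto simp: subspace_carrier_vec_iff)
        fix v w assume "v \<in> ?V" "w \<in> ?V"
        then obtain a b where ab: "a \<in> W" "v = map_vec cnj a" "b \<in> W" "w = map_vec cnj b" by auto
        then have "a \<in> carrier_vec n" "b \<in> carrier_vec n" "a + b \<in> W"
          using W by (auto simp: subspace_carrier_vec_iff)
        then show "v + w \<in> ?V" using ab by (intro image_eqI[of _ _ "a + b"]) auto
      next
        fix k v assume "v \<in> ?V"
        then obtain a where a: "a \<in> W" "v = map_vec cnj a" by auto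
        then have "cnj k \<cdot>\<^sub>v a \<in> W" using W by (auto simp: subspace_carrier_vec_iff)
        then show "k \<cdot>\<^sub>v v \<in> ?V" using a by (intro image_eqI[of _ _ "cnj k \<cdot>\<^sub>v a"]) auto
      qed
      fix g w assume g: "g \<in> carrier G" and "w \<in> ?V"
      then obtain a where a: "a \<in> W" "w = map_vec cnj a" by auto
      have "?\<sigma> g *\<^sub>v a \<in> W" using W g a(1) by blast
      then show "\<rho> g *\<^sub>v w \<in> ?V" using cnj_vec[OF g, of a] a Wc
        by (intro image_eqI[of _ _ "?\<sigma> g *\<^sub>v a"]) (auto simp: cc)
    qed
    moreover have VW: "W = map_vec cnj ` ?V" unfolding image_image cc by simp
    moreover have "map_vec cnj ` carrier_vec n = (carrier_vec n :: complex vec set)"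
    proof
      show "carrier_vec n \<subseteq> map_vec cnj ` (carrier_vec n :: complex vec set)"
      proof
        fix v :: "complex vec" assume "v \<in> carrier_vec n"
        then show "v \<in> map_vec cnj ` carrier_vec n"
          by (intro image_eqI[of _ _ "map_vec cnj v"]) (auto simp: cc)
      qed
    qed auto
    moreover have "map_vec cnj (0\<^sub>v n) = (0\<^sub>v n :: complex vec)" by (intro eq_vecI) auto
    ultimately show "W = {0\<^sub>v n} \<or> W = carrier_vec n" by (metis image_empty image_insert)
  qed
  moreover have "character G ?\<sigma> = (\<lambda>g\<in>carrier G. cnj (\<chi> g))"
    unfolding character_def \<rho>(2)
  proof (rule restrict_ext)
    fix g assume g: "g \<in> carrier G"
    then show "trace (?\<sigma> g) = cnj (restrict (\<lambda>g. trace (\<rho> g)) (carrier G) g)"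
      using c[OF g] by (simp add: trace_def)
  qed
  ultimately show ?thesis unfolding Irr_def by (auto intro!: exI[of _ n] exI[of _ ?\<sigma>])
qed

text \<open>The averages \<open>T j k\<close> of the matrix units are intertwiners whose entries are
  sums of products of matrix coefficients. Schur's lemma evaluates them, and the sum of the entries
  \<open>T i k $$ (i, k)\<close> is the product of characters.\<close>

theorem Irr_orthogonal:
  assumes "\<chi> \<in> Irr G" "\<psi> \<in> Irr G"
  shows "(\<Sum>g\<in>carrier G. \<chi> g * \<psi> (inv g)) = (if \<chi> = \<psi> then of_nat (card (carrier G)) else 0)"
proof -
  obtain n \<rho> where \<rho>: "irreducible_rep G n \<rho>" "\<chi> = character G \<rho>" using IrrE assms(1) by blast
  \<comment> \<open>Equal characters are given the same representation, so that
    \<open>schur_scalar\<close> applies literally and no isomorphism of representations has to be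
    derived from equality of characters.\<close>
  define m \<sigma> where "m = (if \<chi> = \<psi> then n else (SOME m. \<exists>\<sigma>. irreducible_rep G m \<sigma> \<and> \<psi> = character G \<sigma>))"
    and "\<sigma> = (if \<chi> = \<psi> then \<rho> else (SOME \<sigma>. irreducible_rep G m \<sigma> \<and> \<psi> = character G \<sigma>))"
  have \<sigma>: "irreducible_rep G m \<sigma> \<and> \<psi> = character G \<sigma>"
  proof (cases "\<chi> = \<psi>")
    case True
    then show ?thesis using \<rho> by (simp add: m_def \<sigma>_def)
  next
    case False
    have ex: "\<exists>m \<sigma>. irreducible_rep G m \<sigma> \<and> \<psi> = character G \<sigma>" using IrrE[OF assms(2)] by metis
    have "\<exists>\<sigma>. irreducible_rep G m \<sigma> \<and> \<psi> = character G \<sigma>"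
      using someI_ex[OF ex] False by (simp add: m_def)
    from someI_ex[OF this] show ?thesis using False by (simp add: \<sigma>_def)
  qed
  note rr = irreducible_repD(1)[OF \<rho>(1)] irreducible_repD(1)[OF conjunct1[OF \<sigma>]]
  note c = is_rep_carrier[OF rr(1)] is_rep_carrier[OF rr(2)]
  define E where "E j k = mat n m (\<lambda>p. if p = (j, k) then (1::complex) else 0)" for j k
  have E: "E j k \<in> carrier_mat n m" for j k by (simp add: E_def)
  define T where "T j k = mat_sum n m (carrier G) (\<lambda>g. \<rho> g * E j k * \<sigma> (inv g))" for j k
  have T: "T j k \<in> carrier_mat n m" for j k by (simp add: T_def)
  have T_index: "T j k $$ (i, l) = (\<Sum>g\<in>carrier G. \<rho> g $$ (i, j) * \<sigma> (inv g) $$ (k, l))"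
    if ij: "i < n" "j < n" "k < m" "l < m" for i j k l
  proof -
    have "(\<rho> g * E j k * \<sigma> (inv g)) $$ (i, l) = \<rho> g $$ (i, j) * \<sigma> (inv g) $$ (k, l)"
      if g: "g \<in> carrier G" for g
    proof -
      have cg: "\<rho> g \<in> carrier_mat n n" "\<sigma> (inv g) \<in> carrier_mat m m" using c g by auto
      have RE: "(\<rho> g * E j k) $$ (i, q) = (if q = k then \<rho> g $$ (i, j) else 0)" if "q < m" for q
      proof -
        have "(\<rho> g * E j k) $$ (i, q) = (\<Sum>p<n. \<rho> g $$ (i, p) * E j k $$ (p, q))"
by (rule mult_mat_nth[OF cg(1) E ij(1) that])
        also have "\<dots> = (\<Sum>p<n. if p = j then (if q = k then \<rho> g $$ (i, j) else 0) else 0)"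
          by (rule sum.cong) (use that ij in \<open>auto simp: E_def\<close>)
        finally show ?thesis using ij by simp
      qed
      have "(\<rho> g * E j k * \<sigma> (inv g)) $$ (i, l) = (\<Sum>q<m. (\<rho> g * E j k) $$ (i, q) * \<sigma> (inv g) $$ (q, l))"
        by (rule mult_mat_nth[OF mult_carrier_mat[OF cg(1) E] cg(2) ij(1,4)])
      also have "\<dots> = (\<Sum>q<m. if q = k then \<rho> g $$ (i, j) * \<sigma> (inv g) $$ (k, l) else 0)"
        by (rule sum.cong) (auto simp: RE)
      finally show ?thesis using ij by simp
    qed
    then show ?thesis using ij by (simp add: T_def mat_sum_index)
  qed
  have Tcomm: "\<rho> h * T j k = T j k * \<sigma> h" if "h \<in> carrier G" for h j k
    unfolding T_def by (rule intertwiner_sum[OF rr E that])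
  have sum_eq: "(\<Sum>g\<in>carrier G. \<chi> g * \<psi> (inv g)) = (\<Sum>i<n. \<Sum>k<m. T i k $$ (i, k))"
  proof -
    have "(\<Sum>g\<in>carrier G. \<chi> g * \<psi> (inv g)) =
        (\<Sum>g\<in>carrier G. \<Sum>i<n. \<Sum>k<m. \<rho> g $$ (i, i) * \<sigma> (inv g) $$ (k, k))"
    proof (rule sum.cong)
      fix g assume g: "g \<in> carrier G"
      then have "\<rho> g \<in> carrier_mat n n" "\<sigma> (inv g) \<in> carrier_mat m m" using c by auto
      then show "\<chi> g * \<psi> (inv g) = (\<Sum>i<n. \<Sum>k<m. \<rho> g $$ (i, i) * \<sigma> (inv g) $$ (k, k))"
        using g \<rho>(2) \<sigma> by (simp add: character_eq trace_def sum_product)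
    qed simp
    also have "\<dots> = (\<Sum>i<n. \<Sum>g\<in>carrier G. \<Sum>k<m. \<rho> g $$ (i, i) * \<sigma> (inv g) $$ (k, k))"
      by (rule sum.swap)
    also have "\<dots> = (\<Sum>i<n. \<Sum>k<m. \<Sum>g\<in>carrier G. \<rho> g $$ (i, i) * \<sigma> (inv g) $$ (k, k))"
      by (rule sum.cong[OF refl]) (rule sum.swap)
    also have "\<dots> = (\<Sum>i<n. \<Sum>k<m. T i k $$ (i, k))"
      by (intro sum.cong) (auto simp: T_index)
    finally show ?thesis .
  qed
  show ?thesis
  proof (cases "\<chi> = \<psi>")
    case False
    have "T j k = 0\<^sub>m n m" for j k
    proof (rule ccontr)
      assume "T j k \<noteq> 0\<^sub>m n m"
      from schur_iso[OF \<rho>(1) conjunct1[OF \<sigma>] T Tcomm this] obtain C where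
        nm: "n = m" and C: "C \<in> carrier_mat n n" "T j k * C = 1\<^sub>m n" "C * T j k = 1\<^sub>m n" by blast
      \<comment> \<open>A nonzero intertwiner is invertible, so the two representations are similar
        and have the same character.\<close>
      have "trace (\<rho> h) = trace (\<sigma> h)" if h: "h \<in> carrier G" for h
      proof -
        have Tn: "T j k \<in> carrier_mat n n" and sh: "\<sigma> h \<in> carrier_mat n n" and rh: "\<rho> h \<in> carrier_mat n n"
          using T c h nm by auto
        have "\<rho> h = \<rho> h * T j k * C" using assoc_mult_mat[OF rh Tn C(1)] C(2) rh by simp
        also have "\<dots> = T j k * \<sigma> h * C" using Tcomm[OF h] by simp
        finally have "trace (\<rho> h) = trace (T j k * \<sigma> h * C)" by simp
        also have "\<dots> = trace (C * (T j k * \<sigma> h))"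
          using Tn sh C(1) by (intro trace_mult_comm[of _ n n]) auto
        also have "C * (T j k * \<sigma> h) = \<sigma> h" using assoc_mult_mat[OF C(1) Tn sh] C(3) sh by simp
        finally show ?thesis .
      qed
      then have "\<chi> = \<psi>" using \<rho>(2) \<sigma> by (auto simp: character_def intro: restrict_ext)
      then show False using False by simp
    qed
    then have "(\<Sum>i<n. \<Sum>k<m. T i k $$ (i, k)) = 0" by simp
    then show ?thesis using sum_eq False by simp
  next
    case True
    then have mn: "m = n" and \<sigma>\<rho>: "\<sigma> = \<rho>" by (simp_all add: m_def \<sigma>_def)
    have n0: "n > 0" by (rule irreducible_repD(2)[OF \<rho>(1)])
    \<comment> \<open>Each \<open>T i k\<close> is scalar, so its entry vanishes for distinct
      indices. For equal indices the scalar is found from the trace: every one of the summands has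
      trace 1.\<close>
    have TT: "T i k $$ (i, k) = (if k = i then of_nat (card (carrier G)) / of_nat n else 0)"
      if ik: "i < n" "k < n" for i k
    proof -
      have Tn: "T i k \<in> carrier_mat n n" using T mn by simp
      obtain d where d: "T i k = d \<cdot>\<^sub>m 1\<^sub>m n"
        using schur_scalar[OF \<rho>(1) Tn] Tcomm \<sigma>\<rho> by metis
      show ?thesis
      proof (cases "k = i")
        case False
        then show ?thesis using d ik by simp
      next
        case True
        have "d * of_nat n = trace (T i i)" using d True trace_smult[of "1\<^sub>m n" n d] by simp
        also have "\<dots> = (\<Sum>g\<in>carrier G. trace (\<rho> g * E i i * \<rho> (inv g)))"
          unfolding T_def \<sigma>\<rho> mn by (rule trace_mat_sum) (use c E mn in \<open>auto intro!: mult_carrier_mat\<close>)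
        also have "\<dots> = (\<Sum>g\<in>carrier G. 1)"
        proof (rule sum.cong)
          fix g assume g: "g \<in> carrier G"
          have cg: "\<rho> g \<in> carrier_mat n n" "\<rho> (inv g) \<in> carrier_mat n n" and En: "E i i \<in> carrier_mat n n"
            using c(1) g E mn by auto
          have "trace (\<rho> g * E i i * \<rho> (inv g)) = trace (\<rho> (inv g) * (\<rho> g * E i i))"
            using cg En by (intro trace_mult_comm[of _ n n]) auto
          also have "\<rho> (inv g) * (\<rho> g * E i i) = E i i"
            using assoc_mult_mat[OF cg(2,1) En] is_rep_inv(2)[OF rr(1) g] En by simp
          also have "trace (E i i) = (\<Sum>p<n. if p = i then 1 else 0)"
            unfolding trace_def using mn by (intro sum.cong) (auto simp: E_def)
          also have "\<dots> = 1" using ik by simp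
          finally show "trace (\<rho> g * E i i * \<rho> (inv g)) = 1" .
        qed simp
        finally have "d * of_nat n = of_nat (card (carrier G))" by simp
        then have "d = of_nat (card (carrier G)) / of_nat n" using n0 by (simp add: eq_divide_eq)
        then show ?thesis using d ik True by simp
      qed
    qed
    have "(\<Sum>i<n. \<Sum>k<m. T i k $$ (i, k)) = (\<Sum>i<n. \<Sum>k<n. if k = i then of_nat (card (carrier G)) / of_nat n else 0)"
      unfolding mn by (intro sum.cong) (auto simp: TT)
    also have "\<dots> = of_nat (card (carrier G))" using n0 by simp
    finally show ?thesis using sum_eq True by simp
  qed
qed


text \<open>Among the nonzero invariant subspaces of \<open>W\<close>, each given by a matrix with
  independent columns, one of least dimension carries an irreducible representation.\<close>

lemma exists_irreducible_subrep:
  assumes R: "is_rep N R" and W: "VectorSpace.subspace class_ring W (module_vec TYPE(complex) N)"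
    and nz: "W \<noteq> {0\<^sub>v N}" and inv: "\<And>g w. g \<in> carrier G \<Longrightarrow> w \<in> W \<Longrightarrow> R g *\<^sub>v w \<in> W"
  obtains k \<rho> B where "irreducible_rep G k \<rho>" "B \<in> carrier_mat N k" "inj_mat B"
    "\<And>g. g \<in> carrier G \<Longrightarrow> R g * B = B * \<rho> g" "\<And>v. v \<in> carrier_vec k \<Longrightarrow> B *\<^sub>v v \<in> W"
proof -
  note c = is_rep_carrier[OF R]
  define P where "P k B \<longleftrightarrow> 0 < k \<and> B \<in> carrier_mat N k \<and> inj_mat B \<and>
    (\<forall>v\<in>carrier_vec k. B *\<^sub>v v \<in> W) \<and>
    (\<forall>g\<in>carrier G. \<forall>v\<in>carrier_vec k. \<exists>u\<in>carrier_vec k. R g *\<^sub>v (B *\<^sub>v v) = B *\<^sub>v u)" for k B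
  obtain k0 B0 where B0: "k0 > 0" "B0 \<in> carrier_mat N k0" "inj_mat B0"
    "\<And>v. v \<in> carrier_vec k0 \<Longrightarrow> B0 *\<^sub>v v \<in> W"
    "\<And>w. w \<in> W \<Longrightarrow> \<exists>v\<in>carrier_vec k0. B0 *\<^sub>v v = w"
    using subspace_basis_mat[OF W nz] by blast
  have "P k0 B0" unfolding P_def
  proof (intro conjI ballI)
    fix g and v :: "complex vec" assume "g \<in> carrier G" "v \<in> carrier_vec k0"
    then have "R g *\<^sub>v (B0 *\<^sub>v v) \<in> W" using inv B0(4) by blast
    from B0(5)[OF this] show "\<exists>u\<in>carrier_vec k0. R g *\<^sub>v (B0 *\<^sub>v v) = B0 *\<^sub>v u" by metis
  qed (use B0 in auto)
  then have ex: "\<exists>k B. P k B" by blast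
  define k where "k = (LEAST k. \<exists>B. P k B)"
  obtain B where PB: "P k B" using LeastI_ex[OF ex] unfolding k_def by blast
  have min: "k \<le> l" if "P l C" for l C unfolding k_def using that by (intro Least_le) blast
  have B: "0 < k" "B \<in> carrier_mat N k" "inj_mat B" "\<And>v. v \<in> carrier_vec k \<Longrightarrow> B *\<^sub>v v \<in> W"
    and stable: "\<And>g v. g \<in> carrier G \<Longrightarrow> v \<in> carrier_vec k \<Longrightarrow>
      \<exists>u\<in>carrier_vec k. R g *\<^sub>v (B *\<^sub>v v) = B *\<^sub>v u"
    using PB unfolding P_def by auto
  have inj: "u = v" if "u \<in> carrier_vec k" "v \<in> carrier_vec k" "B *\<^sub>v u = B *\<^sub>v v" for u v
  proof -
    have "B *\<^sub>v (u - v) = 0\<^sub>v N"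
      using that B(2) mult_minus_distrib_mat_vec[OF B(2) that(1,2)] by simp
    then have uv: "u - v = 0\<^sub>v k" using inj_matD[OF B(3,2)] that by simp
    show ?thesis
    proof (rule eq_vecI)
      fix i assume i: "i < dim_vec v"
      have "(u - v) $ i = 0" using uv i that by simp
      then show "u $ i = v $ i" using i that by simp
    qed (use that in simp)
  qed
  define f where "f g j = (SOME u. u \<in> carrier_vec k \<and> R g *\<^sub>v (B *\<^sub>v unit_vec k j) = B *\<^sub>v u)" for g j
  have f: "f g j \<in> carrier_vec k \<and> R g *\<^sub>v (B *\<^sub>v unit_vec k j) = B *\<^sub>v f g j" if g: "g \<in> carrier G" for g j
  proof -
    have "\<exists>u. u \<in> carrier_vec k \<and> R g *\<^sub>v (B *\<^sub>v unit_vec k j) = B *\<^sub>v u"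
      using stable[OF g, of "unit_vec k j"] by auto
    from someI_ex[OF this] show ?thesis unfolding f_def .
  qed
  \<comment> \<open>The columns of \<open>\<rho> g\<close> are the coordinates, with respect to the
    columns of \<open>B\<close>, of the images of these columns under \<open>R g\<close>.\<close>
  define \<rho> where "\<rho> g = mat k k (\<lambda>(i, j). f g j $ i)" for g
  have rc: "\<rho> g \<in> carrier_mat k k" for g by (simp add: \<rho>_def)
  have RB: "R g * B = B * \<rho> g" if g: "g \<in> carrier G" for g
  proof (rule mat_col_eqI)
    fix j assume "j < dim_col (B * \<rho> g)"
    then have j: "j < k" using rc[of g] by simp
    have "col (R g * B) j = R g *\<^sub>v (B *\<^sub>v unit_vec k j)"
      using mult_mat_vec_unit[OF B(2) j] col_mult2[OF c[OF g] B(2) j] by simp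
    also have "\<dots> = B *\<^sub>v f g j" using f[OF g] by blast
    also have "f g j = col (\<rho> g) j"
      using f[OF g, of j] j by (intro eq_vecI) (auto simp: \<rho>_def)
    also have "B *\<^sub>v col (\<rho> g) j = col (B * \<rho> g) j" using col_mult2[OF B(2) rc j] by simp
    finally show "col (R g * B) j = col (B * \<rho> g) j" .
  qed (use B(2) rc[of g] c[OF g] in auto)
  have RBv: "R g *\<^sub>v (B *\<^sub>v v) = B *\<^sub>v (\<rho> g *\<^sub>v v)" if "g \<in> carrier G" "v \<in> carrier_vec k" for g v
    using RB[OF that(1)] assoc_mult_mat_vec[OF c[OF that(1)] B(2) that(2)]
      assoc_mult_mat_vec[OF B(2) rc that(2), of g] by simp
  have cancel: "M = M'" if "M \<in> carrier_mat k k" "M' \<in> carrier_mat k k" "B * M = B * M'" for M M'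
  proof (rule mat_col_eqI)
    fix j assume "j < dim_col M'"
    then have j: "j < k" using that by simp
    have cols: "col M j \<in> carrier_vec k" "col M' j \<in> carrier_vec k"
      using that(1,2) by (metis carrier_matD(1) col_dim)+
    have "B *\<^sub>v col M j = B *\<^sub>v col M' j"
      using col_mult2[OF B(2) that(1) j] col_mult2[OF B(2) that(2) j] that(3) by simp
    then show "col M j = col M' j" by (rule inj[OF cols])
  qed (use that(1,2) in auto)
  have rep: "is_rep k \<rho>" unfolding is_rep_def
  proof (intro conjI ballI)
    fix g h assume gh: "g \<in> carrier G" "h \<in> carrier G"
    have "B * \<rho> (g \<otimes> h) = R g * R h * B" using RB[of "g \<otimes> h"] is_rep_mult[OF R gh] gh by simp
    also have "\<dots> = R g * (R h * B)" using assoc_mult_mat[OF c[OF gh(1)] c[OF gh(2)] B(2)] .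
    also have "\<dots> = R g * B * \<rho> h"
      unfolding RB[OF gh(2)] by (rule assoc_mult_mat[OF c[OF gh(1)] B(2) rc, symmetric])
    also have "\<dots> = B * (\<rho> g * \<rho> h)"
      unfolding RB[OF gh(1)] by (rule assoc_mult_mat[OF B(2) rc rc])
    finally show "\<rho> (g \<otimes> h) = \<rho> g * \<rho> h" by (rule cancel[OF rc mult_carrier_mat[OF rc rc]])
  next
    have "B * \<rho> \<one> = R \<one> * B" by (rule RB[symmetric]) simp
    also have "\<dots> = B * 1\<^sub>m k" using is_rep_one[OF R] B(2) by simp
    finally show "\<rho> \<one> = 1\<^sub>m k" by (rule cancel[OF rc one_carrier_mat])
  qed (rule rc)
  have "irreducible_rep G k \<rho>" unfolding irreducible_rep_def
  proof (intro conjI allI impI)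
    show "\<rho> \<in> hom G (GL k)" using rep is_rep_iff_hom by blast
    show "0 < k" by (rule B(1))
    fix V assume V: "VectorSpace.subspace class_ring V (module_vec TYPE(complex) k) \<and>
      (\<forall>g\<in>carrier G. \<forall>w\<in>V. \<rho> g *\<^sub>v w \<in> V)"
    show "V = {0\<^sub>v k} \<or> V = carrier_vec k"
    proof (cases "V = {0\<^sub>v k}")
      case False
      obtain l C where C: "l > 0" "C \<in> carrier_mat k l" "inj_mat C"
        "\<And>v. v \<in> carrier_vec l \<Longrightarrow> C *\<^sub>v v \<in> V"
        "\<And>w. w \<in> V \<Longrightarrow> \<exists>v\<in>carrier_vec l. C *\<^sub>v v = w"
        using subspace_basis_mat[OF conjunct1[OF V] False] by blast
      have BC: "B * C \<in> carrier_mat N l" using B(2) C(2) by simp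
      have BCv: "B * C *\<^sub>v v = B *\<^sub>v (C *\<^sub>v v)" if "v \<in> carrier_vec l" for v
        using assoc_mult_mat_vec[OF B(2) C(2) that] .
      have Cv: "C *\<^sub>v v \<in> carrier_vec k" if "v \<in> carrier_vec l" for v using C(2) that by simp
      have "P l (B * C)" unfolding P_def
      proof (intro conjI ballI)
        show "inj_mat (B * C)" by (rule inj_mat_mult[OF B(2) C(2) B(3) C(3)])
        fix g and v :: "complex vec" assume g: "g \<in> carrier G" and v: "v \<in> carrier_vec l"
        have "\<rho> g *\<^sub>v (C *\<^sub>v v) \<in> V" using V g C(4)[OF v] by blast
        then obtain u where u: "u \<in> carrier_vec l" "C *\<^sub>v u = \<rho> g *\<^sub>v (C *\<^sub>v v)" using C(5) by blast
        have "R g *\<^sub>v (B * C *\<^sub>v v) = B * C *\<^sub>v u"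
          using RBv[OF g Cv[OF v]] u BCv[OF v] BCv[OF u(1)] by simp
        then show "\<exists>u\<in>carrier_vec l. R g *\<^sub>v (B * C *\<^sub>v v) = B * C *\<^sub>v u" using u(1) by blast
      next
        fix v :: "complex vec" assume v: "v \<in> carrier_vec l"
        show "B * C *\<^sub>v v \<in> W" unfolding BCv[OF v] by (rule B(4)[OF Cv[OF v]])
      qed (use C BC in auto)
      \<comment> \<open>The columns of \<open>B * C\<close> span an invariant subspace of dimension
        \<open>l\<close>, so minimality gives k \<le> l, while independence of the columns of
        \<open>C\<close> gives l \<le> k.\<close>
      then have "k = l" using min inj_mat_dims[OF C(2,3)] by fastforce
      then obtain D where D: "D \<in> carrier_mat k k" "C * D = 1\<^sub>m k" and Ck: "C \<in> carrier_mat k k"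
        using inj_mat_square[of C k] C(2,3) by metis
      have "V = carrier_vec k"
      proof
        show "V \<subseteq> carrier_vec k" using V by (simp add: subspace_carrier_vec_iff)
        show "carrier_vec k \<subseteq> V"
        proof
          fix v :: "complex vec" assume v: "v \<in> carrier_vec k"
          have "C *\<^sub>v (D *\<^sub>v v) = v" using assoc_mult_mat_vec[OF Ck D(1) v] D(2) v by simp
          moreover have "D *\<^sub>v v \<in> carrier_vec l" using D(1) v \<open>k = l\<close> by simp
          ultimately show "v \<in> V" using C(4) by metis
        qed
      qed
      then show ?thesis ..
    qed simp
  qed
  then show thesis using that[of k \<rho> B] B RB by blast
qed

text \<open>Let \<open>T\<close> be the action of \<open>f\<close> on the regular representation. By Schur's lemma the action of a class
  function orthogonal to all irreducible characters vanishes on every irreducible subrepresentation;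
  this applies to \<open>T\<close> and to its adjoint. If \<open>T\<close> were nonzero, its image would contain an irreducible
  subrepresentation, annihilated by the adjoint of \<open>T\<close>, which is impossible.\<close>

theorem class_function_eq_0:
  assumes cf: "\<And>g h. g \<in> carrier G \<Longrightarrow> h \<in> carrier G \<Longrightarrow> f (h \<otimes> g \<otimes> inv h) = f g"
    and orth: "\<And>\<chi>. \<chi> \<in> Irr G \<Longrightarrow> (\<Sum>g\<in>carrier G. f g * \<chi> g) = 0" and g0: "g0 \<in> carrier G"
  shows "f g0 = (0 :: complex)"
proof -
  define N where "N = card (carrier G)"
  obtain x where x: "bij_betw x {..<N} (carrier G)"
    using ex_bij_betw_nat_finite[OF finite_carrier] by (auto simp: N_def lessThan_atLeast0)
  have xc: "x i \<in> carrier G" if "i < N" for i using x that by (auto dest: bij_betwE)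
  define R where "R g = mat N N (\<lambda>(i, j). if x i = g \<otimes> x j then 1 else (0::complex))" for g
  have Rc: "R g \<in> carrier_mat N N" and Rd [simp]: "dim_row (R g) = N" "dim_col (R g) = N" for g
    by (simp_all add: R_def)
  have x_sum: "(\<Sum>l<N. F (x l)) = (\<Sum>y\<in>carrier G. F y)" for F :: "'a \<Rightarrow> complex"
    by (rule sum.reindex_bij_betw[OF x])
  have x_inj: "x i = x j \<longleftrightarrow> i = j" if "i < N" "j < N" for i j
    using x that by (auto simp: bij_betw_def inj_on_def)
  have R: "is_rep N R" unfolding is_rep_def
  proof (intro conjI ballI)
    fix g h assume gh: "g \<in> carrier G" "h \<in> carrier G"
    show "R (g \<otimes> h) = R g * R h"
    proof (rule eq_matI)
      fix i j assume "i < dim_row (R g * R h)" "j < dim_col (R g * R h)"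
      then have ij: "i < N" "j < N" by auto
      have "(R g * R h) $$ (i, j) = (\<Sum>l<N. R g $$ (i, l) * R h $$ (l, j))"
        by (rule mult_mat_nth[OF Rc Rc ij])
      also have "\<dots> = (\<Sum>l<N. (\<lambda>y. if y = h \<otimes> x j then (if x i = g \<otimes> y then 1 else 0) else 0) (x l))"
        using ij by (intro sum.cong) (auto simp: R_def)
      also have "\<dots> = (\<Sum>y\<in>carrier G. if y = h \<otimes> x j then (if x i = g \<otimes> y then 1 else 0) else 0)"
        by (rule x_sum)
      also have "\<dots> = R (g \<otimes> h) $$ (i, j)" using gh ij xc by (simp add: R_def m_assoc)
      finally show "R (g \<otimes> h) $$ (i, j) = (R g * R h) $$ (i, j)" by simp
    qed auto
  next
    show "R \<one> = 1\<^sub>m N" using xc x_inj by (intro eq_matI) (auto simp: R_def)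
  qed (rule Rc)
  define T where "T f = mat_sum N N (carrier G) (\<lambda>g. f g \<cdot>\<^sub>m R g)" for f :: "'a \<Rightarrow> complex"
  have Tc: "T f \<in> carrier_mat N N" and Td [simp]: "dim_row (T f) = N" "dim_col (T f) = N" for f
    by (simp_all add: T_def mat_sum_def)
  \<comment> \<open>\<open>T f\<close> is the group matrix of \<open>f\<close>. Its entries make
    commutation with \<open>R\<close> and the adjoint visible, and the column of
    \<open>\<one>\<close> returns the values of \<open>f\<close>.\<close>
  have T_index: "T f $$ (i, j) = f (x i \<otimes> inv (x j))" if ij: "i < N" "j < N" for f i j
  proof -
    have "T f $$ (i, j) = (\<Sum>g\<in>carrier G. if g = x i \<otimes> inv (x j) then f g else 0)"
      unfolding T_def mat_sum_index[OF ij]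
    proof (rule sum.cong)
      fix g assume g: "g \<in> carrier G"
      have "x i = g \<otimes> x j \<longleftrightarrow> g = x i \<otimes> inv (x j)"
        using g xc[OF ij(1)] xc[OF ij(2)] by (metis inv_solve_right)
      then show "(f g \<cdot>\<^sub>m R g) $$ (i, j) = (if g = x i \<otimes> inv (x j) then f g else 0)"
        using ij by (simp add: R_def)
    qed simp
    then show ?thesis using xc ij by simp
  qed
  have T_irr: "T f * B = 0\<^sub>m N k"
    if cf: "\<And>g h. g \<in> carrier G \<Longrightarrow> h \<in> carrier G \<Longrightarrow> f (h \<otimes> g \<otimes> inv h) = f g"
    and orth: "\<And>\<chi>. \<chi> \<in> Irr G \<Longrightarrow> (\<Sum>g\<in>carrier G. f g * \<chi> g) = 0"
    and irr: "irreducible_rep G k \<rho>" and B: "B \<in> carrier_mat N k"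
    and RB: "\<And>g. g \<in> carrier G \<Longrightarrow> R g * B = B * \<rho> g" for f k \<rho> B
  proof -
    note rep = irreducible_repD(1)[OF irr]
    note rc = is_rep_carrier[OF rep]
    define S where "S = mat_sum k k (carrier G) (\<lambda>g. f g \<cdot>\<^sub>m \<rho> g)"
    have Sc: "S \<in> carrier_mat k k" by (simp add: S_def)
    have comm: "\<rho> h * S = S * \<rho> h" if h: "h \<in> carrier G" for h
    proof -
      have "\<rho> h * S = mat_sum k k (carrier G) (\<lambda>g. \<rho> h * (f g \<cdot>\<^sub>m \<rho> g))"
        unfolding S_def by (rule mat_sum_mult_left) (use rc h in auto)
      also have "\<dots> = mat_sum k k (carrier G) (\<lambda>g. (f (h \<otimes> g \<otimes> inv h) \<cdot>\<^sub>m \<rho> (h \<otimes> g \<otimes> inv h)) * \<rho> h)"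
      proof (rule mat_sum_cong)
        fix g assume g: "g \<in> carrier G"
        have "\<rho> (h \<otimes> g \<otimes> inv h) * \<rho> h = \<rho> (h \<otimes> g)"
          using is_rep_mult[OF rep, of "h \<otimes> g \<otimes> inv h" h] g h by (simp add: m_assoc)
        moreover have "\<rho> (h \<otimes> g) = \<rho> h * \<rho> g" by (rule is_rep_mult[OF rep h g])
        moreover have "\<rho> (h \<otimes> g \<otimes> inv h) \<in> carrier_mat k k" using g h rc by simp
        ultimately show "\<rho> h * (f g \<cdot>\<^sub>m \<rho> g) = (f (h \<otimes> g \<otimes> inv h) \<cdot>\<^sub>m \<rho> (h \<otimes> g \<otimes> inv h)) * \<rho> h"
          using mult_smult_distrib[OF rc[OF h] rc[OF g], of "f g"] cf[OF g h]
            mult_smult_assoc_mat[OF _ rc[OF h], of "\<rho> (h \<otimes> g \<otimes> inv h)" k "f g"] by simp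
      qed
      also have "\<dots> = mat_sum k k (carrier G) (\<lambda>g. (f g \<cdot>\<^sub>m \<rho> g) * \<rho> h)"
        by (rule mat_sum_reindex[OF bij_betw_conj[OF h], symmetric])
      also have "\<dots> = S * \<rho> h"
        unfolding S_def by (rule mat_sum_mult_right[symmetric]) (use rc h in auto)
      finally show ?thesis .
    qed
    obtain d where d: "S = d \<cdot>\<^sub>m 1\<^sub>m k" using schur_scalar[OF irr Sc comm] by blast
    have "d * of_nat k = trace S" unfolding d using trace_smult[of "1\<^sub>m k" k d] by simp
    also have "\<dots> = (\<Sum>g\<in>carrier G. trace (f g \<cdot>\<^sub>m \<rho> g))"
      unfolding S_def by (rule trace_mat_sum) (use rc in auto)
    also have "\<dots> = (\<Sum>g\<in>carrier G. f g * character G \<rho> g)"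
      by (rule sum.cong) (auto simp: trace_smult[OF rc] character_eq)
    also have "\<dots> = 0" by (rule orth) (use irr in \<open>auto simp: Irr_def\<close>)
    finally have "d = 0" using irreducible_repD(2)[OF irr] by simp
    then have S0: "S = 0\<^sub>m k k" unfolding d by (intro eq_matI) auto
    have "T f * B = mat_sum N k (carrier G) (\<lambda>g. (f g \<cdot>\<^sub>m R g) * B)"
      unfolding T_def by (rule mat_sum_mult_right) (use B Rc in auto)
    also have "\<dots> = mat_sum N k (carrier G) (\<lambda>g. B * (f g \<cdot>\<^sub>m \<rho> g))"
    proof (rule mat_sum_cong)
      fix g assume g: "g \<in> carrier G"
      show "(f g \<cdot>\<^sub>m R g) * B = B * (f g \<cdot>\<^sub>m \<rho> g)"
        unfolding mult_smult_assoc_mat[OF Rc B] mult_smult_distrib[OF B rc[OF g]] RB[OF g] ..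
    qed
    also have "\<dots> = B * S" unfolding S_def by (rule mat_sum_mult_left[symmetric]) (use B rc in auto)
    also have "\<dots> = 0\<^sub>m N k" unfolding S0 using B by simp
    finally show ?thesis .
  qed
  have T0: "T f = 0\<^sub>m N N"
  proof (rule ccontr)
    assume nz: "T f \<noteq> 0\<^sub>m N N"
    define W where "W = (\<lambda>v. T f *\<^sub>v v) ` carrier_vec N"
    have W: "VectorSpace.subspace class_ring W (module_vec TYPE(complex) N)"
      unfolding subspace_carrier_vec_iff
    proof (intro conjI allI ballI)
      show "W \<subseteq> carrier_vec N" using mult_mat_vec_carrier[OF Tc] by (auto simp: W_def)
      show "0\<^sub>v N \<in> W" unfolding W_def
        by (intro image_eqI[of _ _ "0\<^sub>v N"]) (auto simp: mult_mat_vec_zero[OF Tc])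
      fix v w assume "v \<in> W" "w \<in> W"
      then obtain a b where ab: "a \<in> carrier_vec N" "v = T f *\<^sub>v a" "b \<in> carrier_vec N" "w = T f *\<^sub>v b"
        unfolding W_def by auto
      then show "v + w \<in> W" unfolding W_def
        by (intro image_eqI[of _ _ "a + b"]) (auto simp: mult_add_distrib_mat_vec[OF Tc])
    next
      fix d v assume "v \<in> W"
      then obtain a where "a \<in> carrier_vec N" "v = T f *\<^sub>v a" unfolding W_def by auto
      then show "d \<cdot>\<^sub>v v \<in> W" unfolding W_def
        by (intro image_eqI[of _ _ "d \<cdot>\<^sub>v a"]) (auto simp: mult_mat_vec[OF Tc])
    qed
    have Tcomm: "R h * T f = T f * R h" if h: "h \<in> carrier G" for h
    proof (rule eq_matI)
      fix i j assume "i < dim_row (T f * R h)" "j < dim_col (T f * R h)"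
      then have ij: "i < N" "j < N" by auto
      note xij = xc[OF ij(1)] xc[OF ij(2)]
      have "(R h * T f) $$ (i, j) = (\<Sum>l<N. R h $$ (i, l) * T f $$ (l, j))"
        by (rule mult_mat_nth[OF Rc Tc ij])
      also have "\<dots> = (\<Sum>l<N. (\<lambda>y. if y = inv h \<otimes> x i then f (y \<otimes> inv (x j)) else 0) (x l))"
      proof (rule sum.cong)
        fix l assume "l \<in> {..<N}"
        then have l: "l < N" by simp
        have "x i = h \<otimes> x l \<longleftrightarrow> x l = inv h \<otimes> x i"
          using h xc[OF l] xij(1) by (metis inv_solve_left)
        then show "R h $$ (i, l) * T f $$ (l, j) =
            (\<lambda>y. if y = inv h \<otimes> x i then f (y \<otimes> inv (x j)) else 0) (x l)"
          using l ij by (simp add: R_def T_index)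
      qed simp
      also have "\<dots> = f (inv h \<otimes> x i \<otimes> inv (x j))"
        using x_sum[of "\<lambda>y. if y = inv h \<otimes> x i then f (y \<otimes> inv (x j)) else 0"] h xij by simp
      also have "\<dots> = f (x i \<otimes> inv (h \<otimes> x j))"
        using cf[of "inv h \<otimes> x i \<otimes> inv (x j)" h] h xij
        by (simp add: m_assoc[symmetric] inv_mult_group)
      also have "\<dots> = (\<Sum>l<N. (\<lambda>y. if y = h \<otimes> x j then f (x i \<otimes> inv y) else 0) (x l))"
        using x_sum[of "\<lambda>y. if y = h \<otimes> x j then f (x i \<otimes> inv y) else 0"] h xij by simp
      also have "\<dots> = (\<Sum>l<N. T f $$ (i, l) * R h $$ (l, j))"
        by (rule sum.cong) (use ij in \<open>auto simp: R_def T_index\<close>)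
      also have "\<dots> = (T f * R h) $$ (i, j)"
        by (rule mult_mat_nth[OF Tc Rc ij, symmetric])
      finally show "(R h * T f) $$ (i, j) = (T f * R h) $$ (i, j)" .
    qed auto
    have Winv: "R g *\<^sub>v w \<in> W" if g: "g \<in> carrier G" and w: "w \<in> W" for g w
    proof -
      obtain a where a: "a \<in> carrier_vec N" "w = T f *\<^sub>v a" using w unfolding W_def by auto
      have "R g *\<^sub>v w = T f *\<^sub>v (R g *\<^sub>v a)"
        using assoc_mult_mat_vec[OF Rc Tc a(1), of g f] assoc_mult_mat_vec[OF Tc Rc a(1), of f g]
          Tcomm[OF g] a(2) by simp
      then show ?thesis unfolding W_def using mult_mat_vec_carrier[OF Rc a(1), of g] by auto
    qed
    have "W \<noteq> {0\<^sub>v N}"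
    proof
      assume W0: "W = {0\<^sub>v N}"
      have "T f $$ (i, j) = 0" if ij: "i < N" "j < N" for i j
      proof -
        have "col (T f) j \<in> W" unfolding W_def mult_mat_vec_unit[OF Tc ij(2), symmetric] by simp
        then have "col (T f) j $ i = 0" using W0 ij by simp
        then show ?thesis using ij by simp
      qed
      then have "T f = 0\<^sub>m N N" by (intro eq_matI) auto
      then show False using nz by blast
    qed
    from exists_irreducible_subrep[OF R W this Winv] obtain k \<rho> B where
      irr: "irreducible_rep G k \<rho>" and B: "B \<in> carrier_mat N k" "inj_mat B"
      and RB: "\<And>g. g \<in> carrier G \<Longrightarrow> R g * B = B * \<rho> g"
      and BW: "\<And>v. v \<in> carrier_vec k \<Longrightarrow> B *\<^sub>v v \<in> W" by blast
    \<comment> \<open>Chosen so that \<open>T f'\<close> is the adjoint of \<open>T f\<close>; both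
      hypotheses on \<open>f\<close> pass to it by substituting inverses and conjugating.\<close>
    define f' where "f' g = cnj (f (inv g))" for g
    have T': "T f' = ctrans (T f)"
      using xc by (intro eq_matI) (auto simp: T_index ctrans_def f'_def inv_mult_group)
    have cf': "f' (h \<otimes> g \<otimes> inv h) = f' g" if "g \<in> carrier G" "h \<in> carrier G" for g h
      using cf[of "inv g" h] that by (simp add: f'_def inv_mult_group m_assoc)
    have orth': "(\<Sum>g\<in>carrier G. f' g * \<chi> g) = 0" if \<chi>: "\<chi> \<in> Irr G" for \<chi>
    proof -
      have "(\<Sum>g\<in>carrier G. f' g * \<chi> g) = (\<Sum>g\<in>carrier G. f' (inv g) * \<chi> (inv g))"
        by (rule sum.reindex_bij_betw[OF bij_betw_inv, symmetric])
      also have "\<dots> = (\<Sum>g\<in>carrier G. cnj (f g * \<chi> g))"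
        by (rule sum.cong) (auto simp: f'_def Irr_inv[OF \<chi>])
      also have "\<dots> = cnj (\<Sum>g\<in>carrier G. f g * \<chi> g)" by simp
      also have "\<dots> = 0" using orth[OF \<chi>] by simp
      finally show ?thesis .
    qed
    have TB: "T f' * B = 0\<^sub>m N k" by (rule T_irr[OF cf' orth' irr B(1) RB])
    have k0: "k > 0" by (rule irreducible_repD(2)[OF irr])
    define b where "b = B *\<^sub>v unit_vec k 0"
    have bW: "b \<in> W" unfolding b_def by (rule BW) simp
    then obtain a where a: "a \<in> carrier_vec N" "b = T f *\<^sub>v a" unfolding W_def by auto
    have "(ctrans (T f) * T f) *\<^sub>v a = T f' *\<^sub>v b"
      unfolding T' a(2) by (rule assoc_mult_mat_vec[OF ctrans_carrier[OF Tc] Tc a(1)])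
    also have "\<dots> = (T f' * B) *\<^sub>v unit_vec k 0"
      unfolding b_def by (rule assoc_mult_mat_vec[OF Tc B(1), symmetric]) simp
    also have "\<dots> = 0\<^sub>v N" unfolding TB by (intro eq_vecI) auto
    finally have z: "(ctrans (T f) * T f) *\<^sub>v a = 0\<^sub>v N" .
    have "complex_of_real (\<Sum>j<N. (cmod ((T f *\<^sub>v a) $ j))\<^sup>2) = 0"
      unfolding ctrans_mult_quadratic[OF Tc a(1), symmetric] z by simp
    then have "(\<Sum>j<N. (cmod (b $ j))\<^sup>2) = 0" unfolding a(2) by (simp only: of_real_eq_0_iff)
    then have "b $ j = 0" if "j < N" for j
      using that by (subst (asm) sum_nonneg_eq_0_iff) auto
    then have "b = 0\<^sub>v N" using a by (intro eq_vecI) auto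
    then have u: "unit_vec k 0 = (0\<^sub>v k :: complex vec)"
      using inj_matD[OF B(2,1), of "unit_vec k 0"] unfolding b_def by simp
    have "unit_vec k 0 $ 0 = (1 :: complex)" using k0 by simp
    then show False unfolding u using k0 by simp
  qed
  obtain i j where ij: "i < N" "x i = g0" "j < N" "x j = \<one>"
    using x g0 one_closed unfolding bij_betw_def by (metis imageE lessThan_iff)
  have "f g0 = T f $$ (i, j)" using T_index[OF ij(1,3), of f] ij g0 by simp
  also have "\<dots> = 0" unfolding T0 using ij by simp
  finally show ?thesis .
qed


section \<open>Conjugacy classes, column orthogonality and the count of real classes\<close>

definition conj_class :: "'a \<Rightarrow> 'a set" where
  "conj_class x = (\<lambda>h. h \<otimes> x \<otimes> inv h) ` carrier G"

lemma conj_class_subset: "x \<in> carrier G \<Longrightarrow> conj_class x \<subseteq> carrier G"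
  by (auto simp: conj_class_def)

lemma finite_conj_class: "finite (conj_class x)"
  by (simp add: conj_class_def)

lemma conj_class_self: "x \<in> carrier G \<Longrightarrow> x \<in> conj_class x"
  unfolding conj_class_def by (rule image_eqI[of _ _ \<one>]) auto

lemma conj_mem_conj_class:
  assumes "x \<in> carrier G" "h \<in> carrier G" "y \<in> conj_class x"
  shows "h \<otimes> y \<otimes> inv h \<in> conj_class x"
proof -
  obtain k where "k \<in> carrier G" "y = k \<otimes> x \<otimes> inv k" using assms(3) by (auto simp: conj_class_def)
  then show ?thesis unfolding conj_class_def
    by (intro image_eqI[of _ _ "h \<otimes> k"]) (use assms in \<open>auto simp: m_assoc inv_mult_group\<close>)
qed

lemma conj_class_sym:
  assumes "x \<in> carrier G" "y \<in> conj_class x"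
  shows "x \<in> conj_class y"
proof -
  obtain k where k: "k \<in> carrier G" "y = k \<otimes> x \<otimes> inv k" using assms(2) by (auto simp: conj_class_def)
  then have "x = inv k \<otimes> y \<otimes> inv (inv k)" using assms(1)
    by (simp add: m_assoc) (simp add: m_assoc[symmetric])
  then show ?thesis unfolding conj_class_def using k(1) by blast
qed

lemma conj_class_eq:
  assumes "x \<in> carrier G" "y \<in> conj_class x"
  shows "conj_class y = conj_class x"
proof -
  have sub: "conj_class y \<subseteq> conj_class x" if "x \<in> carrier G" "y \<in> conj_class x" for x y
    using conj_mem_conj_class[OF that(1) _ that(2)] by (auto simp: conj_class_def[of y])
  have "y \<in> carrier G" using assms conj_class_subset by blast
  then show ?thesis using sub[OF assms] sub[OF _ conj_class_sym[OF assms]] by blast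
qed

lemma conj_mem_conj_class_iff:
  assumes "x \<in> carrier G" "h \<in> carrier G" "g \<in> carrier G"
  shows "h \<otimes> g \<otimes> inv h \<in> conj_class x \<longleftrightarrow> g \<in> conj_class x"
proof
  assume "h \<otimes> g \<otimes> inv h \<in> conj_class x"
  then have "inv h \<otimes> (h \<otimes> g \<otimes> inv h) \<otimes> inv (inv h) \<in> conj_class x"
    by (rule conj_mem_conj_class[OF assms(1) inv_closed[OF assms(2)]])
  moreover have "inv h \<otimes> (h \<otimes> g \<otimes> inv h) \<otimes> inv (inv h) = g"
    using assms by (simp add: m_assoc) (simp add: m_assoc[symmetric])
  ultimately show "g \<in> conj_class x" by simp
qed (rule conj_mem_conj_class[OF assms(1,2)])

text \<open>By orthogonality the value lists of distinct irreducible characters are independent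
  columns of length |G|. The bound makes \<open>Irr G\<close> finite; a sum over an infinite set
  would be 0 by default.\<close>

lemma card_subset_Irr_le:
  assumes "F \<subseteq> Irr G" "finite F"
  shows "card F \<le> card (carrier G)"
proof -
  define N where "N = card (carrier G)"
  define k where "k = card F"
  obtain x where x: "bij_betw x {..<N} (carrier G)"
    using ex_bij_betw_nat_finite[OF finite_carrier] by (auto simp: N_def lessThan_atLeast0)
  obtain c where c: "bij_betw c {..<k} F"
    using ex_bij_betw_nat_finite[OF assms(2)] by (auto simp: k_def lessThan_atLeast0)
  have cI: "c j \<in> Irr G" if "j < k" for j using c that assms(1) by (auto dest: bij_betwE)
  define B where "B = mat N k (\<lambda>(i, j). c j (x i))"
  have B: "B \<in> carrier_mat N k" by (simp add: B_def)
  have "inj_mat B" unfolding inj_mat_def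
  proof (intro ballI impI)
    fix v assume "v \<in> carrier_vec (dim_col B)" "B *\<^sub>v v = 0\<^sub>v (dim_row B)"
    then have v: "v \<in> carrier_vec k" "B *\<^sub>v v = 0\<^sub>v N" using B by auto
    have rel: "(\<Sum>j<k. c j g * v $ j) = 0" if g: "g \<in> carrier G" for g
    proof -
      obtain i where i: "i < N" "x i = g" using x g by (metis bij_betw_imp_surj_on imageE lessThan_iff)
      have "(\<Sum>j<k. c j g * v $ j) = (B *\<^sub>v v) $ i"
        unfolding mult_mat_vec_nth[OF B v(1) i(1)] using i by (intro sum.cong) (auto simp: B_def)
      then show ?thesis using v(2) i(1) by simp
    qed
    have "v $ l = 0" if l: "l < k" for l
    proof -
      have "0 = (\<Sum>g\<in>carrier G. (\<Sum>j<k. c j g * v $ j) * c l (inv g))" using rel by simp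
      also have "\<dots> = (\<Sum>g\<in>carrier G. \<Sum>j<k. v $ j * (c j g * c l (inv g)))"
        by (simp add: sum_distrib_left sum_distrib_right ac_simps)
      also have "\<dots> = (\<Sum>j<k. \<Sum>g\<in>carrier G. v $ j * (c j g * c l (inv g)))" by (rule sum.swap)
      also have "\<dots> = (\<Sum>j<k. v $ j * (\<Sum>g\<in>carrier G. c j g * c l (inv g)))"
        by (simp add: sum_distrib_left)
      also have "\<dots> = (\<Sum>j<k. if j = l then v $ j * of_nat N else 0)"
      proof (rule sum.cong)
        fix j assume "j \<in> {..<k}"
        then have j: "j < k" by simp
        have "c j = c l \<longleftrightarrow> j = l" using c j l by (auto simp: bij_betw_def inj_on_def)
        then show "v $ j * (\<Sum>g\<in>carrier G. c j g * c l (inv g)) = (if j = l then v $ j * of_nat N else 0)"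
          unfolding Irr_orthogonal[OF cI[OF j] cI[OF l]] by (simp add: N_def)
      qed simp
      also have "\<dots> = v $ l * of_nat N" using l by simp
      finally have "v $ l * of_nat N = 0" by simp
      moreover have "N \<noteq> 0" unfolding N_def using finite_carrier one_closed by (metis card_eq_0_iff empty_iff)
      ultimately show ?thesis by simp
    qed
    then show "v = 0\<^sub>v (dim_col B)" using v(1) B by (intro eq_vecI) auto
  qed
  from inj_mat_dims[OF B this] show ?thesis by (simp add: N_def k_def)
qed

lemma finite_Irr: "finite (Irr G)"
  using finite_if_finite_subsets_card_bdd[of "Irr G" "card (carrier G)"] card_subset_Irr_le by blast

text \<open>The left side is the expansion of the indicator function of the class of
  \<open>x\<close> in irreducible characters. The difference of the two sides is a class function
  orthogonal to every irreducible character, hence 0.\<close>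

lemma column_orthogonality:
  assumes x: "x \<in> carrier G" and g: "g \<in> carrier G"
  shows "of_nat (card (conj_class x)) / of_nat (card (carrier G)) * (\<Sum>\<chi>\<in>Irr G. \<chi> x * \<chi> (inv g))
    = (if g \<in> conj_class x then 1 else 0 :: complex)"
proof -
  let ?q = "of_nat (card (conj_class x)) / of_nat (card (carrier G)) :: complex"
  define f where "f g = (if g \<in> conj_class x then 1 else 0) - ?q * (\<Sum>\<chi>\<in>Irr G. \<chi> x * \<chi> (inv g))" for g
  have G0: "(of_nat (card (carrier G)) :: complex) \<noteq> 0"
    using finite_carrier one_closed by (metis card_eq_0_iff empty_iff of_nat_eq_0_iff)
  have cf: "f (h \<otimes> g \<otimes> inv h) = f g" if "g \<in> carrier G" "h \<in> carrier G" for g h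
  proof -
    have "inv (h \<otimes> g \<otimes> inv h) = h \<otimes> inv g \<otimes> inv h" using that by (simp add: inv_mult_group m_assoc)
    then have "\<chi> (inv (h \<otimes> g \<otimes> inv h)) = \<chi> (inv g)" if "\<chi> \<in> Irr G" for \<chi>
      using Irr_conj[OF that, of "inv g" h] \<open>g \<in> carrier G\<close> \<open>h \<in> carrier G\<close> by simp
    then have "(\<Sum>\<chi>\<in>Irr G. \<chi> x * \<chi> (inv (h \<otimes> g \<otimes> inv h))) = (\<Sum>\<chi>\<in>Irr G. \<chi> x * \<chi> (inv g))"
      by (intro sum.cong) auto
    then show ?thesis unfolding f_def using conj_mem_conj_class_iff[OF x that(2,1)] by simp
  qed
  have orth: "(\<Sum>g\<in>carrier G. f g * \<psi> g) = 0" if \<psi>: "\<psi> \<in> Irr G" for \<psi>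
  proof -
    have "(\<Sum>g\<in>carrier G. (if g \<in> conj_class x then 1 else 0) * \<psi> g) = (\<Sum>g\<in>carrier G. if g \<in> conj_class x then \<psi> x else 0)"
      by (rule sum.cong) (use x Irr_conj[OF \<psi> x] in \<open>auto simp: conj_class_def\<close>)
    also have "\<dots> = (\<Sum>g\<in>conj_class x. \<psi> x)"
      using conj_class_subset[OF x] by (simp add: sum.If_cases Int_absorb1 Collect_mem_eq)
    also have "\<dots> = of_nat (card (conj_class x)) * \<psi> x" by simp
    finally have 1: "(\<Sum>g\<in>carrier G. (if g \<in> conj_class x then 1 else 0) * \<psi> g) = of_nat (card (conj_class x)) * \<psi> x" .
    have "(\<Sum>g\<in>carrier G. (\<Sum>\<chi>\<in>Irr G. \<chi> x * \<chi> (inv g)) * \<psi> g)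
        = (\<Sum>g\<in>carrier G. \<Sum>\<chi>\<in>Irr G. \<chi> x * (\<psi> g * \<chi> (inv g)))"
      by (simp add: sum_distrib_left sum_distrib_right ac_simps)
    also have "\<dots> = (\<Sum>\<chi>\<in>Irr G. \<Sum>g\<in>carrier G. \<chi> x * (\<psi> g * \<chi> (inv g)))" by (rule sum.swap)
    also have "\<dots> = (\<Sum>\<chi>\<in>Irr G. \<chi> x * (\<Sum>g\<in>carrier G. \<psi> g * \<chi> (inv g)))"
      by (simp add: sum_distrib_left)
    also have "\<dots> = (\<Sum>\<chi>\<in>Irr G. if \<chi> = \<psi> then \<chi> x * of_nat (card (carrier G)) else 0)"
      by (rule sum.cong) (auto simp: Irr_orthogonal[OF \<psi>])
    also have "\<dots> = \<psi> x * of_nat (card (carrier G))" using \<psi> finite_Irr by simp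
    finally have 2: "(\<Sum>g\<in>carrier G. (\<Sum>\<chi>\<in>Irr G. \<chi> x * \<chi> (inv g)) * \<psi> g) = \<psi> x * of_nat (card (carrier G))" .
    have "(\<Sum>g\<in>carrier G. f g * \<psi> g) = (\<Sum>g\<in>carrier G. (if g \<in> conj_class x then 1 else 0) * \<psi> g
        - ?q * ((\<Sum>\<chi>\<in>Irr G. \<chi> x * \<chi> (inv g)) * \<psi> g))"
      unfolding f_def left_diff_distrib mult.assoc ..
    also have "\<dots> = (\<Sum>g\<in>carrier G. (if g \<in> conj_class x then 1 else 0) * \<psi> g)
        - ?q * (\<Sum>g\<in>carrier G. (\<Sum>\<chi>\<in>Irr G. \<chi> x * \<chi> (inv g)) * \<psi> g)"
      unfolding sum_subtractf sum_distrib_left[of ?q] ..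
    finally have "(\<Sum>g\<in>carrier G. f g * \<psi> g) = (\<Sum>g\<in>carrier G. (if g \<in> conj_class x then 1 else 0) * \<psi> g)
        - ?q * (\<Sum>g\<in>carrier G. (\<Sum>\<chi>\<in>Irr G. \<chi> x * \<chi> (inv g)) * \<psi> g)" .
    then show ?thesis unfolding 1 2 using G0 by simp
  qed
  have "f g = 0" by (rule class_function_eq_0[OF cf orth g])
  then show ?thesis unfolding f_def by simp
qed

theorem card_real_valued_Irr:
  "card (real_valued_Irr G) = card (conj_class ` {x \<in> carrier G. inv x \<in> conj_class x})"
proof -
  let ?R = "{x \<in> carrier G. inv x \<in> conj_class x}"
  let ?N = "of_nat (card (carrier G)) :: complex"
  have G0: "?N \<noteq> 0"
    using finite_carrier one_closed by (metis card_eq_0_iff empty_iff of_nat_eq_0_iff)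
  have square_sum: "(\<Sum>x\<in>carrier G. \<chi> x * \<chi> x) = (if \<chi> \<in> real_valued_Irr G then ?N else 0)"
    if \<chi>: "\<chi> \<in> Irr G" for \<chi>
  proof -
    let ?\<psi> = "\<lambda>g\<in>carrier G. cnj (\<chi> g)"
    have "(\<Sum>x\<in>carrier G. \<chi> x * \<chi> x) = (\<Sum>x\<in>carrier G. \<chi> x * ?\<psi> (inv x))"
      by (rule sum.cong) (auto simp: Irr_inv[OF \<chi>])
    also have "\<dots> = (if \<chi> = ?\<psi> then ?N else 0)" by (rule Irr_orthogonal[OF \<chi> Irr_cnj[OF \<chi>]])
    also have "\<chi> = ?\<psi> \<longleftrightarrow> (\<forall>g\<in>carrier G. \<chi> g = cnj (\<chi> g))"
    proof
      assume eq: "\<chi> = ?\<psi>"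
      show "\<forall>g\<in>carrier G. \<chi> g = cnj (\<chi> g)"
      proof
        fix g assume "g \<in> carrier G"
        then show "\<chi> g = cnj (\<chi> g)" using fun_cong[OF eq, of g] by simp
      qed
    next
      assume "\<forall>g\<in>carrier G. \<chi> g = cnj (\<chi> g)"
      then show "\<chi> = ?\<psi>"
        using Irr_extensional[OF \<chi>] by (intro extensionalityI[of _ "carrier G"]) auto
    qed
    also have "\<dots> \<longleftrightarrow> \<chi> \<in> real_valued_Irr G"
      using \<chi> by (auto simp: real_valued_Irr_def Reals_cnj_iff)
    finally show ?thesis .
  qed
  have col: "(if inv x \<in> conj_class x then 1 / of_nat (card (conj_class x)) else 0)
      = (\<Sum>\<chi>\<in>Irr G. \<chi> x * \<chi> x) / ?N" if x: "x \<in> carrier G" for x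
  proof -
    have "(of_nat (card (conj_class x)) :: complex) \<noteq> 0"
      using conj_class_self[OF x] finite_conj_class by (metis card_eq_0_iff empty_iff of_nat_eq_0_iff)
    then show ?thesis using column_orthogonality[OF x inv_closed[OF x]] x G0
      by (auto simp: field_simps)
  qed
  have "of_nat (card (conj_class ` ?R)) = (\<Sum>C\<in>conj_class ` ?R. 1 :: complex)" by simp
  \<comment> \<open>Giving each element the weight 1 / |class| turns the count of classes into a sum
    over group elements, to which \<open>col\<close> applies.\<close>
  also have "\<dots> = (\<Sum>C\<in>conj_class ` ?R. \<Sum>x | x \<in> ?R \<and> conj_class x = C. 1 / of_nat (card (conj_class x)))"
  proof (rule sum.cong)
    fix C assume "C \<in> conj_class ` ?R"
    then obtain y where y: "y \<in> carrier G" "inv y \<in> conj_class y" "C = conj_class y" by auto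
    have "{x \<in> carrier G. inv x \<in> conj_class x \<and> conj_class x = C} = C"
    proof (intro equalityI subsetI)
      fix x assume "x \<in> {x \<in> carrier G. inv x \<in> conj_class x \<and> conj_class x = C}"
      then show "x \<in> C" using conj_class_self by blast
    next
      fix x assume "x \<in> C"
      then obtain h where h: "h \<in> carrier G" "x = h \<otimes> y \<otimes> inv h" and xC: "x \<in> conj_class y"
        using y(3) by (auto simp: conj_class_def)
      have "inv x = h \<otimes> inv y \<otimes> inv h" using h y(1) by (simp add: inv_mult_group m_assoc)
      then have "inv x \<in> conj_class y" using conj_mem_conj_class[OF y(1) h(1) y(2)] by simp
      then show "x \<in> {x \<in> carrier G. inv x \<in> conj_class x \<and> conj_class x = C}"
        using conj_class_eq[OF y(1) xC] conj_class_subset[OF y(1)] xC y(3) by auto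
    qed
    then have "(\<Sum>x | x \<in> ?R \<and> conj_class x = C. 1 / of_nat (card (conj_class x)))
        = (\<Sum>x\<in>C. 1 / of_nat (card C) :: complex)"
      by (intro sum.cong) auto
    also have "\<dots> = 1"
      using finite_conj_class[of y] conj_class_self[OF y(1)] y(3) by (auto simp: card_eq_0_iff)
    finally show "1 = (\<Sum>x | x \<in> ?R \<and> conj_class x = C. 1 / of_nat (card (conj_class x)) :: complex)"
      by (rule sym)
  qed simp
  also have "\<dots> = (\<Sum>x\<in>?R. 1 / of_nat (card (conj_class x)))"
    by (rule sum.image_gen[symmetric]) simp
  also have "\<dots> = (\<Sum>x\<in>carrier G. if inv x \<in> conj_class x then 1 / of_nat (card (conj_class x)) else 0)"
    by (rule sum.inter_filter) simp
  also have "\<dots> = (\<Sum>x\<in>carrier G. (\<Sum>\<chi>\<in>Irr G. \<chi> x * \<chi> x) / ?N)"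
    by (rule sum.cong) (auto simp: col)
  also have "\<dots> = (\<Sum>x\<in>carrier G. \<Sum>\<chi>\<in>Irr G. \<chi> x * \<chi> x) / ?N" by (simp add: sum_divide_distrib)
  also have "(\<Sum>x\<in>carrier G. \<Sum>\<chi>\<in>Irr G. \<chi> x * \<chi> x) = (\<Sum>\<chi>\<in>Irr G. \<Sum>x\<in>carrier G. \<chi> x * \<chi> x)"
    by (rule sum.swap)
  also have "\<dots> = (\<Sum>\<chi>\<in>Irr G. if \<chi> \<in> real_valued_Irr G then ?N else 0)"
    by (rule sum.cong) (auto simp: square_sum)
  also have "\<dots> = (\<Sum>\<chi>\<in>{\<chi> \<in> Irr G. \<chi> \<in> real_valued_Irr G}. ?N)"
    by (rule sum.inter_filter[symmetric, OF finite_Irr])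
  also have "{\<chi> \<in> Irr G. \<chi> \<in> real_valued_Irr G} = real_valued_Irr G"
    by (auto simp: real_valued_Irr_def)
  finally have "of_nat (card (conj_class ` ?R)) = (of_nat (card (real_valued_Irr G)) :: complex)"
    using G0 by simp
  then show ?thesis using of_nat_eq_iff by metis
qed

end

section \<open>The field with eight elements\<close>

text \<open>\<open>GF8 a b c\<close> stands for \<open>a + b t + c t\<^sup>2\<close> with \<open>t\<^sup>3 = t + 1\<close>.\<close>

datatype gf8 = GF8 bool bool bool

lemma gf8_cases:
  obtains "x = GF8 False False False" | "x = GF8 True False False"
  | "x = GF8 False True False" | "x = GF8 True True False"
  | "x = GF8 False False True" | "x = GF8 True False True"
  | "x = GF8 False True True" | "x = GF8 True True True"
  by (metis gf8.exhaust)

instantiation gf8 :: field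
begin

definition zero_gf8 :: gf8 where "0 = GF8 False False False"
definition one_gf8 :: gf8 where "1 = GF8 True False False"

fun plus_gf8 :: "gf8 \<Rightarrow> gf8 \<Rightarrow> gf8" where
  "GF8 a b c + GF8 a' b' c' = GF8 (a \<noteq> a') (b \<noteq> b') (c \<noteq> c')"

text \<open>Reduction uses t^3 = t + 1 and t^4 = t^2 + t; addition of bits is
  \<open>\<noteq>\<close>.\<close>

fun times_gf8 :: "gf8 \<Rightarrow> gf8 \<Rightarrow> gf8" where
  "GF8 a b c * GF8 a' b' c' = GF8
     ((a \<and> a') \<noteq> ((b \<and> c') \<noteq> (c \<and> b')))
     (((a \<and> b') \<noteq> (b \<and> a')) \<noteq> (((b \<and> c') \<noteq> (c \<and> b')) \<noteq> (c \<and> c')))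
     (((a \<and> c') \<noteq> ((b \<and> b') \<noteq> (c \<and> a'))) \<noteq> (c \<and> c'))"

definition uminus_gf8 :: "gf8 \<Rightarrow> gf8" where "- x = (x :: gf8)"
definition minus_gf8 :: "gf8 \<Rightarrow> gf8 \<Rightarrow> gf8" where "x - y = (x + y :: gf8)"
text \<open>The sixth power: nonzero elements satisfy x^7 = 1, and 0 goes to 0 as required.\<close>

definition inverse_gf8 :: "gf8 \<Rightarrow> gf8" where "inverse x = (x * x * (x * x * (x * x)) :: gf8)"
definition divide_gf8 :: "gf8 \<Rightarrow> gf8 \<Rightarrow> gf8" where "x div y = (x * inverse y :: gf8)"

instance
proof
  fix x y z :: gf8
  show "x * y * z = x * (y * z)" by (cases x; cases y; cases z) (simp only: times_gf8.simps plus_gf8.simps gf8.inject; intro conjI; argo)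
  show "x * y = y * x" by (cases x; cases y) auto
  show "1 * x = x" by (cases x) (simp add: one_gf8_def)
  show "x + y + z = x + (y + z)" by (cases x; cases y; cases z) auto
  show "x + y = y + x" by (cases x; cases y) auto
  show "0 + x = x" by (cases x) (simp add: zero_gf8_def)
  show "- x + x = 0" by (cases x) (simp add: zero_gf8_def uminus_gf8_def)
  show "x - y = x + - y" by (simp add: uminus_gf8_def minus_gf8_def)
  show "(x + y) * z = x * z + y * z" by (cases x; cases y; cases z) (simp only: times_gf8.simps plus_gf8.simps gf8.inject; intro conjI; argo)
  show "(0 :: gf8) \<noteq> 1" by (simp add: zero_gf8_def one_gf8_def)
  show "x \<noteq> 0 \<Longrightarrow> inverse x * x = 1"
    by (cases x rule: gf8_cases) (simp_all add: zero_gf8_def one_gf8_def inverse_gf8_def)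
  show "x div y = x * inverse y" by (simp add: divide_gf8_def)
  show "inverse (0 :: gf8) = 0" by (simp add: zero_gf8_def inverse_gf8_def)
qed

end

lemma UNIV_gf8: "(UNIV :: gf8 set) =
  {GF8 False False False, GF8 True False False, GF8 False True False, GF8 True True False,
   GF8 False False True, GF8 True False True, GF8 False True True, GF8 True True True}"
proof -
  have "x \<in> {GF8 False False False, GF8 True False False, GF8 False True False, GF8 True True False,
    GF8 False False True, GF8 True False True, GF8 False True True, GF8 True True True}" for x
    by (cases x rule: gf8_cases) simp_all
  then show ?thesis by blast
qed

instance gf8 :: finite
  by standard (simp add: UNIV_gf8)

lemma card_gf8: "card (UNIV :: gf8 set) = 8"
  by (subst UNIV_gf8) simp

lemma gf8_add_self [simp]: "x + x = (0 :: gf8)"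
  by (cases x) (simp add: zero_gf8_def)

lemma gf8_add_self_left [simp]: "x + (x + y) = (y :: gf8)"
  by (simp add: add.assoc[symmetric])

lemma gf8_two [simp]: "(2 :: gf8) = 0"
  by (simp flip: one_add_one)

lemma gf8_add_eq_0_iff: "x + y = 0 \<longleftrightarrow> x = (y :: gf8)"
  by (metis add.right_neutral gf8_add_self_left)

lemma gf8_uminus [simp]: "- x = (x :: gf8)"
  by (simp add: uminus_gf8_def)

lemma gf8_pow7: "x \<noteq> 0 \<Longrightarrow> x ^ 7 = (1 :: gf8)"
  by (cases x rule: gf8_cases) (simp_all add: zero_gf8_def one_gf8_def eval_nat_numeral)

text \<open>The Frobenius automorphism, \<theta> in the overview.\<close>

definition fr :: "gf8 \<Rightarrow> gf8" where "fr x = x * x"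

lemma fr_add [simp]: "fr (x + y) = fr x + fr y"
  by (simp add: fr_def algebra_simps)

lemma fr_mult [simp]: "fr (x * y) = fr x * fr y"
  by (simp add: fr_def ac_simps)

lemma fr_fr_fr [simp]: "fr (fr (fr x)) = x"
  by (cases x rule: gf8_cases) (simp_all add: fr_def)

lemma fr_0 [simp]: "fr 0 = 0" and fr_1 [simp]: "fr 1 = 1"
  by (simp_all add: fr_def)

lemma fr_eq_0_iff [simp]: "fr x = 0 \<longleftrightarrow> x = 0"
  by (simp add: fr_def)

lemma fr_eq_1_iff [simp]: "fr x = 1 \<longleftrightarrow> x = 1"
  by (cases x rule: gf8_cases) (simp_all add: fr_def one_gf8_def)

text \<open>The product is the norm to the field with two elements, whose only unit is 1.\<close>

lemma norm_gf8: "x \<noteq> 0 \<Longrightarrow> x * fr x * fr (fr x) = 1"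
  by (cases x rule: gf8_cases) (simp_all add: zero_gf8_def one_gf8_def fr_def)

definition tr :: "gf8 \<Rightarrow> gf8" where "tr x = x + fr x + fr (fr x)"

section \<open>The group\<close>

type_synonym skew = "gf8 \<times> gf8 \<times> gf8 \<times> gf8 \<times> gf8"

text \<open>A tuple lists the coefficients of 1, X, ..., X^4 of an element of the truncated skew
  polynomial ring. As \<theta> has order 3, X^3 passes scalars unchanged and X^4 twists them like
  X.\<close>

fun skmult :: "skew \<Rightarrow> skew \<Rightarrow> skew" where
  "skmult (u, a, b, c, d) (u', a', b', c', d') =
     (u * u',
      u * a' + a * fr u',
      u * b' + a * fr a' + b * fr (fr u'),
      u * c' + a * fr b' + b * fr (fr a') + c * u',
      u * d' + a * fr c' + b * fr (fr b') + c * a' + d * fr u')"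

fun sfr :: "skew \<Rightarrow> skew" where
  "sfr (u, a, b, c, d) = (fr u, fr a, fr b, fr c, fr d)"

text \<open>Over the polynomials in X^3 the reduced norm is a 3 by 3 determinant with first row u +
  c X^3, a + d X^3, b; these are its terms linear in X^3. The coefficient \<open>d\<close> enters
  only from X^6 on.\<close>

fun nu :: "skew \<Rightarrow> gf8" where
  "nu (u, a, b, c, d) = tr (c * fr u * fr (fr u)) + tr (a * fr b * fr (fr u)) + a * fr a * fr (fr a)"

fun unit_coeff :: "skew \<Rightarrow> gf8" where
  "unit_coeff (u, a, b, c, d) = u"

definition sone :: skew where "sone = (1, 0, 0, 0, 0)"

lemma skmult_assoc: "skmult (skmult x y) z = skmult x (skmult y z)"
  by (cases x; cases y; cases z) (simp add: algebra_simps)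

lemma skmult_one [simp]: "skmult sone x = x" "skmult x sone = x"
  by (cases x; simp add: sone_def)+

lemma sfr_skmult: "sfr (skmult x y) = skmult (sfr x) (sfr y)"
  by (cases x; cases y) simp

lemma sfr_sone [simp]: "sfr sone = sone"
  by (simp add: sone_def)

lemma sfr_sfr_sfr: "sfr (sfr (sfr x)) = x"
  by (cases x) simp

lemma unit_coeff_skmult [simp]: "unit_coeff (skmult x y) = unit_coeff x * unit_coeff y"
  by (cases x; cases y) simp

lemma unit_coeff_sfr [simp]: "unit_coeff (sfr x) = fr (unit_coeff x)"
  by (cases x) simp

text \<open>Multiplicativity of the reduced norm, read off at X^3, gives additivity up to factors
  that are norms of the constant coefficients, hence 1. So the condition \<open>nu = 0\<close>
  defines a subgroup of the units.\<close>

lemma nu_skmult: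
  assumes "unit_coeff x \<noteq> 0" "unit_coeff y \<noteq> 0"
  shows "nu (skmult x y) = nu x + nu y"
proof -
  obtain u a b c d u' a' b' c' d' where x: "x = (u, a, b, c, d)" "y = (u', a', b', c', d')"
    by (metis prod.exhaust)
  have "nu (skmult x y) = u' * fr u' * fr (fr u') * nu x + u * fr u * fr (fr u) * nu y"
    unfolding x by (simp add: tr_def algebra_simps)
  then show ?thesis using norm_gf8[of u] norm_gf8[of u'] assms by (simp add: x)
qed

lemma nu_sfr: "nu (sfr x) = fr (nu x)"
  by (cases x) (simp add: tr_def algebra_simps)

declare nu.simps [simp del]

section \<open>The semidirect product with the Galois group\<close>

type_synonym elt = "nat \<times> skew"

text \<open>The pair \<open>(j, x)\<close> stands for \<sigma>^j x, where \<sigma> is a generator of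
  the Galois group that is moved to the left by the rule x \<sigma> = \<sigma>
  \<open>sfr x\<close>.\<close>

fun gmult :: "elt \<Rightarrow> elt \<Rightarrow> elt" where
  "gmult (j, x) (k, y) = ((j + k) mod 3, skmult ((sfr ^^ k) x) y)"

definition grp :: "elt monoid" where
  "grp = \<lparr>carrier = {(j, x). j < 3 \<and> unit_coeff x \<noteq> 0 \<and> nu x = 0}, monoid.mult = gmult, one = (0, sone)\<rparr>"

lemma funpow_sfr_skmult: "(sfr ^^ k) (skmult x y) = skmult ((sfr ^^ k) x) ((sfr ^^ k) y)"
  by (induction k) (simp_all add: sfr_skmult)

lemma funpow_sfr_mod: "(sfr ^^ (k mod 3)) x = (sfr ^^ k) x"
  by (rule funpow_mod_eq) (simp add: eval_nat_numeral sfr_sfr_sfr)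

lemma funpow_sfr_sone [simp]: "(sfr ^^ k) sone = sone"
  by (induction k) simp_all

lemma unit_coeff_funpow_sfr [simp]: "unit_coeff ((sfr ^^ k) x) = (fr ^^ k) (unit_coeff x)"
  by (induction k) simp_all

lemma funpow_fr_eq_0_iff [simp]: "(fr ^^ k) x = 0 \<longleftrightarrow> x = 0"
  by (induction k) simp_all

lemma funpow_fr_eq_1_iff [simp]: "(fr ^^ k) x = 1 \<longleftrightarrow> x = 1"
  by (induction k) simp_all

lemma funpow_fr_0_1 [simp]: "(fr ^^ k) 0 = 0" "(fr ^^ k) 1 = 1"
  by (induction k) simp_all

lemma funpow_sfr: "(sfr ^^ k) (u, a, b, c, d) = ((fr ^^ k) u, (fr ^^ k) a, (fr ^^ k) b, (fr ^^ k) c, (fr ^^ k) d)"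
  by (induction k) simp_all

lemma nu_funpow_sfr_eq_0_iff [simp]: "nu ((sfr ^^ k) x) = 0 \<longleftrightarrow> nu x = 0"
  by (induction k) (simp_all add: nu_sfr)

lemma gmult_assoc: "gmult (gmult x y) z = gmult x (gmult y z)"
proof -
  obtain j x' k y' l z' where x: "x = (j, x')" "y = (k, y')" "z = (l, z')" by (metis prod.exhaust)
  show ?thesis unfolding x
    by (simp add: funpow_sfr_skmult funpow_sfr_mod skmult_assoc mod_simps add.assoc)
       (simp add: funpow_add[unfolded comp_def, THEN fun_cong, symmetric] add.commute)
qed

text \<open>The system is triangular: in degree order, each unknown coefficient is multiplied by a
  nonzero Frobenius image of \<open>u\<close> and otherwise depends only on earlier ones.\<close>

lemma skmult_left_inverse:
  assumes "unit_coeff y \<noteq> 0"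
  obtains x where "skmult x y = sone"
proof -
  obtain u a b c d where y: "y = (u, a, b, c, d)" by (metis prod.exhaust)
  then have u: "u \<noteq> 0" using assms by simp
  define u1 where "u1 = 1 / u"
  define a1 where "a1 = u1 * a / fr u"
  define b1 where "b1 = (u1 * b + a1 * fr a) / fr (fr u)"
  define c1 where "c1 = (u1 * c + a1 * fr b + b1 * fr (fr a)) / u"
  define d1 where "d1 = (u1 * d + a1 * fr c + b1 * fr (fr b) + c1 * a) / fr u"
  have "skmult (u1, a1, b1, c1, d1) y = sone"
  proof -
    have "u1 * u = 1" "a1 * fr u = u1 * a" "b1 * fr (fr u) = u1 * b + a1 * fr a"
      "c1 * u = u1 * c + a1 * fr b + b1 * fr (fr a)"
      "d1 * fr u = u1 * d + a1 * fr c + b1 * fr (fr b) + c1 * a"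
      using u by (simp_all add: u1_def a1_def b1_def c1_def d1_def)
    then show ?thesis by (simp add: y sone_def)
  qed
  then show thesis by (rule that)
qed

lemma group_grp: "group grp"
proof (rule groupI)
  fix x y assume "x \<in> carrier grp" "y \<in> carrier grp"
  then show "x \<otimes>\<^bsub>grp\<^esub> y \<in> carrier grp"
    by (cases x; cases y) (auto simp: grp_def nu_skmult)
next
  show "\<one>\<^bsub>grp\<^esub> \<in> carrier grp" by (simp add: grp_def sone_def tr_def nu.simps)
next
  fix x y z assume "x \<in> carrier grp" "y \<in> carrier grp" "z \<in> carrier grp"
  then show "x \<otimes>\<^bsub>grp\<^esub> y \<otimes>\<^bsub>grp\<^esub> z = x \<otimes>\<^bsub>grp\<^esub> (y \<otimes>\<^bsub>grp\<^esub> z)"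
    by (simp add: grp_def gmult_assoc)
next
  fix x assume "x \<in> carrier grp"
  then show "\<one>\<^bsub>grp\<^esub> \<otimes>\<^bsub>grp\<^esub> x = x" by (auto simp: grp_def)
next
  fix y assume "y \<in> carrier grp"
  then obtain k y' where y: "y = (k, y')" "k < 3" "unit_coeff y' \<noteq> 0" "nu y' = 0"
    by (auto simp: grp_def)
  obtain x' where x': "skmult x' y' = sone" using skmult_left_inverse[OF y(3)] .
  have ux: "unit_coeff x' \<noteq> 0"
  proof
    assume "unit_coeff x' = 0"
    then have "unit_coeff (skmult x' y') = 0" by simp
    then show False by (simp add: x' sone_def)
  qed
  have "nu (skmult x' y') = nu x'" using nu_skmult[OF ux y(3)] y(4) by simp
  then have nx: "nu x' = 0" by (simp add: x' sone_def tr_def nu.simps)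
  \<comment> \<open>For \<open>k = 0\<close> the exponent \<open>3 - k\<close> is 3, harmless
    because the third iterate of \<open>sfr\<close> is the identity; the first component of the
    inverse is reduced modulo 3.\<close>
  have "(sfr ^^ k) ((sfr ^^ (3 - k)) x') = (sfr ^^ (3 mod 3)) x'"
    unfolding funpow_sfr_mod using y(2) by (simp add: funpow_add[symmetric, unfolded comp_def, THEN fun_cong])
  then have "gmult ((3 - k) mod 3, (sfr ^^ (3 - k)) x') y = (0, sone)"
    using y(2) x' by (simp add: y(1) mod_simps)
  moreover have "((3 - k) mod 3, (sfr ^^ (3 - k)) x') \<in> carrier grp"
    using ux nx by (simp add: grp_def)
  ultimately show "\<exists>x\<in>carrier grp. x \<otimes>\<^bsub>grp\<^esub> y = \<one>\<^bsub>grp\<^esub>"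
    by (intro bexI) (auto simp: grp_def)
qed

lemma mem_grp: "x \<in> carrier grp \<longleftrightarrow> fst x < 3 \<and> unit_coeff (snd x) \<noteq> 0 \<and> nu (snd x) = 0"
  by (cases x) (simp add: grp_def)

lemma mult_grp [simp]: "x \<otimes>\<^bsub>grp\<^esub> y = gmult x y"
  by (simp add: grp_def)

lemma one_grp [simp]: "\<one>\<^bsub>grp\<^esub> = (0, sone)"
  by (simp add: grp_def)

lemma finite_grp: "finite (carrier grp)"
proof (rule finite_subset)
  show "carrier grp \<subseteq> {..<3} \<times> UNIV" by (auto simp: grp_def)
qed simp

section \<open>Orders of the group and of its normal 2-subgroup\<close>

definition syl :: "elt set" where
  "syl = {(j, x). j = 0 \<and> unit_coeff x = 1 \<and> nu x = 0}"

lemma mem_syl: "x \<in> syl \<longleftrightarrow> fst x = 0 \<and> unit_coeff (snd x) = 1 \<and> nu (snd x) = 0"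
  by (cases x) (simp add: syl_def)

lemma syl_subset: "syl \<subseteq> carrier grp"
  by (auto simp: syl_def grp_def)

lemma tr_0_or_1: "tr x = 0 \<or> tr x = 1"
  by (cases x rule: gf8_cases) (simp_all add: tr_def fr_def zero_gf8_def one_gf8_def)

lemma tr_add [simp]: "tr (x + y) = tr x + tr y"
  by (simp add: tr_def algebra_simps)

lemma card_ker_tr: "card {c. tr c = 0} = 4"
proof -
  have "{c. tr c = 0} = {GF8 False False False, GF8 False True False, GF8 False False True, GF8 False True True}"
    (is "_ = ?S")
  proof -
    have "tr c = 0 \<longleftrightarrow> c \<in> ?S" for c
      by (cases c rule: gf8_cases) (simp_all add: tr_def fr_def zero_gf8_def)
    then show ?thesis by blast
  qed
  then show ?thesis by simp
qed

text \<open>The remaining summands of \<open>nu\<close> lie in the prime field, where the trace is the identity; adding them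
  to \<open>c / u\<close> turns the condition \<open>nu = 0\<close> into \<open>tr c = 0\<close>.\<close>

definition nu_tail :: "gf8 \<Rightarrow> gf8 \<Rightarrow> gf8 \<Rightarrow> gf8" where
  "nu_tail u a b = tr (a * fr b * fr (fr u)) + a * fr a * fr (fr a)"

lemma norm_0_or_1: "a * fr a * fr (fr a) = 0 \<or> a * fr a * fr (fr a) = 1"
  using norm_gf8[of a] by (cases "a = 0") auto

lemma tr_nu_tail [simp]: "tr (nu_tail u a b) = nu_tail u a b"
proof -
  have "nu_tail u a b = 0 \<or> nu_tail u a b = 1"
    using tr_0_or_1[of "a * fr b * fr (fr u)"] norm_0_or_1[of a] by (auto simp: nu_tail_def)
  then show ?thesis by (auto simp: tr_def)
qed

lemma nu_tail_eq: "u \<noteq> 0 \<Longrightarrow> nu (u, a, b, u * c, d) = tr c + nu_tail u a b"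
  using norm_gf8[of u] by (simp add: nu_tail_def nu.simps algebra_simps)

definition nu_param :: "nat \<times> gf8 \<times> gf8 \<times> gf8 \<times> gf8 \<times> gf8 \<Rightarrow> elt" where
  "nu_param = (\<lambda>(j, u, a, b, c, d). (j, (u, a, b, u * (c + nu_tail u a b), d)))"

lemma inj_param: "inj_on nu_param {(j, u, a, b, c, d). u \<noteq> 0}"
  by (auto simp: inj_on_def nu_param_def)

lemma param_image:
  assumes "0 \<notin> U"
  shows "nu_param ` (J \<times> U \<times> UNIV \<times> UNIV \<times> {c. tr c = 0} \<times> UNIV)
    = J \<times> {x. unit_coeff x \<in> U \<and> nu x = 0}"
proof (intro equalityI subsetI)
  fix y assume "y \<in> nu_param ` (J \<times> U \<times> UNIV \<times> UNIV \<times> {c. tr c = 0} \<times> UNIV)"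
  then obtain j u a b c d where y: "y = nu_param (j, u, a, b, c, d)" "j \<in> J" "u \<in> U" "tr c = 0" by auto
  then have "u \<noteq> 0" using assms by auto
  then have "nu (u, a, b, u * (c + nu_tail u a b), d) = 0"
    using y(4) nu_tail_eq[of u a b "c + nu_tail u a b" d] by simp
  then show "y \<in> J \<times> {x. unit_coeff x \<in> U \<and> nu x = 0}"
    using y \<open>u \<in> U\<close> by (simp add: nu_param_def)
next
  fix y assume "y \<in> J \<times> {x. unit_coeff x \<in> U \<and> nu x = 0}"
  then obtain j u a b c d where y: "y = (j, (u, a, b, c, d))" "j \<in> J" "u \<in> U" "nu (u, a, b, c, d) = 0"
    by auto
  have u: "u \<noteq> 0" using y(3) assms by auto
  define e where "e = c / u + nu_tail u a b"
  have c: "c = u * (e + nu_tail u a b)" using u by (simp add: e_def add.assoc)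
  have "tr e = 0" using y(4) nu_tail_eq[OF u, of a b "e + nu_tail u a b" d] by (simp add: c add.assoc)
  then show "y \<in> nu_param ` (J \<times> U \<times> UNIV \<times> UNIV \<times> {c. tr c = 0} \<times> UNIV)"
    using y c by (intro image_eqI[of _ _ "(j, u, a, b, e, d)"]) (auto simp: nu_param_def)
qed

text \<open>The factor is 2048 = 8 * 8 * 4 * 8, for \<open>a\<close>, \<open>b\<close>, the
  parameter of trace 0 and \<open>d\<close>.\<close>

lemma card_param_image:
  fixes J :: "nat set"
  assumes "0 \<notin> U"
  shows "card (J \<times> {x. unit_coeff x \<in> U \<and> nu x = 0}) = card J * card U * 2048"
proof -
  have "inj_on nu_param (J \<times> U \<times> UNIV \<times> UNIV \<times> {c. tr c = 0} \<times> UNIV)"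
    using assms by (intro inj_on_subset[OF inj_param]) auto
  then show ?thesis
    unfolding param_image[OF assms, symmetric]
    by (simp add: card_image card_cartesian_product card_gf8 card_ker_tr)
qed

lemma card_syl: "card syl = 2 ^ 11"
proof -
  have "syl = {0} \<times> {x. unit_coeff x \<in> {1} \<and> nu x = 0}" by (auto simp: syl_def)
  then have "card syl = card ({0::nat} \<times> {x. unit_coeff x \<in> {1} \<and> nu x = 0})" by (rule arg_cong)
  also have "\<dots> = 2 ^ 11" by (subst card_param_image) auto
  finally show ?thesis .
qed

lemma card_grp: "card (carrier grp) = 21 * 2 ^ 11"
proof -
  have "carrier grp = {..<3} \<times> {x. unit_coeff x \<in> UNIV - {0} \<and> nu x = 0}"
    by (auto simp: grp_def)
  then have "card (carrier grp) = card ({..<3::nat} \<times> {x. unit_coeff x \<in> UNIV - {0} \<and> nu x = 0})"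
    by (rule arg_cong)
  also have "\<dots> = 21 * 2 ^ 11"
    by (subst card_param_image) (auto simp: card_Diff_singleton card_gf8)
  finally show ?thesis .
qed

lemma multiplicity_card_grp: "multiplicity 2 (card (carrier grp)) = 11"
proof -
  have "multiplicity 2 (21 * 2 ^ 11 :: nat) = 11"
    by (rule multiplicity_eqI) auto
  then show ?thesis by (simp add: card_grp)
qed

interpretation grp: finite_group grp
  using group_grp finite_grp by (simp add: finite_group_def finite_group_axioms_def)

section \<open>Real elements and their conjugacy classes\<close>

lemma tr_fr [simp]: "tr (fr x) = tr x"
  by (simp add: tr_def add.commute add.left_commute)

lemma tr_0 [simp]: "tr 0 = 0"
  by (simp add: tr_def)

lemma tr_1 [simp]: "tr 1 = 1"
  by (simp add: tr_def gf8_two)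

lemma mem_sylE:
  assumes "x \<in> syl"
  obtains a b c d where "x = (0, (1, a, b, c, d))" "nu (1, a, b, c, d) = 0"
  using assms by (auto simp: syl_def)

text \<open>The hypothesis says that conjugation by \<open>h\<close> inverts \<open>g\<close>. Then
  the square of \<open>h\<close> commutes with \<open>g\<close>, so every odd power of
  \<open>h\<close> inverts \<open>g\<close> as well.\<close>

lemma inverted_odd_power:
  fixes G (structure)
  assumes "group G" and gh: "g \<in> carrier G" "h \<in> carrier G" and inv: "g \<otimes> h \<otimes> g = h"
  shows "g \<otimes> h [^] (2 * n + 1 :: nat) \<otimes> g = h [^] (2 * n + 1 :: nat)"
proof -
  interpret group G by fact
  have comm: "g \<otimes> (h \<otimes> h) = (h \<otimes> h) \<otimes> g"
  proof -
    have "g \<otimes> (h \<otimes> h) = (g \<otimes> h) \<otimes> (g \<otimes> h \<otimes> g)" using inv gh by (simp add: m_assoc)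
    also have "\<dots> = (g \<otimes> h \<otimes> g) \<otimes> (h \<otimes> g)" using gh by (simp add: m_assoc)
    also have "\<dots> = (h \<otimes> h) \<otimes> g" using inv gh by (simp add: m_assoc)
    finally show ?thesis .
  qed
  show ?thesis
  proof (induction n)
    case 0
    show ?case using inv gh by simp
  next
    case (Suc n)
    let ?k = "h [^] (2 * n + 1 :: nat)"
    have k: "?k \<in> carrier G" using gh by simp
    have "h [^] (2 * Suc n + 1 :: nat) = ?k \<otimes> (h \<otimes> h)"
      using gh by (simp add: nat_pow_Suc m_assoc)
    moreover have "g \<otimes> (?k \<otimes> (h \<otimes> h)) \<otimes> g = ?k \<otimes> (h \<otimes> h)"
    proof -
      have "g \<otimes> (?k \<otimes> (h \<otimes> h)) \<otimes> g = g \<otimes> ?k \<otimes> ((h \<otimes> h) \<otimes> g)" using gh k by (simp add: m_assoc)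
      also have "\<dots> = (g \<otimes> ?k \<otimes> g) \<otimes> (h \<otimes> h)" unfolding comm[symmetric] using gh k by (simp add: m_assoc)
      finally show ?thesis using Suc by simp
    qed
    ultimately show ?case by simp
  qed
qed

lemma fst_gmult: "fst (gmult x y) = (fst x + fst y) mod 3"
  by (cases x; cases y) simp

lemma fst_grp_pow: "fst (x [^]\<^bsub>grp\<^esub> n) = (n * fst x) mod 3" for n :: nat
  by (induction n) (simp_all add: fst_gmult mod_simps add.commute)

lemma unit_coeff_gmult:
  "fst y = 0 \<Longrightarrow> unit_coeff (snd (gmult x y)) = unit_coeff (snd x) * unit_coeff (snd y)"
  by (cases x; cases y) simp

lemma unit_coeff_grp_pow:
  "fst x = 0 \<Longrightarrow> unit_coeff (snd (x [^]\<^bsub>grp\<^esub> n)) = unit_coeff (snd x) ^ n" for n :: nat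
  by (induction n) (simp_all add: sone_def unit_coeff_gmult mult.commute)

text \<open>Here 21 = 3 * 7: the third power has trivial Galois component, where the constant
  coefficient is multiplicative with values in a group of order 7.\<close>

lemma grp_pow_21_mem_syl:
  assumes "x \<in> carrier grp"
  shows "x [^]\<^bsub>grp\<^esub> (21 :: nat) \<in> syl"
proof -
  let ?y = "x [^]\<^bsub>grp\<^esub> (3 :: nat)" and ?z = "x [^]\<^bsub>grp\<^esub> (21 :: nat)"
  have z: "?z = ?y [^]\<^bsub>grp\<^esub> (7 :: nat)" using grp.nat_pow_pow[OF assms, of 3 7] by simp
  have y: "?y \<in> carrier grp" "fst ?y = 0" using assms fst_grp_pow[of x 3] by auto
  then have "unit_coeff (snd ?y) \<noteq> 0" by (simp add: mem_grp)
  then have "unit_coeff (snd ?z) = 1" using unit_coeff_grp_pow[OF y(2), of 7] gf8_pow7 by (simp add: z)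
  moreover have "fst ?z = 0" using fst_grp_pow[of x 21] by simp
  moreover have "?z \<in> carrier grp" using assms by simp
  ultimately show ?thesis by (simp add: mem_syl mem_grp)
qed

text \<open>Dividing by x^3 leaves s + s^2 = 1 for s = y / x, but the left side has trace 0 and the
  right side trace 1. This will force the coefficient of X to vanish.\<close>

lemma quadratic_no_root:
  assumes "x * fr y + y * fr x = x * fr x"
  shows "x = 0"
proof (rule ccontr)
  assume "x \<noteq> 0"
  define s where "s = y / x"
  have y: "y = s * x" using \<open>x \<noteq> 0\<close> by (simp add: s_def)
  have "(s + fr s + 1) * (x * fr x) = 0" using assms by (simp add: y algebra_simps)
  then have "s + fr s + 1 = 0" using \<open>x \<noteq> 0\<close> by simp
  then show False
    by (cases s rule: gf8_cases) (simp_all add: fr_def zero_gf8_def one_gf8_def)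
qed

text \<open>The equations say that \<open>1 + b X\<^sup>2 + c X\<^sup>3 + \<dots>\<close> is inverted by \<open>1 + a X + e X\<^sup>2 + \<dots>\<close>. Dividing the
  second one by \<open>b\<^sup>5\<close> and taking traces yields \<open>tr 1 = 0\<close>.\<close>

lemma square_coeff_zero:
  assumes 1: "b * fr (fr a) = a * fr b"
    and 2: "b * fr (fr e) + e * fr (fr b) + b * fr (fr b) + c * a + a * fr c = 0"
  shows "b = 0"
proof (rule ccontr)
  assume b: "b \<noteq> 0"
  define s where "s = e / b"
  have e: "e = s * b" using b by (simp add: s_def)
  define q where "q = b * fr (fr b)"
  have q: "q \<noteq> 0" using b by (simp add: q_def)
  have "tr (a * (c + fr c) / q) = 0"
  proof (cases "a = 0")
    case True
    then show ?thesis by (simp add: tr_def)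
  next
    case False
    \<comment> \<open>Hypothesis \<open>1\<close> says a^4 b = a b^2, so b = a^3. Then q = b^5 =
      a^15 = a, and the quotient becomes c + \<open>fr c\<close>, of trace 0.\<close>
    have "(a * b) * (a * a * a) = (a * b) * b" using 1 by (simp add: fr_def ac_simps)
    then have "b = a * a * a" using False b by simp
    moreover have "x * x * x * fr (fr (x * x * x)) = x" for x
      by (cases x rule: gf8_cases) (simp_all add: fr_def)
    ultimately have "q = a" by (simp add: q_def)
    then show ?thesis using False by simp
  qed
  moreover have "a * (c + fr c) / q = fr (fr s) + s + 1"
  proof -
    have "a * (c + fr c) = (fr (fr s) + s + 1) * q"
      using 2 by (simp add: e q_def gf8_add_eq_0_iff algebra_simps)
    then show ?thesis using q by simp
  qed
  moreover have "tr (fr (fr s) + s + 1) = 1" by simp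
  ultimately show False by simp
qed

definition layer :: "gf8 \<Rightarrow> gf8 \<Rightarrow> elt" where
  "layer c d = (0, (1, 0, 0, c, d))"

lemma layer_mem_syl: "layer c d \<in> syl \<longleftrightarrow> tr c = 0"
  by (simp add: layer_def mem_syl nu.simps)

lemma inverted_by_syl:
  assumes g: "g \<in> syl" and h: "h \<in> syl" and inv: "gmult (gmult g h) g = h"
  obtains c d where "g = layer c d" "tr c = 0"
proof -
  obtain a b c d where g': "g = (0, (1, a, b, c, d))" using mem_sylE[OF g] .
  obtain a' b' c' d' where h': "h = (0, (1, a', b', c', d'))" using mem_sylE[OF h] .
  \<comment> \<open>In degree 1 the equation \<open>inv\<close> holds automatically, so the first
    condition comes from X^2. Once \<open>a = 0\<close>, the degrees 3 and 4 supply the two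
    hypotheses of \<open>square_coeff_zero\<close>.\<close>
  have "a * fr a' + a' * fr a = a * fr a"
    using inv by (simp add: g' h' gf8_add_eq_0_iff algebra_simps)
  then have a: "a = 0" by (rule quadratic_no_root)
  have 1: "b * fr (fr a') = a' * fr b"
    using inv by (simp add: g' h' a gf8_add_eq_0_iff algebra_simps)
  have "b * fr (fr b') + b' * fr (fr b) + b * fr (fr b) + c * a' + a' * fr c = 0"
    using inv by (simp add: g' h' a gf8_add_eq_0_iff algebra_simps)
  from square_coeff_zero[OF 1 this] have b: "b = 0" .
  have "g = layer c d" by (simp add: g' a b layer_def)
  moreover have "tr c = 0" using g calculation by (simp add: layer_mem_syl)
  ultimately show thesis by (rule that)
qed

lemma real_imp_layer:
  assumes g: "g \<in> carrier grp" and real: "inv\<^bsub>grp\<^esub> g \<in> grp.conj_class g"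
  obtains c d where "g = layer c d" "tr c = 0"
proof -
  obtain h where h: "h \<in> carrier grp" and "inv\<^bsub>grp\<^esub> g = h \<otimes>\<^bsub>grp\<^esub> g \<otimes>\<^bsub>grp\<^esub> inv\<^bsub>grp\<^esub> h"
    using real by (auto simp: grp.conj_class_def)
  then have "inv\<^bsub>grp\<^esub> g \<otimes>\<^bsub>grp\<^esub> h = h \<otimes>\<^bsub>grp\<^esub> g"
    using g grp.inv_solve_right by (metis grp.inv_closed grp.m_closed)
  then have "g \<otimes>\<^bsub>grp\<^esub> h \<otimes>\<^bsub>grp\<^esub> g = h"
    using g h by (metis grp.inv_solve_left grp.m_assoc grp.m_closed)
  then have pow: "g \<otimes>\<^bsub>grp\<^esub> h [^]\<^bsub>grp\<^esub> (2 * 10 + 1 :: nat) \<otimes>\<^bsub>grp\<^esub> g = h [^]\<^bsub>grp\<^esub> (2 * 10 + 1 :: nat)"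
    by (intro inverted_odd_power[OF group_grp g h])
  let ?h = "h [^]\<^bsub>grp\<^esub> (21 :: nat)"
  have h21: "?h \<in> syl" by (rule grp_pow_21_mem_syl[OF h])
  have eq: "gmult (gmult g ?h) g = ?h" using pow by simp
  have "g \<in> syl"
  proof -
    obtain j u a b c d where g': "g = (j, (u, a, b, c, d))" by (metis prod.exhaust)
    obtain a' b' c' d' where h': "?h = (0, (1, a', b', c', d'))" using mem_sylE[OF h21] .
    have "j < 3" using g by (simp add: g' mem_grp)
    \<comment> \<open>As \<open>?h\<close> lies in \<open>syl\<close>, the equation
      \<open>eq\<close> says 2 j = 0 modulo 3 for the Galois component and then u^2 = 1 for the
      constant coefficient.\<close>
    moreover have "(j + j) mod 3 = 0" using eq unfolding h' by (simp add: g' mod_simps)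
    ultimately have j: "j = 0" by presburger
    have "u * u = 1" using eq unfolding h' by (simp add: g' j)
    then have "u = 1" using fr_eq_1_iff[of u] by (simp add: fr_def)
    then show ?thesis using g by (simp add: g' j mem_syl mem_grp)
  qed
  from inverted_by_syl[OF this h21 eq] that show thesis by blast
qed

lemma mem_conj_classI:
  assumes "g \<in> carrier grp" "g' \<in> carrier grp" "h \<in> carrier grp" "gmult h g = gmult g' h"
  shows "g' \<in> grp.conj_class g"
proof -
  have "h \<otimes>\<^bsub>grp\<^esub> g \<in> carrier grp" using assms by (intro grp.m_closed)
  then have "g' = h \<otimes>\<^bsub>grp\<^esub> g \<otimes>\<^bsub>grp\<^esub> inv\<^bsub>grp\<^esub> h"
    using grp.inv_solve_right[OF assms(2) _ assms(3), of "h \<otimes>\<^bsub>grp\<^esub> g"] assms(4) by simp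
  then show ?thesis unfolding grp.conj_class_def using assms(3) by blast
qed

lemma layer_mem_grp: "tr c = 0 \<Longrightarrow> layer c d \<in> carrier grp"
  using layer_mem_syl syl_subset by blast

lemma inv_layer: "tr c = 0 \<Longrightarrow> inv\<^bsub>grp\<^esub> (layer c d) = layer c d"
  by (rule grp.inv_equality) (auto simp: layer_mem_grp, simp add: layer_def sone_def)

lemma conj_layer_0:
  assumes "d \<noteq> 0"
  shows "layer 0 d \<in> grp.conj_class (layer 0 1)"
proof (rule mem_conj_classI)
  show "layer 0 1 \<in> carrier grp" "layer 0 d \<in> carrier grp"
    by (auto intro!: layer_mem_grp simp: tr_def)
  \<comment> \<open>Conjugation by a scalar u multiplies the coefficient of X^4 by u /
    \<open>fr u\<close> = 1 / u, so u = 1 / d carries 1 to d.\<close>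
  show "(0, (1 / d, 0, 0, 0, 0)) \<in> carrier grp" using assms by (simp add: mem_grp nu.simps tr_def)
  have "1 / d = d * fr (1 / d)" using assms by (simp add: fr_def)
  then show "gmult (0, (1 / d, 0, 0, 0, 0)) (layer 0 1) = gmult (layer 0 d) (0, (1 / d, 0, 0, 0, 0))"
    by (simp add: layer_def)
qed

lemma conj_layer_d:
  assumes "tr c = 0" "c \<noteq> 0"
  shows "layer c d \<in> grp.conj_class (layer c 0)"
proof (rule mem_conj_classI)
  show "layer c 0 \<in> carrier grp" "layer c d \<in> carrier grp" by (auto intro!: layer_mem_grp assms)
  \<comment> \<open>A fixed point of \<open>fr\<close> equals its own trace, since the three
    summands of the trace coincide in characteristic 2.\<close>
  have nz: "c + fr c \<noteq> 0"
  proof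
    assume "c + fr c = 0"
    then have "fr c = c" by (simp add: gf8_add_eq_0_iff)
    then have "c + (c + c) = 0" using assms(1) by (simp add: tr_def)
    then show False using assms(2) by (simp del: one_add_one)
  qed
  \<comment> \<open>Conjugation by an element with X-coefficient \<open>a\<close> adds a (c +
    \<open>fr c\<close>) to the coefficient of X^4. The X^3-coefficient of \<open>?h\<close>, the
    norm of \<open>a\<close>, is there to cancel the norm term of \<open>nu\<close>.\<close>
  define a where "a = d / (c + fr c)"
  let ?h = "(0, (1, a, 0, a * fr a * fr (fr a), 0))"
  have "tr (a * fr a * fr (fr a)) = a * fr a * fr (fr a)"
    using norm_0_or_1[of a] by (metis tr_0 tr_1)
  then show "?h \<in> carrier grp" by (simp add: mem_grp nu.simps)
  have "d = a * (c + fr c)" using nz by (simp add: a_def)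
  then show "gmult ?h (layer c 0) = gmult (layer c d) ?h"
    by (simp add: layer_def algebra_simps gf8_two)
qed

lemma conj_layer_fr:
  assumes "tr c = 0"
  shows "layer c d \<in> grp.conj_class (layer (fr c) (fr d))"
proof (rule mem_conj_classI)
  show "layer c d \<in> carrier grp" "layer (fr c) (fr d) \<in> carrier grp"
    by (auto intro!: layer_mem_grp simp: assms)
  show "(1, sone) \<in> carrier grp" by (simp add: mem_grp sone_def nu.simps tr_def)
  show "gmult (1, sone) (layer (fr c) (fr d)) = gmult (layer c d) (1, sone)"
    by (simp add: layer_def)
qed

lemma conj_class_layer_c:
  assumes "tr c = 0" "c \<noteq> 0"
  shows "grp.conj_class (layer c d) = grp.conj_class (layer (GF8 False True False) 0)"
proof -
  let ?t = "GF8 False True False"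
  have tr_t: "tr ?t = 0" by (simp add: tr_def fr_def zero_gf8_def)
  have 1: "grp.conj_class (layer c d) = grp.conj_class (layer c 0)"
    if "tr c = 0" "c \<noteq> 0" for c d
    by (rule grp.conj_class_eq[OF layer_mem_grp conj_layer_d]) (use that in auto)
  have 2: "grp.conj_class (layer c 0) = grp.conj_class (layer (fr c) 0)" if "tr c = 0" for c
    using grp.conj_class_eq[OF layer_mem_grp conj_layer_fr, of c 0] that by simp
  \<comment> \<open>The minimal polynomial of \<open>?t\<close>, t^3 + t + 1, has no quadratic term,
    so \<open>?t\<close> has trace 0, and its three conjugates exhaust the nonzero elements of trace
    0.\<close>
  have "c = ?t \<or> fr c = ?t \<or> fr (fr c) = ?t"
    using assms by (cases c rule: gf8_cases) (simp_all add: tr_def fr_def zero_gf8_def)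
  then show ?thesis using 1[OF assms] 2[of c] 2[of "fr c"] assms by auto
qed

text \<open>The elements 1 + d X^4 are closed under conjugation, which separates the class with
  nonzero \<open>c\<close> from that of the involutions with \<open>c = 0\<close>.\<close>

lemma conj_class_layer_0_subset: "grp.conj_class (layer 0 d) \<subseteq> range (layer 0)"
proof
  fix g assume "g \<in> grp.conj_class (layer 0 d)"
  then obtain h where h: "h \<in> carrier grp" and g: "g = h \<otimes>\<^bsub>grp\<^esub> layer 0 d \<otimes>\<^bsub>grp\<^esub> inv\<^bsub>grp\<^esub> h"
    by (auto simp: grp.conj_class_def)
  have l: "layer 0 d \<in> carrier grp" by (auto intro!: layer_mem_grp simp: tr_def)
  have hl: "h \<otimes>\<^bsub>grp\<^esub> layer 0 d \<in> carrier grp" by (rule grp.m_closed[OF h l])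
  have gc: "g \<in> carrier grp" unfolding g by (rule grp.m_closed[OF hl grp.inv_closed[OF h]])
  obtain j u a b c e where g': "g = (j, (u, a, b, c, e))" by (metis prod.exhaust)
  obtain k v x where h': "h = (k, x)" "unit_coeff x = v" "v \<noteq> 0" using h by (metis mem_grp prod.collapse)
  obtain a' b' c' d' where x: "x = (v, a', b', c', d')" using h'(2) by (cases x) auto
  have "gmult h (layer 0 d) = gmult g h"
    using grp.inv_solve_right[OF gc hl h] g by (simp del: grp.inv_closed)
  then have eq: "gmult (k, x) (layer 0 d) = gmult (j, (u, a, b, c, e)) (k, x)" by (simp add: g' h')
  have "j < 3" "k < 3" using gc h by (simp_all add: g' h' mem_grp)
  moreover have "k mod 3 = (j + k) mod 3" using eq by (cases x) (simp add: layer_def)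
  ultimately have j: "j = 0" by presburger
  \<comment> \<open>Right multiplication by \<open>layer 0 d\<close> changes only the last
    coefficient of \<open>x\<close>, so the lower coefficients of \<open>g\<close> are forced in
    turn. The powers of \<open>fr\<close> come from moving \<open>g\<close> past the Galois
    component of \<open>h\<close>.\<close>
  have eqs: "v = (fr ^^ k) u * v" "a' = (fr ^^ k) u * a' + (fr ^^ k) a * fr v"
    "b' = (fr ^^ k) u * b' + (fr ^^ k) a * fr a' + (fr ^^ k) b * fr (fr v)"
    "c' = (fr ^^ k) u * c' + (fr ^^ k) a * fr b' + (fr ^^ k) b * fr (fr a') + (fr ^^ k) c * v"
    using eq by (simp_all add: x layer_def funpow_sfr)
  have u: "u = 1" using eqs(1) h'(3) by simp
  then have a: "a = 0" using eqs(2) h'(3) by simp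
  then have b: "b = 0" using eqs(3) u h'(3) by simp
  then have "c = 0" using eqs(4) u a h'(3) by simp
  with u a b have "u = 1 \<and> a = 0 \<and> b = 0 \<and> c = 0" by blast
  then have "g = layer 0 e" by (simp add: g' j layer_def)
  then show "g \<in> range (layer 0)" by blast
qed

theorem card_real_valued_Irr_grp: "card (real_valued_Irr grp) = 3"
proof -
  let ?t = "GF8 False True False"
  have tr_t: "tr ?t = 0" and t0: "?t \<noteq> 0" by (simp_all add: tr_def fr_def zero_gf8_def)
  let ?R = "{x \<in> carrier grp. inv\<^bsub>grp\<^esub> x \<in> grp.conj_class x}"
  have R: "layer c d \<in> ?R" if "tr c = 0" for c d
    using that grp.conj_class_self by (simp add: layer_mem_grp inv_layer)
  have "grp.conj_class ` ?R = {grp.conj_class (layer 0 0), grp.conj_class (layer 0 1), grp.conj_class (layer ?t 0)}"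
  proof
    show "grp.conj_class ` ?R \<subseteq> {grp.conj_class (layer 0 0), grp.conj_class (layer 0 1), grp.conj_class (layer ?t 0)}"
    proof
      fix C assume "C \<in> grp.conj_class ` ?R"
      then obtain g where g: "g \<in> carrier grp" "inv\<^bsub>grp\<^esub> g \<in> grp.conj_class g" "C = grp.conj_class g" by auto
      obtain c d where cd: "g = layer c d" "tr c = 0" using real_imp_layer[OF g(1,2)] .
      have "grp.conj_class (layer 0 d) = grp.conj_class (layer 0 1)" if "d \<noteq> 0"
        by (rule grp.conj_class_eq[OF layer_mem_grp conj_layer_0[OF that]]) simp
      then show "C \<in> {grp.conj_class (layer 0 0), grp.conj_class (layer 0 1), grp.conj_class (layer ?t 0)}"
        using conj_class_layer_c[OF cd(2)] g(3) cd(1) by (cases "c = 0"; cases "d = 0") auto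
    qed
    show "{grp.conj_class (layer 0 0), grp.conj_class (layer 0 1), grp.conj_class (layer ?t 0)} \<subseteq> grp.conj_class ` ?R"
      using R[of 0] R[OF tr_t] by auto
  qed
  moreover have "grp.conj_class (layer 0 0) = {layer 0 0}"
  proof -
    have "layer 0 0 = \<one>\<^bsub>grp\<^esub>" by (simp add: layer_def sone_def)
    moreover have "grp.conj_class \<one>\<^bsub>grp\<^esub> = {\<one>\<^bsub>grp\<^esub>}"
      unfolding grp.conj_class_def using grp.one_closed grp.r_one grp.r_inv by (auto simp del: one_grp mult_grp)
    ultimately show ?thesis by simp
  qed
  moreover have "layer 0 1 \<in> grp.conj_class (layer 0 1)" "layer ?t 0 \<in> grp.conj_class (layer ?t 0)"
    using layer_mem_grp tr_t by (auto intro!: grp.conj_class_self)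
  moreover have "layer ?t 0 \<notin> range (layer 0)" "layer 0 1 \<noteq> layer 0 0" "layer ?t 0 \<noteq> layer 0 0"
    using t0 by (auto simp: layer_def)
  ultimately have "card (grp.conj_class ` ?R) = 3"
    using conj_class_layer_0_subset[of 1] by (auto simp: card_insert_if)
  then show ?thesis using grp.card_real_valued_Irr by simp
qed

section \<open>Transport along isomorphisms\<close>

lemma (in group) upper_central_Suc_cosets:
  "x \<in> upper_central G (Suc n) \<longleftrightarrow>
     x \<in> carrier G \<and> (\<forall>y\<in>carrier G. upper_central G n #> (x \<otimes> y) = upper_central G n #> (y \<otimes> x))"
proof -
  interpret N: normal "upper_central G n" G by (rule upper_central_normal)
  show ?thesis by (auto simp: center_def FactGroup_def RCOSETS_def N.rcos_sum)
qed

text \<open>In this commutator form membership in one term is expressed by membership of elements in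
  the previous term, which makes invariance under isomorphisms an induction.\<close>

lemma (in group) upper_central_Suc_iff:
  "x \<in> upper_central G (Suc n) \<longleftrightarrow>
     x \<in> carrier G \<and> (\<forall>y\<in>carrier G. (x \<otimes> y) \<otimes> inv (y \<otimes> x) \<in> upper_central G n)"
proof -
  interpret N: normal "upper_central G n" G by (rule upper_central_normal)
  have coset: "upper_central G n #> a = upper_central G n #> b \<longleftrightarrow> a \<otimes> inv b \<in> upper_central G n"
    if "a \<in> carrier G" "b \<in> carrier G" for a b
    using that N.rcos_module[OF is_group, of b a] rcos_self[OF _ N.subgroup_axioms, of a]
      repr_independence[OF _ _ N.subgroup_axioms, of a b] by auto
  then show ?thesis
    unfolding upper_central_Suc_cosets by (simp add: coset del: upper_central.simps cong: conj_cong)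
qed

lemma upper_central_iso:
  assumes "group G" "group H" "f \<in> iso G H"
  shows "f ` upper_central G n = upper_central H n"
proof -
  interpret G: group G by fact
  interpret H: group H by fact
  interpret f: group_hom G H f
    using assms by (simp add: group_hom_def group_hom_axioms_def iso_def)
  have bij: "bij_betw f (carrier G) (carrier H)" using assms(3) by (simp add: iso_def)
  have sub: "upper_central G n \<subseteq> carrier G" "upper_central H n \<subseteq> carrier H" for n
    by (simp_all add: normal_imp_subgroup subgroup.subset G.upper_central_normal H.upper_central_normal)
  have surj: "carrier H = f ` carrier G" using bij by (simp add: bij_betw_def)
  have mem: "x \<in> upper_central G n \<longleftrightarrow> f x \<in> upper_central H n" if "x \<in> carrier G" for x n
    using that
  proof (induction n arbitrary: x)
    case 0
    have "f x = f \<one>\<^bsub>G\<^esub> \<longleftrightarrow> x = \<one>\<^bsub>G\<^esub>"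
      using bij 0 by (intro inj_on_eq_iff) (auto simp: bij_betw_def)
    then show ?case by simp
  next
    case (Suc n)
    show ?case unfolding G.upper_central_Suc_iff H.upper_central_Suc_iff surj
      using Suc by simp
  qed
  show ?thesis
  proof (intro equalityI subsetI)
    fix y assume "y \<in> f ` upper_central G n"
    then obtain x where "x \<in> upper_central G n" "y = f x" by auto
    then show "y \<in> upper_central H n" using mem[of x n] sub(1)[of n] by auto
  next
    fix y assume y: "y \<in> upper_central H n"
    then obtain x where "x \<in> carrier G" "y = f x" using sub(2)[of n] surj by auto
    then show "y \<in> f ` upper_central G n" using mem[of x n] y by auto
  qed
qed

lemma involutions_iso:
  assumes "group S" "group T" "f \<in> iso S T"
  shows "f ` involutions S = involutions T"
proof -
  interpret f: group_hom S T f
    using assms by (simp add: group_hom_def group_hom_axioms_def iso_def)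
  have surj: "carrier T = f ` carrier S" and inj: "inj_on f (carrier S)"
    using assms(3) by (auto simp: iso_def bij_betw_def)
  have one: "f x = \<one>\<^bsub>T\<^esub> \<longleftrightarrow> x = \<one>\<^bsub>S\<^esub>" if "x \<in> carrier S" for x
    using inj_on_eq_iff[OF inj that f.G.one_closed] f.hom_one by simp
  have iff: "f x \<in> involutions T \<longleftrightarrow> x \<in> involutions S" if x: "x \<in> carrier S" for x
  proof -
    have "f x \<otimes>\<^bsub>T\<^esub> f x = \<one>\<^bsub>T\<^esub> \<longleftrightarrow> x \<otimes>\<^bsub>S\<^esub> x = \<one>\<^bsub>S\<^esub>"
      using one[of "x \<otimes>\<^bsub>S\<^esub> x"] f.hom_mult[OF x x] x by simp
    then show ?thesis using one[OF x] x by (simp add: involutions_def)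
  qed
  show ?thesis
  proof (intro equalityI subsetI)
    fix y assume "y \<in> f ` involutions S"
    then obtain x where "x \<in> involutions S" "y = f x" by auto
    then show "y \<in> involutions T" using iff[of x] by (simp add: involutions_def)
  next
    fix y assume y: "y \<in> involutions T"
    then have "y \<in> f ` carrier S" using surj by (simp add: involutions_def)
    then obtain x where "x \<in> carrier S" "y = f x" by auto
    then show "y \<in> f ` involutions S" using iff[of x] y by auto
  qed
qed

text \<open>Conjugation of an automorphism by \<open>f\<close>. Elements of \<open>AutoGroup\<close>
  are extensional functions, hence the restriction to the carrier.\<close>

definition transport_auto ::
    "('a, 'c) monoid_scheme \<Rightarrow> ('b, 'd) monoid_scheme \<Rightarrow> ('a \<Rightarrow> 'b) \<Rightarrow> ('a \<Rightarrow> 'a) \<Rightarrow> 'b \<Rightarrow> 'b" where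
  "transport_auto S T f \<alpha> = (\<lambda>y\<in>carrier T. f (\<alpha> (inv_into (carrier S) f y)))"

lemma transport_auto_hom:
  assumes "group S" "group T" "f \<in> iso S T"
  shows "transport_auto S T f \<in> hom (AutoGroup S) (AutoGroup T)"
proof -
  interpret S: group S by fact
  interpret T: group T by fact
  let ?g = "inv_into (carrier S) f"
  have f: "f \<in> hom S T" "bij_betw f (carrier S) (carrier T)" using assms(3) by (auto simp: iso_def)
  have g: "?g \<in> hom T S" "bij_betw ?g (carrier T) (carrier S)"
    using S.iso_set_sym[OF assms(3)] by (auto simp: iso_def)
  have gf: "?g (f x) = x" if "x \<in> carrier S" for x using f(2) that by (simp add: bij_betw_def)
  have gc: "?g y \<in> carrier S" if "y \<in> carrier T" for y using g(1) that by (rule hom_in_carrier)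
  have fc: "f x \<in> carrier T" if "x \<in> carrier S" for x using f(1) that by (rule hom_in_carrier)
  have auto: "transport_auto S T f \<alpha> \<in> auto T" if \<alpha>: "\<alpha> \<in> auto S" for \<alpha>
  proof -
    have a: "\<alpha> \<in> hom S S" "bij_betw \<alpha> (carrier S) (carrier S)"
      using \<alpha> by (auto simp: auto_def Bij_def)
    have ac: "\<alpha> x \<in> carrier S" if "x \<in> carrier S" for x using a(1) that by (rule hom_in_carrier)
    have "bij_betw (f \<circ> (\<alpha> \<circ> ?g)) (carrier T) (carrier T)"
      by (rule bij_betw_trans[OF bij_betw_trans[OF g(2) a(2)] f(2)])
    then have "bij_betw (transport_auto S T f \<alpha>) (carrier T) (carrier T)"
      by (subst bij_betw_cong[of _ _ "f \<circ> (\<alpha> \<circ> ?g)"]) (simp_all add: transport_auto_def)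
    moreover have "transport_auto S T f \<alpha> \<in> hom T T"
      by (rule homI) (simp_all add: transport_auto_def gc ac fc hom_mult[OF g(1)] hom_mult[OF a(1)] hom_mult[OF f(1)])
    ultimately show ?thesis by (simp add: auto_def Bij_def transport_auto_def)
  qed
  show ?thesis
  proof (rule homI)
    fix \<alpha> assume "\<alpha> \<in> carrier (AutoGroup S)"
    then show "transport_auto S T f \<alpha> \<in> carrier (AutoGroup T)" using auto by (simp add: AutoGroup_def)
  next
    fix \<alpha> \<beta> assume "\<alpha> \<in> carrier (AutoGroup S)" "\<beta> \<in> carrier (AutoGroup S)"
    then have ab: "\<alpha> \<in> auto S" "\<beta> \<in> auto S" by (simp_all add: AutoGroup_def)
    have Bij: "\<gamma> \<in> Bij (carrier S)" "transport_auto S T f \<gamma> \<in> Bij (carrier T)" if "\<gamma> \<in> auto S" for \<gamma>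
      using that auto[OF that] by (auto simp: auto_def)
    have bc: "\<beta> x \<in> carrier S" if "x \<in> carrier S" for x
      using ab(2) that by (auto simp: auto_def intro: hom_in_carrier)
    have "transport_auto S T f (compose (carrier S) \<alpha> \<beta>)
        = compose (carrier T) (transport_auto S T f \<alpha>) (transport_auto S T f \<beta>)"
      by (rule ext) (simp add: transport_auto_def compose_def gc bc gf fc)
    then show "transport_auto S T f (\<alpha> \<otimes>\<^bsub>AutoGroup S\<^esub> \<beta>)
        = transport_auto S T f \<alpha> \<otimes>\<^bsub>AutoGroup T\<^esub> transport_auto S T f \<beta>"
      using Bij[OF ab(1)] Bij[OF ab(2)] by (simp add: AutoGroup_def BijGroup_def)
  qed
qed

lemma suzuki_2_group_iso:
  assumes grp: "group S" "group T" and f: "f \<in> iso S T" and suz: "suzuki_2_group S"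
  shows "suzuki_2_group T"
proof -
  interpret S: group S by fact
  interpret T: group T by fact
  have bij: "bij_betw f (carrier S) (carrier T)" and hom: "f \<in> hom S T" using f by (auto simp: iso_def)
  have card: "card (carrier T) = card (carrier S)" using bij_betw_same_card[OF bij] by simp
  have inv: "f ` involutions S = involutions T" by (rule involutions_iso[OF grp f])
  have inj: "inj_on f (involutions S)"
    using bij by (auto simp: bij_betw_def involutions_def intro: inj_on_subset)
  have "card (involutions T) = card (involutions S)"
    using card_image[OF inj] inv by simp
  moreover have "\<not> comm_group T"
  proof
    assume "comm_group T"
    then interpret T': comm_group T .
    have "comm_group S"
    proof (rule S.group_comm_groupI)
      fix x y assume xy: "x \<in> carrier S" "y \<in> carrier S"
      then have "f (x \<otimes>\<^bsub>S\<^esub> y) = f (y \<otimes>\<^bsub>S\<^esub> x)"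
        using hom T'.m_comm by (simp add: hom_mult hom_in_carrier)
      then show "x \<otimes>\<^bsub>S\<^esub> y = y \<otimes>\<^bsub>S\<^esub> x" using bij xy by (auto simp: bij_betw_def inj_on_def)
    qed
    then show False using suz by (simp add: suzuki_2_group_def)
  qed
  moreover have "finite (carrier T)"
    using suz bij bij_betw_finite by (auto simp: suzuki_2_group_def)
  moreover obtain A where A: "subgroup A (AutoGroup S)" "solvable (AutoGroup S\<lparr>carrier := A\<rparr>)"
    and trans: "\<And>x y. x \<in> involutions S \<Longrightarrow> y \<in> involutions S \<Longrightarrow> \<exists>\<alpha>\<in>A. \<alpha> x = y"
    using suz unfolding suzuki_2_group_def by blast
  let ?t = "transport_auto S T f"
  interpret t: group_hom "AutoGroup S" "AutoGroup T" ?t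
    using S.AutoGroup T.AutoGroup transport_auto_hom[OF grp f]
    by (simp add: group_hom_def group_hom_axioms_def)
  have sub: "subgroup (?t ` A) (AutoGroup T)" by (rule t.subgroup_img_is_subgroup[OF A(1)])
  have "group_hom (AutoGroup S\<lparr>carrier := A\<rparr>) (AutoGroup T\<lparr>carrier := ?t ` A\<rparr>) ?t"
    using subgroup.subgroup_is_group[OF A(1) S.AutoGroup] subgroup.subgroup_is_group[OF sub T.AutoGroup]
      subgroup.subset[OF A(1)] hom_mult[OF transport_auto_hom[OF grp f]]
    by (auto simp: group_hom_def group_hom_axioms_def hom_def subset_iff)
  \<comment> \<open>The transported group is a homomorphic image of the solvable group
    \<open>A\<close>.\<close>
  then have "solvable (AutoGroup T\<lparr>carrier := ?t ` A\<rparr>)"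
    by (rule group_hom.surj_hom_imp_solvable) (simp_all add: A(2))
  moreover have "\<exists>\<alpha>\<in>?t ` A. \<alpha> x = y" if xy: "x \<in> involutions T" "y \<in> involutions T" for x y
  proof -
    obtain u v where uv: "u \<in> involutions S" "x = f u" "v \<in> involutions S" "y = f v"
      using xy unfolding inv[symmetric] by blast
    then obtain \<alpha> where \<alpha>: "\<alpha> \<in> A" "\<alpha> u = v" using trans by blast
    have u: "u \<in> carrier S" using uv(1) by (simp add: involutions_def)
    have "x \<in> carrier T" using xy(1) by (simp add: involutions_def)
    then have "?t \<alpha> x = y" using uv \<alpha>(2) u bij by (simp add: transport_auto_def bij_betw_def)
    then show ?thesis using \<alpha>(1) by blast
  qed
  ultimately show ?thesis
    using suz sub grp card unfolding suzuki_2_group_def by auto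
qed

section \<open>The Sylow subgroup\<close>

text \<open>The Suzuki group \<open>A(3, \<theta>)\<close> of order 64, a Sylow 2-subgroup of \<open>Sz(8)\<close>.\<close>

fun szmult :: "gf8 \<times> gf8 \<Rightarrow> gf8 \<times> gf8 \<Rightarrow> gf8 \<times> gf8" where
  "szmult (a, b) (a', b') = (a + a', b + b' + a * fr a')"

definition sz :: "(gf8 \<times> gf8) monoid" where
  "sz = \<lparr>carrier = UNIV, monoid.mult = szmult, one = (0, 0)\<rparr>"

lemma sz_simps [simp]: "carrier sz = UNIV" "x \<otimes>\<^bsub>sz\<^esub> y = szmult x y" "\<one>\<^bsub>sz\<^esub> = (0, 0)"
  by (simp_all add: sz_def)

lemma group_sz: "group sz"
proof (rule groupI)
  fix x y z
  show "x \<otimes>\<^bsub>sz\<^esub> y \<otimes>\<^bsub>sz\<^esub> z = x \<otimes>\<^bsub>sz\<^esub> (y \<otimes>\<^bsub>sz\<^esub> z)"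
    by (cases x; cases y; cases z) (simp add: algebra_simps)
  show "\<one>\<^bsub>sz\<^esub> \<otimes>\<^bsub>sz\<^esub> x = x" by (cases x) simp
  obtain a b where "x = (a, b)" by (metis prod.exhaust)
  then show "\<exists>y\<in>carrier sz. y \<otimes>\<^bsub>sz\<^esub> x = \<one>\<^bsub>sz\<^esub>"
    by (intro bexI[of _ "(a, b + a * fr a)"]) simp_all
qed auto

text \<open>Scaling \<open>a\<close> by \<open>u\<close> forces the factor \<open>u * fr u\<close>
  on \<open>b\<close>, because of the term \<open>a * fr a'\<close> in
  \<open>szmult\<close>.\<close>

definition sz_aut :: "gf8 \<Rightarrow> gf8 \<times> gf8 \<Rightarrow> gf8 \<times> gf8" where
  "sz_aut u = (\<lambda>(a, b). (u * a, u * fr u * b))"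

lemma sz_aut_comp: "compose UNIV (sz_aut u) (sz_aut v) = sz_aut (u * v)"
  by (rule ext) (auto simp: compose_def sz_aut_def)

lemma sz_aut_one: "sz_aut 1 = (\<lambda>x\<in>UNIV. x)"
  by (rule ext) (auto simp: sz_aut_def)

lemma sz_aut_auto: "u \<noteq> 0 \<Longrightarrow> sz_aut u \<in> auto sz"
proof -
  assume u: "u \<noteq> 0"
  have "inj (sz_aut u)" using u by (auto simp: inj_on_def sz_aut_def)
  then have "bij (sz_aut u)" using finite_UNIV_inj_surj[OF finite_UNIV] by (simp add: bij_def)
  moreover have "sz_aut u \<in> hom sz sz"
    by (rule homI) (auto simp: sz_aut_def algebra_simps)
  ultimately show ?thesis by (simp add: auto_def Bij_def)
qed

lemma suzuki_2_group_sz: "suzuki_2_group sz"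
proof -
  interpret sz: group sz by (rule group_sz)
  let ?A = "sz_aut ` (UNIV - {0})"
  have mult: "sz_aut u \<otimes>\<^bsub>AutoGroup sz\<^esub> sz_aut v = sz_aut (u * v)" if "u \<noteq> 0" "v \<noteq> 0" for u v
    using sz_aut_auto[OF that(1)] sz_aut_auto[OF that(2)]
    by (simp add: AutoGroup_def BijGroup_def auto_def sz_aut_comp)
  have one: "\<one>\<^bsub>AutoGroup sz\<^esub> = sz_aut 1" by (simp add: AutoGroup_def BijGroup_def sz_aut_one)
  have car: "sz_aut u \<in> carrier (AutoGroup sz)" if "u \<noteq> 0" for u
    using sz_aut_auto[OF that] by (simp add: AutoGroup_def)
  interpret Aut: group "AutoGroup sz" by (rule sz.AutoGroup)
  have sub: "subgroup ?A (AutoGroup sz)"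
  proof (rule Aut.subgroupI)
    show "?A \<subseteq> carrier (AutoGroup sz)" using car by auto
    have "sz_aut 1 \<in> ?A" by (rule imageI) simp
    then show "?A \<noteq> {}" by (metis empty_iff)
    fix \<alpha> assume "\<alpha> \<in> ?A"
    then obtain u where u: "u \<noteq> 0" "\<alpha> = sz_aut u" by auto
    have "inv\<^bsub>AutoGroup sz\<^esub> \<alpha> = sz_aut (1 / u)"
      using u by (intro Aut.inv_equality) (auto simp: mult one car)
    then show "inv\<^bsub>AutoGroup sz\<^esub> \<alpha> \<in> ?A" using u by auto
  next
    fix \<alpha> \<beta> assume "\<alpha> \<in> ?A" "\<beta> \<in> ?A"
    then show "\<alpha> \<otimes>\<^bsub>AutoGroup sz\<^esub> \<beta> \<in> ?A" using mult by auto
  qed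
  interpret A: group "AutoGroup sz\<lparr>carrier := ?A\<rparr>"
    by (rule subgroup.subgroup_is_group[OF sub sz.AutoGroup])
  interpret A: comm_group "AutoGroup sz\<lparr>carrier := ?A\<rparr>"
    by (rule A.group_comm_groupI) (auto simp: mult mult.commute)
  \<comment> \<open>The acting group is abelian, so its derived series ends after one step.\<close>
  have "((derived (AutoGroup sz\<lparr>carrier := ?A\<rparr>)) ^^ 1) ?A = {\<one>\<^bsub>AutoGroup sz\<lparr>carrier := ?A\<rparr>\<^esub>}"
    using A.derived_eq_singleton[of ?A] by simp
  then have solv: "solvable (AutoGroup sz\<lparr>carrier := ?A\<rparr>)"
    unfolding A.solvable_iff_trivial_derived_seq by (intro exI[of _ 1]) simp
  have inv: "involutions sz = {0} \<times> (UNIV - {0})"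
    by (auto simp: involutions_def)
  have trans: "\<exists>\<alpha>\<in>?A. \<alpha> x = y" if xy: "x \<in> involutions sz" "y \<in> involutions sz" for x y
  proof -
    obtain b c where bc: "x = (0, b)" "y = (0, c)" "b \<noteq> 0" "c \<noteq> 0" using xy inv by auto
    \<comment> \<open>The requirement is u^3 b = c; the square of b / c solves it because (b / c)^6
      = c / b.\<close>
    define u where "u = fr (b / c)"
    have u: "u \<noteq> 0" using bc by (simp add: u_def)
    have "fr (fr u) = b / c" by (simp only: u_def fr_fr_fr)
    then have "u * fr u * (b / c) = 1" using norm_gf8[OF u] by simp
    then have "u * fr u * b = c" using bc(4) by (simp add: field_simps)
    then have "sz_aut u x = y" by (simp add: bc sz_aut_def)
    then show ?thesis using u by blast
  qed
  have "\<not> comm_group sz"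
  proof
    assume "comm_group sz"
    then interpret c: comm_group sz .
    have "szmult (1, 0) (GF8 False True False, 0) = szmult (GF8 False True False, 0) (1, 0)"
      using c.m_comm[of "(1, 0)" "(GF8 False True False, 0)"] by simp
    then show False by (simp add: fr_def one_gf8_def zero_gf8_def)
  qed
  moreover have "card (involutions sz) > 1" unfolding inv by (simp add: card_cartesian_product card_Diff_singleton card_gf8)
  moreover have "finite (carrier sz)" by simp
  moreover have "card (carrier sz) = 2 ^ 6"
    by (simp add: UNIV_Times_UNIV[symmetric] card_cartesian_product card_gf8 del: UNIV_Times_UNIV)
  ultimately show ?thesis unfolding suzuki_2_group_def
  proof (intro conjI)
    show "\<exists>A. subgroup A (AutoGroup sz) \<and> solvable (AutoGroup sz\<lparr>carrier := A\<rparr>) \<and>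
        (\<forall>x\<in>involutions sz. \<forall>y\<in>involutions sz. \<exists>\<alpha>\<in>A. \<alpha> x = y)"
      using sub solv trans by blast
    show "\<exists>k. card (carrier sz) = 2 ^ k" using \<open>card (carrier sz) = 2 ^ 6\<close> by blast
    show "group sz" by (rule group_sz)
  qed
qed

section \<open>The Sylow 2-subgroup and its upper central series\<close>

definition syl_grp :: "elt monoid" where
  "syl_grp = grp\<lparr>carrier := syl\<rparr>"

lemma syl_grp_simps [simp]: "carrier syl_grp = syl" "x \<otimes>\<^bsub>syl_grp\<^esub> y = gmult x y" "\<one>\<^bsub>syl_grp\<^esub> = (0, sone)"
  by (simp_all add: syl_grp_def)

text \<open>As 2048 is prime to 3 and 7, both the Galois component and the constant coefficient must
  be trivial.\<close>

lemma pow_2048_imp_syl: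
  assumes x: "x \<in> carrier grp" and pow: "x [^]\<^bsub>grp\<^esub> (2 ^ 11 :: nat) = \<one>\<^bsub>grp\<^esub>"
  shows "x \<in> syl"
proof -
  have "(2 ^ 11 * fst x) mod 3 = 0"
    unfolding fst_grp_pow[of x "2 ^ 11", symmetric] pow by simp
  moreover have "fst x \<in> {0, 1, 2}" using x by (auto simp: mem_grp)
  ultimately have f: "fst x = 0" by auto
  let ?u = "unit_coeff (snd x)"
  have u0: "?u \<noteq> 0" using x by (simp add: mem_grp)
  have "?u ^ (2 ^ 11) = 1"
    unfolding unit_coeff_grp_pow[OF f, of "2 ^ 11", symmetric] pow by (simp add: sone_def)
  moreover have "?u ^ (2 ^ 11) = ?u ^ 4"
  proof -
    \<comment> \<open>Modulo 7 the exponent is 4, so the power is the twofold Frobenius image, which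
      is 1 only for 1.\<close>
    have p: "(2 ^ 11 :: nat) = 7 * 292 + 4" by simp
    show ?thesis unfolding p power_add power_mult gf8_pow7[OF u0] by simp
  qed
  moreover have "fr (fr ?u) = ?u ^ 4" by (simp add: fr_def eval_nat_numeral ac_simps)
  ultimately have "fr (fr ?u) = 1" by metis
  then have "?u = 1" by (simp only: fr_eq_1_iff)
  then show ?thesis using x f by (simp add: mem_syl mem_grp)
qed

lemma subgroup_syl: "subgroup syl grp"
proof (rule grp.subgroupI)
  show "syl \<subseteq> carrier grp" by (rule syl_subset)
  have "(0, sone) \<in> syl" by (simp add: mem_syl sone_def nu.simps)
  then show "syl \<noteq> {}" by blast
  fix x y assume x: "x \<in> syl" and y: "y \<in> syl"
  have "x \<otimes>\<^bsub>grp\<^esub> y \<in> carrier grp" using x y syl_subset by (intro grp.m_closed) auto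
  then show "x \<otimes>\<^bsub>grp\<^esub> y \<in> syl" using x y by (simp add: mem_syl mem_grp fst_gmult unit_coeff_gmult)
next
  fix x assume x: "x \<in> syl"
  then have xc: "x \<in> carrier grp" using syl_subset by blast
  let ?y = "inv\<^bsub>grp\<^esub> x"
  have yc: "?y \<in> carrier grp" using xc by (rule grp.inv_closed)
  have yx: "gmult ?y x = (0, sone)" using grp.l_inv[OF xc] by simp
  have fx: "fst x = 0" "unit_coeff (snd x) = 1" using x by (simp_all add: mem_syl)
  have "fst ?y mod 3 = 0" using arg_cong[OF yx, of fst] fx by (simp add: fst_gmult)
  moreover have "fst ?y < 3" using yc by (simp add: mem_grp)
  moreover have "unit_coeff (snd ?y) = 1"
    using arg_cong[OF yx, of "\<lambda>z. unit_coeff (snd z)"] fx by (simp add: unit_coeff_gmult sone_def)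
  ultimately show "?y \<in> syl" using yc by (simp add: mem_syl mem_grp)
qed

lemma group_syl_grp: "group syl_grp"
  unfolding syl_grp_def by (rule subgroup.subgroup_is_group[OF subgroup_syl group_grp])

text \<open>Elements of \<open>P\<close> are killed by the exponent |P|, so \<open>P\<close> lies in
  \<open>syl\<close>, and the cardinalities agree.\<close>

lemma sylow_grp_eq:
  assumes "sylow_subgroup 2 P grp"
  shows "P = syl"
proof -
  have P: "subgroup P grp" and card: "card P = 2 ^ 11"
    using assms by (simp_all add: sylow_subgroup_def multiplicity_card_grp)
  interpret P: subgroup P grp by (rule P)
  interpret PG: group "grp\<lparr>carrier := P\<rparr>" by (rule P.subgroup_is_group[OF group_grp])
  have "x \<in> syl" if x: "x \<in> P" for x
  proof (rule pow_2048_imp_syl)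
    show "x \<in> carrier grp" using x P.subset by blast
    have order: "Coset.order (grp\<lparr>carrier := P\<rparr>) = 2 ^ 11" using card by (simp add: Coset.order_def)
    have pow: "x [^]\<^bsub>grp\<lparr>carrier := P\<rparr>\<^esub> n = x [^]\<^bsub>grp\<^esub> n" for n :: nat
      by (simp add: nat_pow_def)
    have "x [^]\<^bsub>grp\<lparr>carrier := P\<rparr>\<^esub> Coset.order (grp\<lparr>carrier := P\<rparr>) = \<one>\<^bsub>grp\<lparr>carrier := P\<rparr>\<^esub>"
      using PG.pow_order_eq_1[of x] x by simp
    then show "x [^]\<^bsub>grp\<^esub> (2 ^ 11 :: nat) = \<one>\<^bsub>grp\<^esub>"
      unfolding order pow by simp
  qed
  then show ?thesis
    using card card_syl finite_subset[OF syl_subset finite_grp] by (intro card_subset_eq) auto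
qed

text \<open>Test elements with arbitrary coefficient of X, against which centrality is checked; the
  norm of \<open>a\<close> as coefficient of X^3 makes \<open>nu\<close> vanish.\<close>

lemma syl_witness: "(0, (1, a, 0, a * fr a * fr (fr a), 0)) \<in> syl"
proof -
  have "tr (a * fr a * fr (fr a)) = a * fr a * fr (fr a)"
    using norm_0_or_1[of a] by (metis tr_0 tr_1)
  then show ?thesis by (simp add: mem_syl nu.simps)
qed

lemma coset_layer_0:
  "range (layer 0) #>\<^bsub>syl_grp\<^esub> (0, (1, a, b, c, d)) = range (\<lambda>e. (0, (1, a, b, c, e)))"
proof (intro equalityI subsetI)
  fix x assume "x \<in> range (layer 0) #>\<^bsub>syl_grp\<^esub> (0, (1, a, b, c, d))"
  then show "x \<in> range (\<lambda>e. (0, (1, a, b, c, e)))" by (auto simp: r_coset_def layer_def)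
next
  fix x assume "x \<in> range (\<lambda>e :: gf8. (0 :: nat, (1 :: gf8, a, b, c, e)))"
  then obtain e where "x = (0, (1, a, b, c, e))" by blast
  then have "x = layer 0 (d + e) \<otimes>\<^bsub>syl_grp\<^esub> (0, (1, a, b, c, d))"
    by (simp add: layer_def ac_simps)
  then show "x \<in> range (layer 0) #>\<^bsub>syl_grp\<^esub> (0, (1, a, b, c, d))" unfolding r_coset_def by blast
qed

text \<open>For nonzero \<open>a\<close> the equation a a'^2 = a' a^2 has only the solutions 0 and
  \<open>a\<close>.\<close>

lemma exists_noncommuting: "a \<noteq> 0 \<Longrightarrow> \<exists>a'. a * fr a' \<noteq> a' * fr a"
proof (rule ccontr)
  assume a: "a \<noteq> 0" and no: "\<nexists>a'. a * fr a' \<noteq> a' * fr a"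
  then have "a * fr (GF8 False True False) = GF8 False True False * fr a" by blast
  moreover have "a * fr 1 = 1 * fr a" using no by blast
  then have "a = 1" using a by (simp add: fr_def)
  ultimately show False by (simp add: fr_def one_gf8_def)
qed

text \<open>Testing with 1 puts \<open>b\<close> into the prime field; testing with t, which
  \<open>fr\<close> moves, then excludes \<open>b = 1\<close>.\<close>

lemma eq_0_of_commuting:
  assumes "\<And>a. b * fr (fr a) = a * fr b"
  shows "b = 0"
  using assms[of 1] assms[of "GF8 False True False"]
  by (cases b rule: gf8_cases) (simp_all add: fr_def zero_gf8_def one_gf8_def)

lemma center_syl_grp: "center syl_grp = range (layer 0)"
proof (intro equalityI subsetI)
  fix x assume "x \<in> range (layer 0)"
  then obtain d where x: "x = layer 0 d" by blast
  have "gmult x y = gmult y x" if "y \<in> syl" for y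
    by (rule mem_sylE[OF that]) (simp add: x layer_def add.commute)
  moreover have "x \<in> syl" unfolding x layer_mem_syl by simp
  ultimately show "x \<in> center syl_grp" by (simp add: Defs.center_def)
next
  fix x assume x: "x \<in> center syl_grp"
  have xs: "x \<in> syl" using x by (simp add: Defs.center_def)
  have comm: "gmult x y = gmult y x" if "y \<in> syl" for y
    using x that by (simp add: Defs.center_def)
  obtain a b c d where x: "x = (0, (1, a, b, c, d))" using mem_sylE[OF xs] .
  have a: "a = 0"
  proof (rule ccontr)
    assume "a \<noteq> 0"
    then obtain a' where "a * fr a' \<noteq> a' * fr a" using exists_noncommuting by blast
    then show False using comm[OF syl_witness, of a'] by (simp add: x)
  qed
  have "b * fr (fr a') = a' * fr b" for a'
    using comm[OF syl_witness, of a'] by (simp add: x a)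
  then have b: "b = 0" by (rule eq_0_of_commuting)
  \<comment> \<open>A Frobenius-fixed \<open>c\<close> is 0 or 1, and 1 has trace 1.\<close>
  have "c = fr c" using comm[OF syl_witness, of 1] by (simp add: x a b)
  moreover have "tr c = 0" using xs by (simp add: x a b mem_syl nu.simps)
  ultimately have "c = 0" by (cases c rule: gf8_cases) (simp_all add: tr_def fr_def zero_gf8_def)
  then show "x \<in> range (layer 0)" by (auto simp: x a b layer_def)
qed

lemma upper_central_2_syl_grp: "upper_central syl_grp 2 = {layer c d | c d. tr c = 0}"
proof -
  interpret P: group syl_grp by (rule group_syl_grp)
  let ?Z = "range (layer 0)"
  have Z: "upper_central syl_grp 1 = ?Z" unfolding P.upper_central_1 center_syl_grp ..
  have mem: "x \<in> upper_central syl_grp 2 \<longleftrightarrow>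
      x \<in> syl \<and> (\<forall>y\<in>syl. ?Z #>\<^bsub>syl_grp\<^esub> gmult x y = ?Z #>\<^bsub>syl_grp\<^esub> gmult y x)" for x
    using P.upper_central_Suc_cosets[of x 1] unfolding Z Suc_1 by simp
  show ?thesis
  proof (intro equalityI subsetI)
    fix x assume "x \<in> {layer c d | c d. tr c = 0}"
    then obtain c d where x: "x = layer c d" "tr c = 0" by blast
    have "?Z #>\<^bsub>syl_grp\<^esub> gmult x y = ?Z #>\<^bsub>syl_grp\<^esub> gmult y x" if y: "y \<in> syl" for y
    proof -
      obtain a' b' c' d' where y: "y = (0, (1, a', b', c', d'))" using mem_sylE[OF y] .
      have "gmult x y = (0, (1, a', b', c + c', d + d' + c * a'))" "gmult y x = (0, (1, a', b', c + c', d + d' + a' * fr c))"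
        by (simp_all add: x y layer_def ac_simps)
      \<comment> \<open>The two products differ only in the coefficient of X^4, which the center
        absorbs.\<close>
      then show ?thesis by (simp only: coset_layer_0)
    qed
    then show "x \<in> upper_central syl_grp 2" unfolding mem using x by (simp add: layer_mem_syl)
  next
    fix x assume "x \<in> upper_central syl_grp 2"
    then have xs: "x \<in> syl"
      and comm: "\<And>y. y \<in> syl \<Longrightarrow> ?Z #>\<^bsub>syl_grp\<^esub> gmult x y = ?Z #>\<^bsub>syl_grp\<^esub> gmult y x"
      unfolding mem by auto
    obtain a b c d where x: "x = (0, (1, a, b, c, d))" using mem_sylE[OF xs] .
    \<comment> \<open>Equal cosets agree up to degree 3; comparing degrees 2 and 3 of the products
      with a test element gives the two equations.\<close>
    have eq: "a * fr a' = a' * fr a \<and> b * fr (fr a') = a' * fr b" for a'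
    proof -
      define n where "n = a' * fr a' * fr (fr a')"
      have xy: "gmult x (0, (1, a', 0, n, 0)) = (0, (1, a + a', b + a * fr a', c + n + b * fr (fr a'), d + a * fr n + c * a'))"
        and yx: "gmult (0, (1, a', 0, n, 0)) x = (0, (1, a + a', b + a' * fr a, c + n + a' * fr b, d + a' * fr c + n * a))"
        by (simp_all add: x ac_simps)
      have "range (\<lambda>e :: gf8. (0 :: nat, (1 :: gf8, a + a', b + a * fr a', c + n + b * fr (fr a'), e)))
          = range (\<lambda>e. (0, (1, a + a', b + a' * fr a, c + n + a' * fr b, e)))"
        using comm[OF syl_witness[of a']] unfolding n_def[symmetric] xy yx coset_layer_0 .
      then have "(0, (1, a + a', b + a * fr a', c + n + b * fr (fr a'), 0))
          \<in> range (\<lambda>e :: gf8. (0 :: nat, (1 :: gf8, a + a', b + a' * fr a, c + n + a' * fr b, e)))" by blast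
      then show ?thesis by auto
    qed
    have a: "a = 0" using eq exists_noncommuting[of a] by blast
    have "b * fr (fr a') = a' * fr b" for a' using eq by blast
    then have b: "b = 0" by (rule eq_0_of_commuting)
    show "x \<in> {layer c d | c d. tr c = 0}"
      using xs layer_mem_syl[of c d] by (auto simp: x a b layer_def)
  qed
qed

fun top_layers :: "elt \<Rightarrow> gf8 \<times> gf8" where
  "top_layers (j, u, a, b, c, d) = (a, b)"

lemma top_layers_hom: "top_layers \<in> hom syl_grp sz"
  by (rule homI) (auto elim!: mem_sylE)

lemma top_layers_surj: "top_layers ` syl = UNIV"
proof -
  have "(a, b) \<in> top_layers ` syl" for a b
  proof -
    \<comment> \<open>The X^3-coefficient \<open>nu_tail 1 a b\<close> lifts the pair into
      \<open>syl\<close>, because \<open>tr\<close> fixes \<open>nu_tail\<close>, so the two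
      contributions to \<open>nu\<close> cancel.\<close>
    have "nu (1, a, b, 1 * (nu_tail 1 a b), 0) = 0"
      using nu_tail_eq[of 1 a b "nu_tail 1 a b" 0] by simp
    then have "(0, (1, a, b, nu_tail 1 a b, 0)) \<in> syl" by (simp add: mem_syl)
    then show ?thesis by (rule rev_image_eqI) simp
  qed
  then show ?thesis by auto
qed

lemma kernel_top_layers: "kernel syl_grp sz top_layers = upper_central syl_grp 2"
  unfolding upper_central_2_syl_grp kernel_def
  by (auto simp: layer_mem_syl elim!: mem_sylE) (auto simp: layer_def mem_syl nu.simps)

text \<open>The first isomorphism theorem for the projection to \<open>sz\<close>, stated for any
  isomorphic copy \<open>K\<close> because the final group lives on the natural numbers.\<close>

lemma suzuki_2_group_quotient:
  assumes K: "group K" and e: "e \<in> iso K syl_grp"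
  shows "suzuki_2_group (K Mod upper_central K 2)"
proof -
  interpret K: group K by fact
  let ?h = "top_layers \<circ> e"
  have e': "e \<in> hom K syl_grp" "e ` carrier K = syl" using e by (auto simp: iso_def bij_betw_def)
  have inj: "inj_on e (carrier K)" using e by (auto simp: iso_def bij_betw_def)
  have "?h \<in> hom K sz" by (rule hom_compose[OF e'(1) top_layers_hom])
  then interpret h: group_hom K sz ?h
    using K group_sz by (simp add: group_hom_def group_hom_axioms_def)
  have surj: "?h ` carrier K = carrier sz" unfolding image_comp[symmetric] e'(2) top_layers_surj by simp
  have eu: "e ` upper_central K 2 = upper_central syl_grp 2"
    by (rule upper_central_iso[OF K group_syl_grp e])
  have sub: "upper_central K 2 \<subseteq> carrier K"
    using K.upper_central_normal by (simp add: normal_imp_subgroup subgroup.subset)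
  have kernel: "kernel K sz ?h = upper_central K 2"
  proof (intro equalityI subsetI)
    fix x assume "x \<in> kernel K sz ?h"
    then have x: "x \<in> carrier K" "top_layers (e x) = (0, 0)" by (auto simp: kernel_def)
    then have "e x \<in> kernel syl_grp sz top_layers" using e'(2) by (auto simp: kernel_def)
    then have "e x \<in> e ` upper_central K 2" unfolding kernel_top_layers eu .
    then show "x \<in> upper_central K 2" using inj_on_image_mem_iff[OF inj x(1) sub] by blast
  next
    fix x assume x: "x \<in> upper_central K 2"
    then have "e x \<in> kernel syl_grp sz top_layers" unfolding kernel_top_layers eu[symmetric] by (rule imageI)
    then show "x \<in> kernel K sz ?h" using x sub by (auto simp: kernel_def)
  qed
  let ?q = "\<lambda>C. the_elem (?h ` C)"
  have "?q \<in> iso (K Mod upper_central K 2) sz"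
    using h.FactGroup_iso_set[OF surj] unfolding kernel .
  moreover have Q: "group (K Mod upper_central K 2)"
    by (rule normal.factorgroup_is_group[OF K.upper_central_normal])
  ultimately have "inv_into (carrier (K Mod upper_central K 2)) ?q \<in> iso sz (K Mod upper_central K 2)"
    by (intro group.iso_set_sym)
  then show ?thesis by (rule suzuki_2_group_iso[OF group_sz Q _ suzuki_2_group_sz])
qed

text \<open>Both sides are counted by real conjugacy classes, which an isomorphism visibly permutes
  into each other; no representation is transported.\<close>

lemma real_valued_Irr_iso_card:
  assumes "finite_group G" "finite_group H" "e \<in> iso G H"
  shows "card (real_valued_Irr G) = card (real_valued_Irr H)"
proof -
  interpret G: finite_group G by fact
  interpret H: finite_group H by fact
  interpret e: group_hom G H e
    using assms(3) G.is_group H.is_group by (simp add: group_hom_def group_hom_axioms_def iso_def)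
  have surj: "carrier H = e ` carrier G" and inj: "inj_on e (carrier G)"
    using assms(3) by (auto simp: iso_def bij_betw_def)
  have cl: "H.conj_class (e x) = e ` G.conj_class x" if "x \<in> carrier G" for x
    unfolding H.conj_class_def G.conj_class_def surj image_image
    by (rule image_cong) (simp_all add: that)
  have "inv\<^bsub>H\<^esub> (e x) \<in> H.conj_class (e x) \<longleftrightarrow> inv\<^bsub>G\<^esub> x \<in> G.conj_class x" if x: "x \<in> carrier G" for x
    using inj_on_image_mem_iff[OF inj G.inv_closed[OF x] G.conj_class_subset[OF x]] x
    by (simp add: cl e.hom_inv[symmetric] del: e.hom_inv)
  then have "{y \<in> carrier H. inv\<^bsub>H\<^esub> y \<in> H.conj_class y} = e ` {x \<in> carrier G. inv\<^bsub>G\<^esub> x \<in> G.conj_class x}"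
    unfolding surj by auto
  then have "H.conj_class ` {y \<in> carrier H. inv\<^bsub>H\<^esub> y \<in> H.conj_class y}
      = (\<lambda>C. e ` C) ` G.conj_class ` {x \<in> carrier G. inv\<^bsub>G\<^esub> x \<in> G.conj_class x}"
    by (auto simp: image_image cl intro!: image_cong)
  moreover have "inj_on (\<lambda>C. e ` C) (G.conj_class ` {x \<in> carrier G. inv\<^bsub>G\<^esub> x \<in> G.conj_class x})"
    by (rule inj_on_subset[OF inj_on_image_Pow[OF inj]]) (use G.conj_class_subset in blast)
  ultimately show ?thesis
    unfolding G.card_real_valued_Irr H.card_real_valued_Irr by (simp add: card_image)
qed

lemma exists_nat_group_iso:
  assumes "group G" "finite (carrier G)"
  obtains N :: "nat monoid" and e where "group N" "e \<in> iso N G"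
proof -
  interpret group G by fact
  obtain f :: "'a \<Rightarrow> nat" where f: "inj_on f (carrier G)"
    using finite_imp_inj_to_nat_seg[OF assms(2)] by blast
  let ?g = "inv_into (carrier G) f"
  define N where "N = \<lparr>carrier = f ` carrier G, monoid.mult = (\<lambda>x y. f (?g x \<otimes>\<^bsub>G\<^esub> ?g y)), one = f \<one>\<^bsub>G\<^esub>\<rparr>"
  have gf: "?g (f x) = x" if "x \<in> carrier G" for x using f that by simp
  have N: "group N"
  proof (rule groupI)
    fix x assume "x \<in> carrier N"
    then obtain a where a: "a \<in> carrier G" "x = f a" by (auto simp: N_def)
    show "\<exists>y\<in>carrier N. y \<otimes>\<^bsub>N\<^esub> x = \<one>\<^bsub>N\<^esub>"
      by (rule bexI[of _ "f (inv\<^bsub>G\<^esub> a)"]) (simp_all add: a N_def gf)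
  qed (auto simp: N_def gf m_assoc)
  have "?g \<in> iso N G"
  proof (rule isoI)
    show "?g \<in> hom N G" by (rule homI) (auto simp: N_def gf)
    show "bij_betw ?g (carrier N) (carrier G)"
      using bij_betw_inv_into[of f "carrier G" "f ` carrier G"] f by (simp add: N_def bij_betw_def)
  qed
  then show thesis using that N by blast
qed

lemma sylow_subgroup_iso_image:
  assumes "group G" "group H" "e \<in> iso G H" "sylow_subgroup p P G"
  shows "sylow_subgroup p (e ` P) H"
proof -
  interpret e: group_hom G H e
    using assms by (simp add: group_hom_def group_hom_axioms_def iso_def)
  have bij: "bij_betw e (carrier G) (carrier H)" using assms(3) by (simp add: iso_def)
  have P: "subgroup P G" using assms(4) by (simp add: sylow_subgroup_def)
  have "inj_on e P" by (rule inj_on_subset[OF bij_betw_imp_inj_on[OF bij] subgroup.subset[OF P]])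
  then have "card (e ` P) = card P" by (rule card_image)
  then show ?thesis
    using assms(4) e.subgroup_img_is_subgroup[OF P] bij_betw_same_card[OF bij]
    by (simp add: sylow_subgroup_def)
qed

theorem mainTheorem2:
  shows "\<exists>G :: nat monoid.
           group G \<and> finite (carrier G) \<and> card (real_valued_Irr G) = 3 \<and>
           (\<forall>P. sylow_subgroup 2 P G \<longrightarrow>
                suzuki_2_group (G\<lparr>carrier := P\<rparr> Mod upper_central (G\<lparr>carrier := P\<rparr>) 2))"
proof -
  obtain N :: "nat monoid" and e where N: "group N" and e: "e \<in> iso N grp"
    using exists_nat_group_iso[OF group_grp finite_grp] .
  have bij: "bij_betw e (carrier N) (carrier grp)" and hom: "e \<in> hom N grp" using e by (auto simp: iso_def)
  have fin: "finite (carrier N)" using bij_betw_finite[OF bij] finite_grp by simp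
  have "card (real_valued_Irr N) = 3"
    using real_valued_Irr_iso_card[OF _ grp.finite_group_axioms e] N fin card_real_valued_Irr_grp
    by (simp add: finite_group_def finite_group_axioms_def)
  moreover have "suzuki_2_group (N\<lparr>carrier := P\<rparr> Mod upper_central (N\<lparr>carrier := P\<rparr>) 2)"
    if P: "sylow_subgroup 2 P N" for P
  proof (rule suzuki_2_group_quotient)
    have sub: "subgroup P N" using P by (simp add: sylow_subgroup_def)
    show "group (N\<lparr>carrier := P\<rparr>)" by (rule subgroup.subgroup_is_group[OF sub N])
    \<comment> \<open>The image of \<open>P\<close> is a Sylow 2-subgroup of \<open>grp\<close>, and
      there is only one.\<close>
    have eP: "e ` P = syl"
      by (rule sylow_grp_eq[OF sylow_subgroup_iso_image[OF N group_grp e P]])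
    have Pc: "P \<subseteq> carrier N" by (rule subgroup.subset[OF sub])
    show "e \<in> iso (N\<lparr>carrier := P\<rparr>) syl_grp"
    proof (rule isoI)
      show "e \<in> hom (N\<lparr>carrier := P\<rparr>) syl_grp"
      proof (rule homI)
        fix x y assume "x \<in> carrier (N\<lparr>carrier := P\<rparr>)" "y \<in> carrier (N\<lparr>carrier := P\<rparr>)"
        then have "x \<in> carrier N" "y \<in> carrier N" using Pc by auto
        then show "e (x \<otimes>\<^bsub>N\<lparr>carrier := P\<rparr>\<^esub> y) = e x \<otimes>\<^bsub>syl_grp\<^esub> e y"
          using hom_mult[OF hom] by simp
      qed (use eP in auto)
      show "bij_betw e (carrier (N\<lparr>carrier := P\<rparr>)) (carrier syl_grp)"
        using bij eP Pc by (auto simp: bij_betw_def intro: inj_on_subset)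
    qed
  qed
  ultimately show ?thesis using N fin by blast
qed

end
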